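(* Let $N\in\mathbb N$ (with $N\ge2$ when $R_N=D_N$), $r>0$, $0<t_\ast<\infty$, and $R_N\in\{A_N,B_N,B_N^\vee,C_N,C_N^\vee,BC_N,D_N\}$. For $t\in(0,t_\ast)$ let $\mathbf P^{R_N}_t$ be the probability measure on $S_N^{R_N}$ with density $\mathbf p^{R_N}_t(\mathbf x)=q^{R_N}_t(\mathbf x)/\prod_{n=1}^N m^{R_N}_n(t_\ast)$, where $S_N^{A_N}=\mathbb W_N^{[0,2\pi r)}=\{0\le x_1<\dots<x_N<2\pi r\}$ and $S_N^{R_N}=\mathbb W_N^{[0,\pi r]}=\{0\le x_1<\dots<x_N\le\pi r\}$ for the other six types, and let $\Xi^{R_N}=\sum_{j=1}^N\delta_{X_j}$ where $\mathbf X=(X_1,\dots,X_N)$ has law $\mathbf P^{R_N}_t$. Then, for each $t\in(0,t_\ast)$, $\Xi^{R_N}$ is a determinantal point process (on $[0,2\pi r)$ for $A_N$, on $[0,\pi r]$ otherwise) with correlation kernel \[ K^{R_N}_t(x,y;t_\ast,r)=\sum_{n=1}^N\frac{1}{m^{R_N}_n(t_\ast)}M^{R_N}_n(x,t)\,\overline{M^{R_N}_n(y,t_\ast-t)}, \] i.e. for every $1\le n\le N$ the $n$-point correlation function is $\rho_n(x_1,\dots,x_n)=\det_{1\le j,k\le n}[K^{R_N}_t(x_j,x_k;t_\ast,r)]$.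
   Context: Jacobi theta functions: for $v\in\mathbb C$, $\tau\in\mathbb H=\{\Im\tau>0\}$, $z=e^{\pi iv}$, $q=e^{\pi i\tau}$: $\vartheta_1(v;\tau)=i\sum_{n\in\mathbb Z}(-1)^nq^{(n-1/2)^2}z^{2n-1}$, $\vartheta_2(v;\tau)=\sum_{n\in\mathbb Z}q^{(n-1/2)^2}z^{2n-1}$. For $\sigma\in\mathbb R$, $z\in\mathbb C$, $\tau\in\mathbb H$: $\Theta^A(\sigma,z,\tau)=e^{2\pi i\sigma z}\vartheta_2(\sigma\tau+z;\tau)$, $\Theta^B=e^{2\pi i\sigma z}\vartheta_1(\sigma\tau+z;\tau)-e^{-2\pi i\sigma z}\vartheta_1(\sigma\tau-z;\tau)$, $\Theta^C=e^{2\pi i\sigma z}\vartheta_2(\sigma\tau+z;\tau)-e^{-2\pi i\sigma z}\vartheta_2(\sigma\tau-z;\tau)$, $\Theta^D=e^{2\pi i\sigma z}\vartheta_2(\sigma\tau+z;\tau)+e^{-2\pi i\sigma z}\vartheta_2(\sigma\tau-z;\tau)$. $\sharp(R_N)=A$ for $A_N$, $B$ for $B_N,B_N^\vee$, $C$ for $C_N,C_N^\vee,BC_N$, $D$ for $D_N$; $J^{R_N}(j)=j-1/2$ for $A_N,C_N^\vee$, $j-1$ for $B_N,B_N^\vee,D_N$, $j$ for $C_N,BC_N$; $\mathcal N^{A_N}=N$, $\mathcal N^{B_N}=2N-1$, $\mathcal N^{B_N^\vee}=\mathcal N^{C_N^\vee}=2N$, $\mathcal N^{C_N}=2(N+1)$,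 $\mathcal N^{BC_N}=2N+1$, $\mathcal N^{D_N}=2(N-1)$. $\xi(x)=x/(2\pi r)$, $\tau(t)=it/(2\pi r^2)$; $M^{R_N}_j(x,t)=\Theta^{\sharp(R_N)}\big(J^{R_N}(j)/\mathcal N^{R_N},\mathcal N^{R_N}\xi(x),(\mathcal N^{R_N})^2\tau(t)\big)$. $q^{R_N}_t(\mathbf x)=\det_{j,k}[\overline{M^{R_N}_j(x_k,t_\ast-t)}]\det_{\ell,m}[M^{R_N}_\ell(x_m,t)]$ (nonnegative, and integrating to $\prod_n m^{R_N}_n(t_\ast)$ over $S_N^{R_N}$). Constants: for $A_N,C_N,C_N^\vee,BC_N$: $m^{R_N}_j(t_\ast)=2\pi r\vartheta_2(\mathcal N^{R_N}J^{R_N}(j)\tau(t_\ast);(\mathcal N^{R_N})^2\tau(t_\ast))$; for $B_N,B_N^\vee$: $m_1=4\pi r\vartheta_2(0;(\mathcal N^{R_N})^2\tau(t_\ast))$, $m_j=2\pi r\vartheta_2(\mathcal N^{R_N}J^{R_N}(j)\tau(t_\ast);(\mathcal N^{R_N})^2\tau(t_\ast))$ ($j\ge2$); for $D_N$: $m_1=4\pi r\vartheta_2(0;(\mathcal N^{D_N})^2\tau(t_\ast))$, $m_j=2\pi r\vartheta_2(\mathcal N^{D_N}J^{D_N}(j)\tau(t_\ast);(\mathcal N^{D_N})^2\tau(t_\ast))$ ($2\le j\le N-1$), $m_N=4\pi r\vartheta_2(\mathcal N^{D_N}(N-1)\tau(t_\ast);(\mathcal N^{D_N})^2\tau(t_\ast))$.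 The $n$-point correlation function $\rho_n$ of a point process $\Xi=\sum_j\delta_{X_j}$ is the function with $\mathbb E[\sum_{j_1,\dots,j_n\ \text{distinct}}f(X_{j_1},\dots,X_{j_n})]=\int f(x_1,\dots,x_n)\rho_n(x_1,\dots,x_n)\,dx_1\cdots dx_n$ for all bounded measurable $f$. *)

theory Defs
  imports "HOL-Probability.Probability" "Jordan_Normal_Form.Determinant"
begin

text \<open>q = exp(pi i tau), z = exp(pi i v); q^((n-1/2)^2) is read as exp(pi i tau (n-1/2)^2).\<close>

definition theta1 :: "complex \<Rightarrow> complex \<Rightarrow> complex" where
  "theta1 v \<tau> = \<i> * infsum (\<lambda>n::int. (if even n then 1 else -1) *
      exp (pi * \<i> * \<tau> * (of_int n - 1/2)\<^sup>2) * exp (pi * \<i> * v * (2 * of_int n - 1))) UNIV"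

definition theta2 :: "complex \<Rightarrow> complex \<Rightarrow> complex" where
  "theta2 v \<tau> = infsum (\<lambda>n::int.
      exp (pi * \<i> * \<tau> * (of_int n - 1/2)\<^sup>2) * exp (pi * \<i> * v * (2 * of_int n - 1))) UNIV"

datatype theta_type = ThA | ThB | ThC | ThD

definition Theta :: "theta_type \<Rightarrow> real \<Rightarrow> complex \<Rightarrow> complex \<Rightarrow> complex" where
  "Theta T \<sigma> z \<tau> = (case T of
      ThA \<Rightarrow> exp (2 * pi * \<i> * \<sigma> * z) * theta2 (\<sigma> * \<tau> + z) \<tau>
    | ThB \<Rightarrow> exp (2 * pi * \<i> * \<sigma> * z) * theta1 (\<sigma> * \<tau> + z) \<tau>
             - exp (- 2 * pi * \<i> * \<sigma> * z) * theta1 (\<sigma> * \<tau> - z) \<tau>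
    | ThC \<Rightarrow> exp (2 * pi * \<i> * \<sigma> * z) * theta2 (\<sigma> * \<tau> + z) \<tau>
             - exp (- 2 * pi * \<i> * \<sigma> * z) * theta2 (\<sigma> * \<tau> - z) \<tau>
    | ThD \<Rightarrow> exp (2 * pi * \<i> * \<sigma> * z) * theta2 (\<sigma> * \<tau> + z) \<tau>
             + exp (- 2 * pi * \<i> * \<sigma> * z) * theta2 (\<sigma> * \<tau> - z) \<tau>)"

datatype root_sys = RA | RB | RBv | RC | RCv | RBC | RD

fun sharp :: "root_sys \<Rightarrow> theta_type" where
  "sharp RA = ThA" | "sharp RB = ThB" | "sharp RBv = ThB"
| "sharp RC = ThC" | "sharp RCv = ThC" | "sharp RBC = ThC" | "sharp RD = ThD"

fun Jfun :: "root_sys \<Rightarrow> nat \<Rightarrow> real" where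
  "Jfun RA j = real j - 1/2" | "Jfun RCv j = real j - 1/2"
| "Jfun RB j = real j - 1" | "Jfun RBv j = real j - 1" | "Jfun RD j = real j - 1"
| "Jfun RC j = real j" | "Jfun RBC j = real j"

fun Ncal :: "root_sys \<Rightarrow> nat \<Rightarrow> real" where
  "Ncal RA N = real N" | "Ncal RB N = 2 * real N - 1"
| "Ncal RBv N = 2 * real N" | "Ncal RCv N = 2 * real N"
| "Ncal RC N = 2 * (real N + 1)" | "Ncal RBC N = 2 * real N + 1"
| "Ncal RD N = 2 * (real N - 1)"

definition xi :: "real \<Rightarrow> real \<Rightarrow> real" where
  "xi r x = x / (2 * pi * r)"

definition tau :: "real \<Rightarrow> real \<Rightarrow> complex" where
  "tau r t = \<i> * t / (2 * pi * r\<^sup>2)"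

definition Mfun :: "root_sys \<Rightarrow> nat \<Rightarrow> real \<Rightarrow> nat \<Rightarrow> real \<Rightarrow> real \<Rightarrow> complex" where
  "Mfun R N r j x t = Theta (sharp R) (Jfun R j / Ncal R N)
      (of_real (Ncal R N * xi r x)) (of_real ((Ncal R N)\<^sup>2) * tau r t)"

definition mconst :: "root_sys \<Rightarrow> nat \<Rightarrow> real \<Rightarrow> real \<Rightarrow> nat \<Rightarrow> complex" where
  "mconst R N r ts j =
     (let \<N> = Ncal R N; T = tau r ts;
          gen = 2 * pi * r * theta2 (of_real (\<N> * Jfun R j) * T) (of_real (\<N>\<^sup>2) * T)
      in (case R of
            RB \<Rightarrow> (if j = 1 then 4 * pi * r * theta2 0 (of_real (\<N>\<^sup>2) * T) else gen)
          | RBv \<Rightarrow> (if j = 1 then 4 * pi * r * theta2 0 (of_real (\<N>\<^sup>2) * T) else gen)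
          | RD \<Rightarrow> (if j = 1 then 4 * pi * r * theta2 0 (of_real (\<N>\<^sup>2) * T)
                   else if j = N then 4 * pi * r * theta2 (of_real (\<N> * (real N - 1)) * T) (of_real (\<N>\<^sup>2) * T)
                   else gen)
          | _ \<Rightarrow> gen))"

definition Sdom :: "root_sys \<Rightarrow> nat \<Rightarrow> real \<Rightarrow> (nat \<Rightarrow> real) set" where
  "Sdom R N r = {x \<in> {1..N} \<rightarrow>\<^sub>E UNIV. 0 \<le> x 1 \<and> (\<forall>k. 1 \<le> k \<and> k < N \<longrightarrow> x k < x (Suc k))
       \<and> (if R = RA then x N < 2 * pi * r else x N \<le> pi * r)}"

definition Ldom :: "root_sys \<Rightarrow> real \<Rightarrow> real set" where
  "Ldom R r = (if R = RA then {0..<2 * pi * r} else {0..pi * r})"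

definition qfun :: "root_sys \<Rightarrow> nat \<Rightarrow> real \<Rightarrow> real \<Rightarrow> real \<Rightarrow> (nat \<Rightarrow> real) \<Rightarrow> complex" where
  "qfun R N r ts t x =
     det (mat N N (\<lambda>(j, k). cnj (Mfun R N r (Suc j) (x (Suc k)) (ts - t))))
   * det (mat N N (\<lambda>(l, m). Mfun R N r (Suc l) (x (Suc m)) t))"

text \<open>Density p_t = q_t / prod m_n; it is real and nonnegative, so we take the real part.\<close>
definition pdens :: "root_sys \<Rightarrow> nat \<Rightarrow> real \<Rightarrow> real \<Rightarrow> real \<Rightarrow> (nat \<Rightarrow> real) \<Rightarrow> real" where
  "pdens R N r ts t x = Re (qfun R N r ts t x / (\<Prod>n\<in>{1..N}. mconst R N r ts n))"

definition Pmeas :: "root_sys \<Rightarrow> nat \<Rightarrow> real \<Rightarrow> real \<Rightarrow> real \<Rightarrow> (nat \<Rightarrow> real) measure" where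
  "Pmeas R N r ts t = density (PiM {1..N} (\<lambda>_. lborel))
      (\<lambda>x. indicator (Sdom R N r) x * ennreal (pdens R N r ts t x))"

definition Kker :: "root_sys \<Rightarrow> nat \<Rightarrow> real \<Rightarrow> real \<Rightarrow> real \<Rightarrow> real \<Rightarrow> real \<Rightarrow> complex" where
  "Kker R N r ts t x y = (\<Sum>n\<in>{1..N}. Mfun R N r n x t * cnj (Mfun R N r n y (ts - t)) / mconst R N r ts n)"

text \<open>For a random vector X = (X_1..X_N) with law P (on functions extensional on {1..N}),
  rho is the n-point correlation function of Xi = sum_j delta_{X_j} iff for all bounded measurable f,
  E[sum over distinct j_1..j_n of f(X_{j_1},...,X_{j_n})] = integral of f * rho over R^n.\<close>

definition is_correlation_function ::
  "(nat \<Rightarrow> real) measure \<Rightarrow> nat \<Rightarrow> nat \<Rightarrow> ((nat \<Rightarrow> real) \<Rightarrow> complex) \<Rightarrow> bool" where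
  "is_correlation_function P N n \<rho> \<longleftrightarrow>
     (\<forall>f :: (nat \<Rightarrow> real) \<Rightarrow> real.
        f \<in> borel_measurable (PiM {1..n} (\<lambda>_. lborel)) \<longrightarrow> (\<exists>B. \<forall>y. \<bar>f y\<bar> \<le> B) \<longrightarrow>
        complex_of_real (\<integral>X. (\<Sum>j\<in>{j \<in> {1..n} \<rightarrow>\<^sub>E {1..N}. inj_on j {1..n}}.
                                    f (\<lambda>k\<in>{1..n}. X (j k))) \<partial>P)
        = (\<integral>y. of_real (f y) * \<rho> y \<partial>PiM {1..n} (\<lambda>_. lborel)))"

text \<open>Xi is a determinantal point process on the set L with kernel K: for each 1 <= n <= N the
  n-point correlation function is det[K(x_j,x_k)] on L^n (and 0 off L^n, since all points lie in L).\<close>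

definition is_determinantal ::
  "(nat \<Rightarrow> real) measure \<Rightarrow> nat \<Rightarrow> real set \<Rightarrow> (real \<Rightarrow> real \<Rightarrow> complex) \<Rightarrow> bool" where
  "is_determinantal P N L K \<longleftrightarrow>
     (\<forall>n\<in>{1..N}. is_correlation_function P N n
        (\<lambda>y. if y \<in> ({1..n} \<rightarrow>\<^sub>E L)
             then det (mat n n (\<lambda>(j, k). K (y (Suc j)) (y (Suc k)))) else 0))"

end

theory Submission
  imports "HOL-Complex_Analysis.Complex_Analysis" Defs
begin

text \<open>
  Writing \<open>s = t / (2 r\<^sup>2)\<close>, the functions \<open>M\<^sub>j\<close> are Fourier series with Gaussian coefficients \<open>exp (- s k\<^sup>2)\<close>, and different
  indices use disjoint sets of modes \<open>k\<close>. Hence the \<open>M\<^sub>j(\<cdot>, t)\<close> and \<open>M\<^sub>j(\<cdot>, t\<^sub>* - t)\<close> are biorthogonal with norms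
  \<open>m\<^sub>j\<close>, the density is \<open>det K\<close> for a reproducing kernel \<open>K\<close> of trace \<open>N\<close>, and the correlation functions follow by
  integrating out one point at a time, after the ordered configurations have been symmetrised.

  The measure of the statement is built from the positive part of the density, so the density has to be shown to be nonnegative.
  A nontrivial combination of the \<open>M\<^sub>j(\<cdot>, t)\<close> is an entire function that is quasi-periodic for the periods \<open>2 \<pi>\<close> and
  \<open>\<i> T\<close>. If it vanished at \<open>N\<close> distinct points, then division by theta factors and Liouville's theorem would force it to
  vanish identically. Therefore the determinant of the \<open>M\<^sub>j(x\<^sub>k, t)\<close> has no zeros for interior configurations at any time
  \<open>t > 0\<close>, and by continuity in \<open>t\<close> the determinants at the times \<open>t\<close> and \<open>t\<^sub>* - t\<close> have the same phase.
\<close>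

section \<open>Quasi-periodic entire functions\<close>

text \<open>With \<open>n = theta_degree R N\<close>, completing the square in the theta exponents
  turns the summation index \<open>l\<close> into the Fourier mode \<open>n * (l - 1/2) + J\<close>.
  Gaussian times add when equal modes are paired, so the pairing of time \<open>t\<close> with
  \<open>ts - t\<close> produces constants at \<open>ts\<close>; a class of modes that is its own
  reflection is met twice, whence \<open>4 * pi * r\<close> in place of \<open>2 * pi * r\<close>.
  For the reflected types \<open>N\<close> is only about half of the degree, so \<open>N\<close>
  zeros alone prove nothing: the zeros forced by symmetry have to be counted as well, and where the
  count merely reaches the degree the multipliers decide. The phase argument rests on conjugation
  acting on the determinant by a constant that depends neither on time nor on the points, which
  makes the product of the determinants at two times real. On the walls \<open>0\<close> and
  \<open>pi * r\<close> determinants may vanish, and the sign there is a limit of interior signs.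
  The density on ordered configurations carries no \<open>1 / N!\<close>: symmetrising over the
  sorting permutations supplies it.\<close>

definition qprod :: "real \<Rightarrow> complex \<Rightarrow> complex" where
  "qprod q w = (\<Prod>n. 1 - of_real q ^ n * w)"

lemma abs_convergent_qprod:
  assumes "0 < q" "q < 1"
  shows "abs_convergent_prod (\<lambda>n. 1 - complex_of_real q ^ n * w)"
proof (rule summable_imp_abs_convergent_prod)
  have "summable (\<lambda>n. norm w * q ^ n)"
    using assms by (intro summable_mult summable_geometric) auto
  then show "summable (\<lambda>n. norm (1 - complex_of_real q ^ n * w - 1))"
    using assms by (simp add: norm_mult norm_power mult.commute)
qed

text \<open>The product is the q-Pochhammer symbol with infinitely many factors; its tail is the
  same product at a rescaled argument. Both the functional equation and the location of the zeros
  come from this.\<close>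

lemma qprod_split:
  assumes "0 < q" "q < 1"
  shows "qprod q w = (\<Prod>k<n. 1 - of_real q ^ k * w) * qprod q (of_real q ^ n * w)"
proof -
  have "convergent_prod (\<lambda>n. 1 - complex_of_real q ^ n * w)"
    using abs_convergent_qprod[OF assms] by (rule abs_convergent_prod_imp_convergent_prod)
  from has_prod_ignore_initial_segment'[OF this, of n]
  show ?thesis
    by (simp add: qprod_def has_prod_iff power_add mult.assoc)
qed

lemma qprod_rec:
  assumes "0 < q" "q < 1"
  shows "qprod q w = (1 - w) * qprod q (of_real q * w)"
  using qprod_split[OF assms, of w 1] by simp

text \<open>A convergent infinite product vanishes only through one of its factors; conversely,
  splitting off the first \<open>n + 1\<close> factors exposes the vanishing one.\<close>

lemma qprod_eq_0_iff:
  assumes "0 < q" "q < 1"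
  shows "qprod q w = 0 \<longleftrightarrow> (\<exists>n. of_real q ^ n * w = 1)"
proof
  assume 0: "qprod q w = 0"
  have "convergent_prod (\<lambda>n. 1 - complex_of_real q ^ n * w)"
    using abs_convergent_qprod[OF assms] by (rule abs_convergent_prod_imp_convergent_prod)
  from prodinf_nonzero[OF this] 0 have "\<exists>n. 1 - complex_of_real q ^ n * w = 0"
    unfolding qprod_def by blast
  then show "\<exists>n. of_real q ^ n * w = 1" by auto
next
  assume "\<exists>n. of_real q ^ n * w = 1"
  then obtain n where "complex_of_real q ^ n * w = 1" by blast
  then show "qprod q w = 0"
    using qprod_split[OF assms, of w "Suc n"] by simp
qed

text \<open>On a disc of radius \<open>R\<close> the factors differ from 1 by at most
  \<open>q ^ n * R\<close>, so the partial products converge uniformly and the limit inherits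
  holomorphy.\<close>

lemma holomorphic_qprod:
  assumes q: "0 < q" "q < 1"
  shows "qprod q holomorphic_on UNIV"
proof -
  have ulim: "uniform_limit (cball 0 R) (\<lambda>N w. \<Prod>n<N. 1 - of_real q ^ n * w) (qprod q) sequentially" for R
  proof -
    have "uniformly_convergent_on (cball 0 R) (\<lambda>N w. \<Prod>n<N. 1 - complex_of_real q ^ n * w)"
    proof (rule uniformly_convergent_on_prod')
      show "uniformly_convergent_on (cball 0 R) (\<lambda>N w. \<Sum>n<N. norm (1 - complex_of_real q ^ n * w - 1))"
      proof (rule Weierstrass_m_test'[where M = "\<lambda>n. q ^ n * R"])
        show "summable (\<lambda>n. q ^ n * R)"
          using q by (intro summable_mult2 summable_geometric) auto
      qed (use q in \<open>auto simp: norm_mult norm_power intro!: mult_left_mono\<close>)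
    qed (auto intro!: continuous_intros)
    then have "uniform_limit (cball 0 R) (\<lambda>N w. \<Prod>n<N. 1 - of_real q ^ n * w)
       (\<lambda>w. lim (\<lambda>N. \<Prod>n<N. 1 - complex_of_real q ^ n * w)) sequentially"
      by (simp add: uniformly_convergent_uniform_limit_iff)
    moreover have "lim (\<lambda>N. \<Prod>n<N. 1 - complex_of_real q ^ n * w) = qprod q w" for w
    proof (rule limI)
      have "convergent_prod (\<lambda>n. 1 - complex_of_real q ^ n * w)"
        using abs_convergent_qprod[OF q] by (rule abs_convergent_prod_imp_convergent_prod)
      from convergent_prod_LIMSEQ[OF this]
      show "(\<lambda>N. \<Prod>n<N. 1 - complex_of_real q ^ n * w) \<longlonglongrightarrow> qprod q w"
        by (simp add: qprod_def LIMSEQ_lessThan_iff_atMost)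
    qed
    ultimately show ?thesis by simp
  qed
  have "qprod q holomorphic_on ball 0 R" for R
    by (rule holomorphic_uniform_limit[OF _ ulim])
       (auto intro!: always_eventually continuous_intros holomorphic_intros)
  then have "qprod q field_differentiable at w" for w
    by (rule holomorphic_on_imp_differentiable_at[of _ "ball 0 (norm w + 1)"]) auto
  then show ?thesis by (auto intro: holomorphic_onI field_differentiable_at_within)
qed

text \<open>The theta function \<open>\<vartheta>\<^sub>1\<close> up to an exponential factor. Starting from the product instead of the series makes
  its zeros evident, so that the triple product identity is not needed.\<close>
definition jtheta :: "real \<Rightarrow> complex \<Rightarrow> complex" where
  "jtheta T z = qprod (exp (-T)) (exp (\<i> * z)) * qprod (exp (-T)) (of_real (exp (-T)) * exp (- (\<i> * z)))"

lemma holomorphic_jtheta: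
  assumes "T > 0"
  shows "jtheta T holomorphic_on UNIV"
proof -
  have q: "qprod (exp (-T)) holomorphic_on UNIV"
    using assms by (intro holomorphic_qprod) auto
  have "(\<lambda>z. (qprod (exp (-T)) \<circ> (\<lambda>z. exp (\<i> * z))) z
     * (qprod (exp (-T)) \<circ> (\<lambda>z. of_real (exp (-T)) * exp (- (\<i> * z)))) z) holomorphic_on UNIV"
    by (intro holomorphic_on_mult holomorphic_on_compose_gen[OF _ q] holomorphic_intros) auto
  then show ?thesis by (simp add: jtheta_def[abs_def])
qed

lemma jtheta_plus_period:
  fixes z :: complex
  shows "jtheta T (z + 2 * pi) = jtheta T z"
proof -
  have "exp (\<i> * (z + 2 * pi)) = exp (\<i> * z) * exp (2 * pi * \<i>)"
    unfolding exp_add[symmetric] by (simp add: algebra_simps)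
  also have "\<dots> = exp (\<i> * z)" by simp
  finally show ?thesis by (simp add: jtheta_def exp_minus)
qed

text \<open>The shift multiplies \<open>w = exp (\<i> * z)\<close> by \<open>q\<close>: the first
  product loses its factor \<open>1 - w\<close>, the second gains \<open>1 - 1 / w\<close>, and the
  quotient of the two is \<open>- 1 / w\<close>.\<close>

lemma jtheta_plus_quasi_period:
  assumes "T > 0"
  shows "jtheta T (z + \<i> * T) = - exp (- (\<i> * z)) * jtheta T z"
proof -
  define q where "q = exp (-T)"
  define w where "w = exp (\<i> * z)"
  have q: "0 < q" "q < 1" and w: "w \<noteq> 0" using assms by (auto simp: q_def w_def)
  have e: "exp (- (\<i> * z)) = 1 / w" by (simp add: w_def exp_minus divide_inverse)
  have "\<i> * (z + \<i> * T) = of_real (-T) + \<i> * z"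
    by (simp add: algebra_simps flip: mult.assoc)
  then have 1: "exp (\<i> * (z + \<i> * T)) = q * w"
    by (simp only: q_def w_def exp_add exp_of_real)
  have 2: "exp (- (\<i> * (z + \<i> * T))) = 1 / (q * w)"
    unfolding 1[symmetric] by (simp add: exp_minus divide_inverse)
  have "jtheta T (z + \<i> * T) = qprod q (q * w) * qprod q (1 / w)"
    unfolding jtheta_def 1 2 q_def[symmetric] using q by simp
  also have "\<dots> = qprod q (q * w) * ((1 - 1 / w) * qprod q (q * (1 / w)))"
    using qprod_rec[OF q, of "1 / w"] by simp
  also have "\<dots> = - (1 / w) * (((1 - w) * qprod q (q * w)) * qprod q (q * (1 / w)))"
    using w by (simp add: field_simps)
  also have "\<dots> = - (1 / w) * (qprod q w * qprod q (q * (1 / w)))"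
    using qprod_rec[OF q, of w] by simp
  finally show ?thesis
    unfolding jtheta_def e q_def[symmetric] w_def[symmetric] by simp
qed

text \<open>The first product vanishes where \<open>exp (\<i> * z)\<close> is \<open>q\<close> to a
  nonpositive power, the second where it is \<open>q\<close> to a positive power. Together these are
  all integral powers of \<open>q\<close>, that is, the period lattice.\<close>

lemma jtheta_eq_0D:
  assumes T: "T > 0" and z: "jtheta T z = 0"
  obtains m n :: int where "z = 2 * pi * of_int m + \<i> * T * of_int n"
proof -
  define q where "q = exp (-T)"
  have q: "0 < q" "q < 1" using assms by (auto simp: q_def)
  have qn: "complex_of_real q ^ n = exp (of_real (- (T * n)))" for n :: nat
  proof -
    have "exp (- (T * n)) = q ^ n" by (simp add: q_def mult.commute flip: exp_of_nat_mult)
    then show ?thesis by (metis exp_of_real of_real_power)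
  qed
  have "\<exists>n::int. exp (\<i> * z) = exp (complex_of_real (T * of_int n))"
  proof -
    from z consider n :: nat where "of_real q ^ n * exp (\<i> * z) = 1"
      | n :: nat where "of_real q ^ n * (of_real q * exp (- (\<i> * z))) = 1"
      unfolding jtheta_def q_def[symmetric] mult_eq_0_iff qprod_eq_0_iff[OF q]
      by blast
    then show ?thesis
    proof cases
      case (1 n)
      then have "exp (\<i> * z) = exp (complex_of_real (T * of_int (int n)))"
        by (simp add: qn exp_minus field_simps)
      then show ?thesis by blast
    next
      case (2 n)
      then have "exp (\<i> * z) = complex_of_real q ^ Suc n"
        by (simp add: exp_minus field_simps)
      then have "exp (\<i> * z) = exp (complex_of_real (T * of_int (- int (Suc n))))"
        unfolding qn by (simp add: algebra_simps)
      then show ?thesis by blast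
    qed
  qed
  then obtain n :: int where "exp (\<i> * z) = exp (complex_of_real (T * of_int n))" by blast
  then obtain m :: int where "\<i> * z = of_real (T * of_int n) + of_int (2 * m) * pi * \<i>"
    by (auto simp: exp_eq)
  then have "z = 2 * pi * of_int m + \<i> * T * of_int (- n)"
    by (simp add: complex_eq_iff)
  then show thesis by (rule that)
qed

text \<open>Only the factor \<open>1 - exp (\<i> * z)\<close> vanishes at 0; what remains has the
  value \<open>qprod q q\<close> squared there, nonzero because all powers
  \<open>q ^ (n + 1)\<close> are below 1. So the zero is simple.\<close>

lemma jtheta_deriv_0:
  assumes "T > 0"
  shows "\<exists>d. d \<noteq> 0 \<and> (jtheta T has_field_derivative d) (at 0)" and "jtheta T 0 = 0"
proof -
  define q where "q = exp (-T)"
  have q: "0 < q" "q < 1" using assms by (auto simp: q_def)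
  have hq: "(qprod q has_field_derivative deriv (qprod q) w) (at w)" for w
    using holomorphic_qprod[OF q] by (intro holomorphic_derivI[of _ UNIV]) auto
  define h where "h z = qprod q (q * exp (\<i> * z)) * qprod q (q * exp (- (\<i> * z)))" for z
  have eq: "jtheta T z = (1 - exp (\<i> * z)) * h z" for z
    unfolding jtheta_def h_def q_def[symmetric] using qprod_rec[OF q, of "exp (\<i> * z)"] by simp
  show "jtheta T 0 = 0" by (simp add: eq)
  have "\<exists>h'. (h has_field_derivative h') (at 0)"
    unfolding h_def
    by (rule exI) (rule derivative_eq_intros DERIV_chain2[OF hq] refl)+
  then obtain h' where h': "(h has_field_derivative h') (at 0)" by blast
  have "qprod q q \<noteq> 0"
    unfolding qprod_eq_0_iff[OF q]
  proof safe
    fix n assume "complex_of_real q ^ n * q = 1"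
    then have "complex_of_real (q ^ Suc n) = of_real 1" by (simp add: mult.commute)
    then have "q ^ Suc n = 1" unfolding of_real_eq_iff .
    moreover have "q ^ Suc n < 1" by (rule power_Suc_less_one) (use q in auto)
    ultimately show False by simp
  qed
  then have "h 0 \<noteq> 0" by (simp add: h_def)
  moreover have "((\<lambda>z. (1 - exp (\<i> * z)) * h z) has_field_derivative - \<i> * h 0) (at 0)"
    by (rule derivative_eq_intros h' refl | simp)+
  ultimately show "\<exists>d. d \<noteq> 0 \<and> (jtheta T has_field_derivative d) (at 0)"
    by (intro exI[of _ "- \<i> * h 0"]) (simp add: eq[abs_def])
qed

text \<open>These are the theta functions of degree \<open>m\<close> for the lattice spanned by
  \<open>2 * pi\<close> and \<open>\<i> * T\<close>; for nonzero multipliers, \<open>m\<close> is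
  the number of zeros per period parallelogram of a function that is not identically zero.\<close>

definition quasi_periodic :: "real \<Rightarrow> nat \<Rightarrow> complex \<Rightarrow> complex \<Rightarrow> (complex \<Rightarrow> complex) \<Rightarrow> bool" where
  "quasi_periodic T m e C f \<longleftrightarrow> f holomorphic_on UNIV \<and> (\<forall>z::complex. f (z + 2 * pi) = e * f z) \<and>
     (\<forall>z. f (z + \<i> * T) = C * exp (- (\<i> * of_nat m * z)) * f z)"

text \<open>A coarser notion that forgets the precise multiplier. It is closed under sums and
  negation of periods, hence passes from two generators to the whole lattice, and it suffices for
  transporting zeros.\<close>

definition exp_period :: "(complex \<Rightarrow> complex) \<Rightarrow> complex \<Rightarrow> bool" where
  "exp_period f \<omega> \<longleftrightarrow> (\<exists>a b. a \<noteq> 0 \<and> (\<forall>z. f (z + \<omega>) = a * exp (b * z) * f z))"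

lemma exp_period_add:
  assumes "exp_period f \<omega>" "exp_period f \<omega>'"
  shows "exp_period f (\<omega> + \<omega>')"
proof -
  obtain a b a' b' where ab: "a \<noteq> 0" "\<And>z. f (z + \<omega>) = a * exp (b * z) * f z"
    "a' \<noteq> 0" "\<And>z. f (z + \<omega>') = a' * exp (b' * z) * f z"
    using assms unfolding exp_period_def by blast
  have "f (z + (\<omega> + \<omega>')) = (a' * exp (b' * \<omega>) * a) * exp ((b + b') * z) * f z" for z
    using ab(4)[of "z + \<omega>"] ab(2)[of z] by (simp add: add.assoc ring_distribs exp_add mult_ac)
  moreover have "a' * exp (b' * \<omega>) * a \<noteq> 0" using ab by simp
  ultimately show ?thesis unfolding exp_period_def by blast
qed

lemma exp_period_minus:
  assumes "exp_period f \<omega>"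
  shows "exp_period f (- \<omega>)"
proof -
  obtain a b where ab: "a \<noteq> 0" "\<And>z. f (z + \<omega>) = a * exp (b * z) * f z"
    using assms unfolding exp_period_def by blast
  have "f (z + - \<omega>) = (exp (b * \<omega>) / a) * exp (- b * z) * f z" for z
    using ab(2)[of "z - \<omega>"] ab(1) by (simp add: ring_distribs exp_diff exp_minus field_simps)
  moreover have "exp (b * \<omega>) / a \<noteq> 0" using ab by simp
  ultimately show ?thesis unfolding exp_period_def by blast
qed

lemma exp_period_0: "exp_period f 0"
  unfolding exp_period_def by (intro exI[of _ 1] exI[of _ 0]) simp

lemma exp_period_of_int_mult:
  assumes "exp_period f \<omega>"
  shows "exp_period f (of_int n * \<omega>)"
proof (induction n rule: int_induct[where k = 0])
  case base
  show ?case by (simp add: exp_period_0)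
next
  case (step1 i)
  show ?case using exp_period_add[OF step1(2) assms] by (simp add: algebra_simps)
next
  case (step2 i)
  show ?case using exp_period_add[OF step2(2) exp_period_minus[OF assms]] by (simp add: algebra_simps)
qed

lemma exp_period_eq_0:
  assumes "exp_period f \<omega>" "f z = 0"
  shows "f (z + \<omega>) = 0"
  using assms unfolding exp_period_def by auto

lemma quasi_periodic_exp_period:
  assumes "quasi_periodic T m e C f" "e \<noteq> 0" "C \<noteq> 0"
  shows "exp_period f (2 * pi * of_int j + \<i> * T * of_int k)"
proof -
  have "exp_period f (2 * pi)"
    using assms unfolding exp_period_def quasi_periodic_def
    by (intro exI[of _ e] exI[of _ 0]) simp
  moreover have "exp_period f (\<i> * T)"
    using assms unfolding exp_period_def quasi_periodic_def
    by (intro exI[of _ C] exI[of _ "- (\<i> * of_nat m)"]) simp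
  ultimately have "exp_period f (of_int j * complex_of_real (2 * pi) + of_int k * (\<i> * T))"
    by (intro exp_period_add exp_period_of_int_mult)
  then show ?thesis by (simp add: mult_ac)
qed

lemma jtheta_quasi_periodic:
  assumes "T > 0"
  shows "quasi_periodic T 1 1 (-1) (jtheta T)"
  unfolding quasi_periodic_def
proof (intro conjI allI)
  show "jtheta T (z + 2 * pi) = 1 * jtheta T z" for z :: complex
    by (simp add: jtheta_plus_period del: of_real_mult)
  show "jtheta T (z + \<i> * T) = - 1 * exp (- (\<i> * of_nat 1 * z)) * jtheta T z" for z
    using jtheta_plus_quasi_period[OF assms, of z] by simp
qed (rule holomorphic_jtheta[OF assms])

text \<open>Every zero is a lattice translate of 0, and translation multiplies by a function without
  zeros, so simplicity at 0 carries over. The product rule leaves only \<open>a * d\<close> because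
  \<open>jtheta T 0 = 0\<close>.\<close>

lemma jtheta_zero_deriv:
  assumes T: "T > 0" and z: "jtheta T z = 0"
  shows "\<exists>d. d \<noteq> 0 \<and> (jtheta T has_field_derivative d) (at z)"
proof -
  obtain j k :: int where jk: "z = 2 * pi * of_int j + \<i> * T * of_int k"
    using jtheta_eq_0D[OF T z] .
  obtain a b where ab: "a \<noteq> 0" "\<And>w. jtheta T (w + z) = a * exp (b * w) * jtheta T w"
    using quasi_periodic_exp_period[OF jtheta_quasi_periodic[OF T], of j k]
    unfolding exp_period_def jk by auto
  obtain d where d: "d \<noteq> 0" "(jtheta T has_field_derivative d) (at 0)"
    using jtheta_deriv_0(1)[OF T] by blast
  have "((\<lambda>w. jtheta T (w + z)) has_field_derivative a * d) (at 0)"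
    unfolding ab(2)
    by (rule derivative_eq_intros d refl | simp add: jtheta_deriv_0(2)[OF T])+
  then have "(jtheta T has_field_derivative a * d) (at z)"
    using DERIV_shift[of "jtheta T" "a * d" 0 z] by simp
  then show ?thesis using ab d by (intro exI[of _ "a * d"]) simp
qed

section \<open>Division of entire functions by theta factors\<close>

lemma eventually_nonzero_at:
  assumes "f holomorphic_on UNIV" "f b \<noteq> 0"
  shows "eventually (\<lambda>w. f w \<noteq> 0) (at z)"
proof -
  have "\<forall>\<^sub>F w in at z. f w \<noteq> 0 \<and> w \<in> UNIV"
    by (rule non_zero_neighbour_alt[OF assms(1)]) (use assms in auto)
  then show ?thesis by simp
qed

text \<open>Zeros of \<open>f\<close> are isolated, so \<open>h\<close> vanishes on a punctured
  neighbourhood of every point and then at the point by continuity. This cancels theta factors from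
  functional equations even at their zeros.\<close>

lemma mult_eq_0_imp_entire_eq_0:
  assumes f: "f holomorphic_on UNIV" "f b \<noteq> 0" and h: "continuous_on UNIV h"
    and fh: "\<And>z::complex. f z * h z = (0::complex)"
  shows "h z = 0"
proof -
  have "(h \<longlongrightarrow> h z) (at z)"
    using h by (simp add: continuous_on_def)
  moreover have "eventually (\<lambda>w. h w = 0) (at z)"
    using eventually_nonzero_at[OF f] by eventually_elim (use fh in auto)
  then have "(h \<longlongrightarrow> 0) (at z)" by (rule tendsto_eventually)
  ultimately show ?thesis by (rule tendsto_unique[rotated]) simp
qed

text \<open>At a zero of the denominator the quotient is completed by the l'Hopital value
  \<open>deriv f z / deriv \<theta> z\<close>. The result is continuous there, so the isolated
  singularity is removable.\<close>

lemma entire_divide_simple_zeros: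
  fixes f \<theta> :: "complex \<Rightarrow> complex"
  assumes f: "f holomorphic_on UNIV" and \<theta>: "\<theta> holomorphic_on UNIV" "\<theta> b \<noteq> 0"
    and zeros: "\<And>z. \<theta> z = 0 \<Longrightarrow> f z = 0 \<and> (\<exists>d. d \<noteq> 0 \<and> (\<theta> has_field_derivative d) (at z))"
  obtains g where "g holomorphic_on UNIV" "\<And>z. f z = \<theta> z * g z"
proof
  define g where "g z = (if \<theta> z = 0 then deriv f z / deriv \<theta> z else f z / \<theta> z)" for z
  show "f z = \<theta> z * g z" for z
    using zeros[of z] by (simp add: g_def)
  have fd: "(f has_field_derivative deriv f z) (at z)" for z
    using f by (intro holomorphic_derivI[of _ UNIV]) auto
  have lim: "(g \<longlongrightarrow> g z) (at z)" for z
  proof (rule Lim_transform_eventually)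
    show "eventually (\<lambda>w. f w / \<theta> w = g w) (at z)"
      using eventually_nonzero_at[OF \<theta>] by eventually_elim (simp add: g_def)
    show "((\<lambda>w. f w / \<theta> w) \<longlongrightarrow> g z) (at z)"
    proof (cases "\<theta> z = 0")
      case True
      then obtain d where "d \<noteq> 0" "(\<theta> has_field_derivative d) (at z)" "f z = 0"
        using zeros by blast
      with True show ?thesis
        by (intro lhopital_complex_simple[OF fd, where g' = d])
           (simp_all add: g_def DERIV_imp_deriv)
    next
      case False
      have "isCont f z" "isCont \<theta> z"
        using \<theta>(1)[THEN holomorphic_on_imp_continuous_on] holomorphic_on_imp_continuous_on[OF f]
        by (auto intro: continuous_on_interior)
      then have "((\<lambda>w. f w / \<theta> w) \<longlongrightarrow> f z / \<theta> z) (at z)"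
        unfolding isCont_def using False by (rule tendsto_divide)
      with False show ?thesis by (simp add: g_def)
    qed
  qed
  show "g holomorphic_on UNIV"
  proof -
    have "g field_differentiable at z" for z
    proof -
      obtain r where r: "r > 0" "\<And>w. w \<noteq> z \<Longrightarrow> dist w z < r \<Longrightarrow> \<theta> w \<noteq> 0"
        using eventually_nonzero_at[OF \<theta>, of z] unfolding eventually_at by auto
      have "(\<lambda>w. f w / \<theta> w) holomorphic_on (ball z r - {z})"
        using r by (intro holomorphic_on_divide holomorphic_on_subset[OF f] holomorphic_on_subset[OF \<theta>(1)])
          (auto simp: dist_commute)
      then have "g holomorphic_on (ball z r - {z})"
        by (rule holomorphic_transform) (use r in \<open>auto simp: g_def dist_commute\<close>)
      then have "g holomorphic_on ball z r"
        by (rule no_isolated_singularity'[rotated]) (use lim in \<open>auto intro: tendsto_within_subset\<close>)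
      then show ?thesis
        using r by (intro holomorphic_on_imp_differentiable_at[of _ "ball z r"]) auto
    qed
    then show ?thesis by (auto intro: holomorphic_onI field_differentiable_at_within)
  qed
qed

text \<open>A zero of \<open>f\<close> at \<open>x\<close> propagates along the lattice and thus
  covers all zeros of the shifted theta function. The latter has multiplier
  \<open>- exp (- (\<i> * (z - x)))\<close>; dividing by it lowers the degree by one and leaves the
  constant \<open>- exp (- (\<i> * x))\<close>.\<close>

lemma quasi_periodic_divide:
  assumes T: "T > 0" and f: "quasi_periodic T (Suc m) e C f" and nz: "e \<noteq> 0" "C \<noteq> 0"
    and x: "f (of_real x) = 0"
  obtains g where "quasi_periodic T m e (C * - exp (- (\<i> * x))) g" "\<And>z. f z = jtheta T (z - of_real x) * g z"
proof -
  define \<theta> where "\<theta> z = jtheta T (z - of_real x)" for z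
  have hol: "\<theta> holomorphic_on UNIV"
  proof -
    have "(jtheta T \<circ> (\<lambda>z. z - of_real x)) holomorphic_on UNIV"
      by (intro holomorphic_on_compose_gen[OF _ holomorphic_jtheta[OF T]] holomorphic_intros) auto
    then show ?thesis by (simp add: \<theta>_def[abs_def] o_def)
  qed
  obtain b where b: "\<theta> b \<noteq> 0"
  proof -
    have False if "\<And>z. jtheta T z = 0"
    proof -
      obtain d where d: "d \<noteq> 0" "(jtheta T has_field_derivative d) (at 0)"
        using jtheta_deriv_0(1)[OF T] by blast
      moreover have "jtheta T = (\<lambda>_. 0)" using that by auto
      ultimately show False using DERIV_unique[OF d(2)] by fastforce
    qed
    then obtain w where "jtheta T w \<noteq> 0" by blast
    then show thesis using that[of "w + of_real x"] by (simp add: \<theta>_def)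
  qed
  have zeros: "f z = 0 \<and> (\<exists>d. d \<noteq> 0 \<and> (\<theta> has_field_derivative d) (at z))" if z: "\<theta> z = 0" for z
  proof
    have z': "jtheta T (z - of_real x) = 0" using z by (simp add: \<theta>_def)
    then obtain j k :: int where "z - of_real x = 2 * pi * of_int j + \<i> * T * of_int k"
      using jtheta_eq_0D[OF T] by blast
    then show "f z = 0"
      using exp_period_eq_0[OF quasi_periodic_exp_period[OF f nz, of j k] x] by (simp add: algebra_simps)
    obtain d where d: "d \<noteq> 0" "(jtheta T has_field_derivative d) (at (z - of_real x))"
      using jtheta_zero_deriv[OF T z'] by blast
    have "(\<theta> has_field_derivative d) (at z)"
      unfolding \<theta>_def using DERIV_shift[of "jtheta T" d z "- of_real x"] d(2) by simp
    with d show "\<exists>d. d \<noteq> 0 \<and> (\<theta> has_field_derivative d) (at z)" by blast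
  qed
  have fh: "f holomorphic_on UNIV" using f by (simp add: quasi_periodic_def)
  obtain g where g: "g holomorphic_on UNIV" "\<And>z. f z = \<theta> z * g z"
    using entire_divide_simple_zeros[OF fh hol b zeros] by blast
  have cont: "continuous_on UNIV (\<lambda>z. g (z + w))" for w
  proof -
    have "continuous_on UNIV g" using g(1) by (rule holomorphic_on_imp_continuous_on)
    then show ?thesis by (rule continuous_on_compose2) (auto intro!: continuous_intros)
  qed
  have "g (z + 2 * pi) - e * g z = 0" for z :: complex
  proof (rule mult_eq_0_imp_entire_eq_0[OF hol b, where h = "\<lambda>z::complex. g (z + 2 * pi) - e * g z"])
    show "continuous_on UNIV (\<lambda>z::complex. g (z + 2 * pi) - e * g z)"
      using cont[of "2 * pi"] cont[of 0] by (auto intro!: continuous_intros)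
    show "\<theta> z * (g (z + 2 * pi) - e * g z) = 0" for z :: complex
    proof -
      have "\<theta> (z + 2 * pi) = \<theta> z"
        unfolding \<theta>_def using jtheta_plus_period[of T "z - of_real x"] by (simp add: algebra_simps)
      moreover have "f (z + 2 * pi) = e * f z" using f by (simp add: quasi_periodic_def)
      ultimately show ?thesis by (simp add: g(2) algebra_simps)
    qed
  qed
  moreover have "g (z + \<i> * T) - C * - exp (- (\<i> * x)) * exp (- (\<i> * of_nat m * z)) * g z = 0" for z :: complex
  proof (rule mult_eq_0_imp_entire_eq_0[OF hol b, where
        h = "\<lambda>z. g (z + \<i> * T) - C * - exp (- (\<i> * x)) * exp (- (\<i> * of_nat m * z)) * g z"])
    show "continuous_on UNIV (\<lambda>z::complex. g (z + \<i> * T) - C * - exp (- (\<i> * x)) * exp (- (\<i> * of_nat m * z)) * g z)"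
      using cont[of "\<i> * T"] cont[of 0] by (auto intro!: continuous_intros)
    show "\<theta> z * (g (z + \<i> * T) - C * - exp (- (\<i> * x)) * exp (- (\<i> * of_nat m * z)) * g z) = 0" for z
    proof -
      define E where "E = exp (\<i> * z)"
      define X where "X = exp (\<i> * x)"
      define M where "M = exp (\<i> * of_nat m * z)"
      have nz: "E \<noteq> 0" "X \<noteq> 0" "M \<noteq> 0" by (auto simp: E_def X_def M_def)
      have "\<theta> (z + \<i> * T) = - exp (- (\<i> * (z - of_real x))) * \<theta> z"
        unfolding \<theta>_def using jtheta_plus_quasi_period[OF T, of "z - of_real x"] by (simp add: algebra_simps)
      also have "exp (- (\<i> * (z - of_real x))) = X / E"
        by (simp add: E_def X_def algebra_simps exp_diff)
      finally have t: "\<theta> (z + \<i> * T) = - (X / E) * \<theta> z" .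
      have "f (z + \<i> * T) = C * exp (- (\<i> * of_nat (Suc m) * z)) * f z"
        using f unfolding quasi_periodic_def by blast
      also have "exp (- (\<i> * of_nat (Suc m) * z)) = 1 / (E * M)"
        by (simp add: E_def M_def algebra_simps exp_diff exp_minus divide_inverse)
      finally have "- (X / E) * \<theta> z * g (z + \<i> * T) = C * (1 / (E * M)) * (\<theta> z * g z)"
        unfolding g(2) t .
      then have "\<theta> z * g (z + \<i> * T) = - (C * (1 / X) * (1 / M) * (\<theta> z * g z))"
        using nz by (simp add: field_simps) (metis add.commute add_eq_0_iff)
      moreover have "exp (- (\<i> * x)) = 1 / X" "exp (- (\<i> * of_nat m * z)) = 1 / M"
        by (simp_all add: X_def M_def exp_minus divide_inverse)
      ultimately show ?thesis by (simp add: algebra_simps)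
    qed
  qed
  ultimately have "quasi_periodic T m e (C * - exp (- (\<i> * x))) g"
    using g(1) unfolding quasi_periodic_def by (simp add: eq_neg_iff_add_eq_0)
  then show thesis using that g(2) unfolding \<theta>_def by blast
qed

text \<open>Multiplication by \<open>exp (\<i> * \<beta> * z)\<close> contributes the modulus
  \<open>exp (- \<beta> * T)\<close> under the imaginary period, which cancels
  \<open>norm C\<close>. The modulus of the product is then doubly periodic, hence bounded by its
  maximum on one period rectangle, and Liouville applies.\<close>

lemma quasi_periodic_degree_0:
  assumes T: "T > 0" and g: "quasi_periodic T 0 e C g" and e: "norm e = 1" and C: "norm C = exp (\<beta> * T)"
  obtains c where "\<And>z. g z = c * exp (- (\<i> * of_real \<beta> * z))"
proof -
  define G where "G z = g z * exp (\<i> * of_real \<beta> * z)" for z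
  have G: "G holomorphic_on UNIV"
    using g unfolding G_def quasi_periodic_def by (auto intro!: holomorphic_intros)
  have p1: "norm (G (z + of_real (2 * pi))) = norm (G z)" for z
    using g e by (simp add: quasi_periodic_def G_def norm_mult norm_exp_eq_Re)
  have p2: "norm (G (z + \<i> * T)) = norm (G z)" for z
    using g C by (simp add: quasi_periodic_def G_def norm_mult norm_divide norm_exp_eq_Re ring_distribs exp_diff mult_ac)
  have per: "norm (G (z + of_int n * w)) = norm (G z)"
    if w: "\<And>z. norm (G (z + w)) = norm (G z)" for w z :: complex and n :: int
  proof (induction n rule: int_induct[where k = 0])
    case base
    show ?case by simp
  next
    case (step1 i)
    then show ?case using w[of "z + of_int i * w"] by (simp add: algebra_simps)
  next
    case (step2 i)
    then show ?case using w[of "z + of_int (i - 1) * w"] by (simp add: algebra_simps)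
  qed
  have "bounded (range G)"
  proof -
    define K where "K = cbox 0 (Complex (2 * pi) T)"
    have "compact (G ` K)"
      unfolding K_def using G
      by (intro compact_continuous_image continuous_on_subset[OF holomorphic_on_imp_continuous_on[OF G]]) auto
    then obtain B where B: "\<And>z. z \<in> K \<Longrightarrow> norm (G z) \<le> B"
      using compact_imp_bounded by (force simp: bounded_iff)
    have "norm (G z) \<le> B" for z
    proof -
      define j where "j = \<lfloor>Re z / (2 * pi)\<rfloor>"
      define k where "k = \<lfloor>Im z / T\<rfloor>"
      define w where "w = z - of_int j * of_real (2 * pi) - of_int k * (\<i> * T)"
      have j: "of_int j * (2 * pi) \<le> Re z" "Re z \<le> (of_int j + 1) * (2 * pi)"
        using floor_divide_lower[of "2 * pi" "Re z"] floor_divide_upper[of "2 * pi" "Re z"]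
        by (auto simp: j_def)
      have k: "of_int k * T \<le> Im z" "Im z \<le> (of_int k + 1) * T"
        using floor_divide_lower[OF T, of "Im z"] floor_divide_upper[OF T, of "Im z"]
        by (auto simp: k_def)
      have "w \<in> K"
        using j k by (simp add: K_def w_def in_cbox_complex_iff algebra_simps)
      moreover have "norm (G z) = norm (G w)"
      proof -
        have "z = w + of_int j * of_real (2 * pi) + of_int k * (\<i> * T)" by (simp add: w_def)
        then show ?thesis using per[OF p2] per[OF p1] by metis
      qed
      ultimately show ?thesis using B by simp
    qed
    then show ?thesis by (auto simp: bounded_iff)
  qed
  then obtain c where c: "\<And>z. G z = c"
    using Liouville_theorem[OF G] by (auto simp: constant_on_def)
  show thesis
  proof (rule that)
    fix z
    show "g z = c * exp (- (\<i> * of_real \<beta> * z))"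
      unfolding c[of z, symmetric] G_def by (simp add: exp_minus)
  qed
qed

section \<open>Counting zeros on the real axis\<close>

definition distinct_mod_2pi :: "real set \<Rightarrow> bool" where
  "distinct_mod_2pi X \<longleftrightarrow> (\<forall>x\<in>X. \<forall>y\<in>X. \<forall>k::int. x = y + 2 * pi * of_int k \<longrightarrow> x = y)"

lemma jtheta_diff_nonzero:
  assumes T: "T > 0" and X: "distinct_mod_2pi X" "x \<in> X" "y \<in> X" "x \<noteq> y"
  shows "jtheta T (of_real x - of_real y) \<noteq> 0"
proof
  assume "jtheta T (of_real x - of_real y) = 0"
  then obtain j k :: int where jk: "complex_of_real x - of_real y = 2 * pi * of_int j + \<i> * T * of_int k"
    using jtheta_eq_0D[OF T] by blast
  have "Re (complex_of_real x - of_real y) = 2 * pi * of_int j" unfolding jk by simp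
  then have "x = y + 2 * pi * of_int j" by simp
  then show False using X unfolding distinct_mod_2pi_def by blast
qed

text \<open>After the theta factors of the other points are removed, the quotient still vanishes at
  the next point, because those factors are nonzero there. The residual degree \<open>m\<close>
  varies in the induction, since each new point uses up one unit of it.\<close>

lemma quasi_periodic_factor:
  assumes T: "T > 0" and nz: "e \<noteq> 0" "C \<noteq> 0" and X: "finite X" "distinct_mod_2pi X"
    and f: "quasi_periodic T (card X + m) e C f" and zeros: "\<And>x. x \<in> X \<Longrightarrow> f (of_real x) = 0"
  shows "\<exists>g. quasi_periodic T m e (C * (\<Prod>x\<in>X. - exp (- (\<i> * of_real x)))) g \<and>
            (\<forall>z. f z = (\<Prod>x\<in>X. jtheta T (z - of_real x)) * g z)"
  using X f zeros
proof (induction X arbitrary: m rule: finite_induct)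
  case empty
  then show ?case by auto
next
  case (insert x X)
  have dX: "distinct_mod_2pi X" using insert.prems(1) by (auto simp: distinct_mod_2pi_def)
  obtain g where g: "quasi_periodic T (Suc m) e (C * (\<Prod>x\<in>X. - exp (- (\<i> * of_real x)))) g"
     "\<And>z. f z = (\<Prod>x\<in>X. jtheta T (z - of_real x)) * g z"
    using insert.IH[OF dX, of "Suc m"] insert.prems insert.hyps by auto
  have "jtheta T (of_real x - of_real y) \<noteq> 0" if y: "y \<in> X" for y
    by (rule jtheta_diff_nonzero[OF T insert.prems(1)]) (use y insert.hyps in auto)
  then have "(\<Prod>y\<in>X. jtheta T (of_real x - of_real y)) \<noteq> 0"
    using insert.hyps by simp
  moreover have "f (of_real x) = 0" using insert.prems by simp
  ultimately have "g (of_real x) = 0" using g(2)[of "of_real x"] by simp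
  from quasi_periodic_divide[OF T g(1) nz(1) _ this]
  obtain h where h: "quasi_periodic T m e (C * (\<Prod>x\<in>X. - exp (- (\<i> * of_real x))) * - exp (- (\<i> * x))) h"
    "\<And>z. g z = jtheta T (z - of_real x) * h z"
    using nz insert.hyps by auto
  show ?case
  proof (intro exI[of _ h] conjI allI)
    show "quasi_periodic T m e (C * (\<Prod>x\<in>insert x X. - exp (- (\<i> * of_real x)))) h"
      using h(1) insert.hyps by (simp add: mult_ac)
    show "f z = (\<Prod>x\<in>insert x X. jtheta T (z - of_real x)) * h z" for z
      using insert.hyps g(2)[of z] h(2)[of z] by (simp add: mult_ac)
  qed
qed

lemma norm_prod_minus_exp: "norm (\<Prod>x\<in>X. - exp (- (\<i> * complex_of_real x))) = 1"
  by (simp add: prod_norm[symmetric] norm_exp_eq_Re)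

text \<open>Dividing out \<open>m\<close> of the zeros leaves
  \<open>c * exp (- (\<i> * \<beta> * z))\<close>, which has no zeros unless \<open>c = 0\<close>;
  the remaining point then forces \<open>c = 0\<close>.\<close>

lemma quasi_periodic_too_many_zeros:
  assumes T: "T > 0" and e: "norm e = 1" and C: "C \<noteq> 0"
    and f: "quasi_periodic T m e C f"
    and X: "finite X" "distinct_mod_2pi X" "card X = Suc m"
    and zeros: "\<And>x. x \<in> X \<Longrightarrow> f (of_real x) = 0"
  shows "f z = 0"
proof -
  obtain x Y where Y: "X = insert x Y" "x \<notin> Y" "card Y = m" "finite Y"
    using X by (metis card_Suc_eq finite_insert)
  have dY: "distinct_mod_2pi Y" using X Y by (auto simp: distinct_mod_2pi_def)
  have e0: "e \<noteq> 0" using e by auto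
  define D where "D = C * (\<Prod>x\<in>Y. - exp (- (\<i> * of_real x)))"
  define \<beta> where "\<beta> = ln (norm D) / T"
  have "norm D = norm C" by (simp add: D_def norm_mult norm_prod_minus_exp)
  then have D: "norm D = exp (\<beta> * T)" using C T by (simp add: \<beta>_def)
  obtain g where g: "quasi_periodic T 0 e D g" "\<And>z. f z = (\<Prod>x\<in>Y. jtheta T (z - of_real x)) * g z"
    using quasi_periodic_factor[OF T e0 C Y(4) dY, of 0 f] f zeros Y unfolding D_def by auto
  obtain c where c: "\<And>z. g z = c * exp (- (\<i> * of_real \<beta> * z))"
    using quasi_periodic_degree_0[OF T g(1) e D] by blast
  have "jtheta T (of_real x - of_real y) \<noteq> 0" if y: "y \<in> Y" for y
    by (rule jtheta_diff_nonzero[OF T X(2)]) (use y Y in auto)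
  then have "(\<Prod>y\<in>Y. jtheta T (of_real x - of_real y)) \<noteq> 0" using Y by simp
  moreover have "f (of_real x) = 0" using zeros Y by simp
  ultimately have "c = 0" using g(2)[of "of_real x"] c by simp
  then show ?thesis using g(2) c by simp
qed

text \<open>Abel's theorem in disguise: after division by \<open>m\<close> theta factors only an exponential \<open>exp (-\<i> \<beta> z)\<close>
  remains, and its multipliers under the two periods have to match.\<close>
lemma quasi_periodic_zeros_phase:
  assumes T: "T > 0" and e: "norm e = 1" and C: "norm C = exp (\<beta> * T)"
    and f: "quasi_periodic T m e C f"
    and X: "finite X" "distinct_mod_2pi X" "card X = m"
    and zeros: "\<And>x. x \<in> X \<Longrightarrow> f (of_real x) = 0"
    and phase: "e \<noteq> exp (- (2 * pi * \<beta> * \<i>)) \<or> C * (\<Prod>x\<in>X. - exp (- (\<i> * of_real x))) \<noteq> of_real (exp (\<beta> * T))"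
  shows "f z = 0"
proof -
  have nz: "e \<noteq> 0" "C \<noteq> 0" using e C by auto
  define D where "D = C * (\<Prod>x\<in>X. - exp (- (\<i> * of_real x)))"
  have D: "norm D = exp (\<beta> * T)" using C by (simp add: D_def norm_mult norm_prod_minus_exp)
  obtain g where g: "quasi_periodic T 0 e D g" "\<And>z. f z = (\<Prod>x\<in>X. jtheta T (z - of_real x)) * g z"
    using quasi_periodic_factor[OF T nz X(1,2), of 0 f] f zeros X unfolding D_def by auto
  obtain c where c: "\<And>z. g z = c * exp (- (\<i> * of_real \<beta> * z))"
    using quasi_periodic_degree_0[OF T g(1) e D] by blast
  have "g (0 + of_real (2 * pi)) = e * g 0" "g (0 + \<i> * T) = D * exp (- (\<i> * of_nat 0 * 0)) * g 0"
    using g(1) unfolding quasi_periodic_def by blast+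
  then have "c * exp (- (\<i> * of_real \<beta> * of_real (2 * pi))) = e * c" "c * exp (of_real (\<beta> * T)) = D * c"
    unfolding c by (simp_all add: mult_ac)
  then have "c = 0"
    using phase unfolding D_def[symmetric] by (auto simp: mult_ac simp flip: exp_of_real)
  then show ?thesis using g(2) c by simp
qed

section \<open>Gaussian lattice sums\<close>

text \<open>The Fourier modes of a theta series in the variable \<open>x / r\<close>; over all
  \<open>l\<close> they fill one residue class modulo \<open>n\<close>.\<close>

definition freq :: "nat \<Rightarrow> real \<Rightarrow> int \<Rightarrow> real" where
  "freq n J l = real n * (of_int l - 1/2) + J"

text \<open>The sign of the series for \<open>theta1\<close>, made optional so that
  \<open>theta1\<close> and \<open>theta2\<close> are treated together.\<close>

definition alt :: "bool \<Rightarrow> int \<Rightarrow> complex" where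
  "alt b l = (if b \<and> odd l then -1 else 1)"

definition gterm :: "bool \<Rightarrow> nat \<Rightarrow> real \<Rightarrow> real \<Rightarrow> complex \<Rightarrow> int \<Rightarrow> complex" where
  "gterm b n J s z l = alt b l * exp (of_real (- s * (freq n J l)\<^sup>2) + \<i> * of_real (freq n J l) * z)"

definition gseries :: "bool \<Rightarrow> nat \<Rightarrow> real \<Rightarrow> real \<Rightarrow> complex \<Rightarrow> complex" where
  "gseries b n J s z = (\<Sum>\<^sub>\<infinity>l. gterm b n J s z l)"

lemma norm_alt [simp]: "norm (alt b l) = 1"
  by (simp add: alt_def)

lemma norm_gterm: "norm (gterm b n J s z l) = exp (- s * (freq n J l)\<^sup>2 - freq n J l * Im z)"
  by (simp add: gterm_def norm_mult norm_exp_eq_Re)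

lemma summable_on_exp_neg_abs: "(\<lambda>l::int. exp (- \<bar>real_of_int l\<bar>)) summable_on UNIV"
proof -
  have s: "(\<lambda>n::nat. exp (- real n)) summable_on UNIV"
  proof -
    have "summable (\<lambda>n::nat. exp (-1::real) ^ n)"
      by (intro summable_geometric) simp
    then have "summable (\<lambda>n::nat. exp (- real n))"
      by (simp flip: exp_of_nat_mult)
    then show ?thesis by (intro norm_summable_imp_summable_on) simp
  qed
  have 1: "(\<lambda>l::int. exp (- \<bar>real_of_int l\<bar>)) summable_on range int"
    by (subst summable_on_reindex) (use s in \<open>auto simp: o_def\<close>)
  have 2: "(\<lambda>l::int. exp (- \<bar>real_of_int l\<bar>)) summable_on range (\<lambda>n. - 1 - int n)"
  proof (subst summable_on_reindex)
    show "inj (\<lambda>n. - 1 - int n)" by (auto simp: inj_def)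
    have "(\<lambda>n::nat. exp (-1) * exp (- real n)) summable_on UNIV"
      using s by (rule summable_on_cmult_right)
    moreover have "(\<lambda>l::int. exp (- \<bar>real_of_int l\<bar>)) \<circ> (\<lambda>n. - 1 - int n) = (\<lambda>n::nat. exp (-1) * exp (- real n))"
      by (auto simp: fun_eq_iff exp_add[symmetric])
    ultimately show "((\<lambda>l::int. exp (- \<bar>real_of_int l\<bar>)) \<circ> (\<lambda>n. - 1 - int n)) summable_on UNIV"
      by simp
  qed
  have "UNIV = range int \<union> range (\<lambda>n. - 1 - int n)"
  proof safe
    fix x :: int
    assume "x \<notin> range (\<lambda>n. - 1 - int n)"
    moreover have "x = - 1 - int (nat (- 1 - x))" if "x < 0" using that by simp
    ultimately have "x \<ge> 0" by (metis not_le rangeI)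
    then show "x \<in> range int" by (metis nonneg_int_cases rangeI)
  qed auto
  moreover have "range int \<inter> range (\<lambda>n. - 1 - int n) = {}"
  proof -
    have "int i \<noteq> - 1 - int j" for i j by linarith
    then show ?thesis by blast
  qed
  ultimately show ?thesis
    using summable_on_Un_disjoint[OF 1 2] by simp
qed

text \<open>Completing the square bounds \<open>- s * k\<^sup>2 + (Y + 1) * k\<close> by
  \<open>(Y + 1)\<^sup>2 / (4 * s)\<close>, which leaves \<open>exp (- k)\<close>. Since
  \<open>n \<ge> 1\<close>, the modulus \<open>k\<close> of the mode is at least
  \<open>\<bar>l\<bar>\<close> minus \<open>n / 2 + \<bar>J\<bar>\<close>; these terms make up the
  constant \<open>A\<close>.\<close>

lemma summable_on_gaussian:
  assumes "s > 0" "n \<ge> 1"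
  shows "(\<lambda>l. exp (- s * (freq n J l)\<^sup>2 + Y * \<bar>freq n J l\<bar>)) summable_on UNIV"
proof -
  define A where "A = (Y + 1)\<^sup>2 / (4 * s) + real n / 2 + \<bar>J\<bar>"
  have "(\<lambda>l. exp A * exp (- \<bar>real_of_int l\<bar>)) summable_on UNIV"
    by (intro summable_on_cmult_right summable_on_exp_neg_abs)
  then show ?thesis
  proof (rule summable_on_comparison_test)
    fix l :: int
    define k where "k = \<bar>freq n J l\<bar>"
    have k2: "(freq n J l)\<^sup>2 = k\<^sup>2" by (simp add: k_def)
    have "0 \<le> s * (k - (Y + 1) / (2 * s))\<^sup>2" using assms by simp
    also have "\<dots> = s * k\<^sup>2 - (Y + 1) * k + (Y + 1)\<^sup>2 / (4 * s)"
      using assms by (simp add: power2_eq_square field_simps)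
    finally have 1: "- s * k\<^sup>2 + Y * k \<le> - k + (Y + 1)\<^sup>2 / (4 * s)"
      by (simp add: algebra_simps)
    have "\<bar>real_of_int l\<bar> \<le> real n * \<bar>real_of_int l\<bar>"
      using assms mult_right_mono[of 1 "real n" "\<bar>real_of_int l\<bar>"] by simp
    also have "\<dots> = \<bar>freq n J l + real n / 2 - J\<bar>"
      by (simp add: freq_def algebra_simps abs_mult)
    also have "\<dots> \<le> k + real n / 2 + \<bar>J\<bar>" unfolding k_def by linarith
    finally have "- s * k\<^sup>2 + Y * k \<le> A - \<bar>real_of_int l\<bar>"
      using 1 by (simp add: A_def)
    then show "exp (- s * (freq n J l)\<^sup>2 + Y * \<bar>freq n J l\<bar>) \<le> exp A * exp (- \<bar>real_of_int l\<bar>)"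
      unfolding k2 k_def[symmetric] exp_add[symmetric] by simp
  qed simp
qed

text \<open>One majorant for all later times and a whole horizontal strip; it serves uniform
  convergence in space, uniform convergence in time and termwise integration.\<close>

lemma norm_gterm_le:
  assumes "s0 \<le> s" "\<bar>Im z\<bar> \<le> Y"
  shows "norm (gterm b n J s z l) \<le> exp (- s0 * (freq n J l)\<^sup>2 + Y * \<bar>freq n J l\<bar>)"
proof -
  have "- (freq n J l * Im z) \<le> \<bar>freq n J l\<bar> * \<bar>Im z\<bar>"
    by (metis abs_ge_minus_self abs_mult)
  also have "\<dots> \<le> Y * \<bar>freq n J l\<bar>" using assms mult_left_mono[of "\<bar>Im z\<bar>" Y "\<bar>freq n J l\<bar>"] by (simp add: mult.commute)
  finally have "- (freq n J l * Im z) \<le> Y * \<bar>freq n J l\<bar>" .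
  moreover have "s0 * (freq n J l)\<^sup>2 \<le> s * (freq n J l)\<^sup>2" using assms by (intro mult_right_mono) auto
  ultimately show ?thesis unfolding norm_gterm by simp
qed

lemma holomorphic_gseries:
  assumes "s > 0" "n \<ge> 1"
  shows "gseries b n J s holomorphic_on UNIV"
proof -
  have ulim: "uniform_limit (cball 0 R) (\<lambda>L z. \<Sum>l\<in>L. gterm b n J s z l) (gseries b n J s)
      (finite_subsets_at_top UNIV)" for R
    unfolding gseries_def[abs_def]
  proof (rule Weierstrass_m_test_general)
    show "(\<lambda>l. exp (- s * (freq n J l)\<^sup>2 + R * \<bar>freq n J l\<bar>)) summable_on UNIV"
      by (rule summable_on_gaussian[OF assms])
    fix l z assume z: "z \<in> cball (0::complex) R"
    then have "\<bar>Im z\<bar> \<le> R" using abs_Im_le_cmod[of z] by simp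
    then show "norm (gterm b n J s z l) \<le> exp (- s * (freq n J l)\<^sup>2 + R * \<bar>freq n J l\<bar>)"
      by (intro norm_gterm_le) auto
  qed
  have "gseries b n J s holomorphic_on ball 0 R" for R
    by (rule holomorphic_uniform_limit[OF _ ulim])
       (auto simp: gterm_def intro!: always_eventually continuous_intros holomorphic_intros)
  then have "gseries b n J s field_differentiable at w" for w
    by (rule holomorphic_on_imp_differentiable_at[of _ "ball 0 (norm w + 1)"]) auto
  then show ?thesis by (auto intro: holomorphic_onI field_differentiable_at_within)
qed

lemma continuous_on_gseries:
  assumes "s > 0" "n \<ge> 1" "continuous_on A f"
  shows "continuous_on A (\<lambda>x. gseries b n J s (f x))"
  using continuous_on_compose2[OF holomorphic_on_imp_continuous_on[OF holomorphic_gseries[OF assms(1,2)]] assms(3)]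
  by simp

lemma continuous_on_gseries_time:
  assumes "n \<ge> 1" "s0 > 0"
  shows "continuous_on {s0..} (\<lambda>s. gseries b n J s z)"
proof (rule uniform_limit_theorem)
  show "uniform_limit {s0..} (\<lambda>L s. \<Sum>l\<in>L. gterm b n J s z l) (\<lambda>s. gseries b n J s z) (finite_subsets_at_top UNIV)"
    unfolding gseries_def
  proof (rule Weierstrass_m_test_general)
    show "(\<lambda>l. exp (- s0 * (freq n J l)\<^sup>2 + \<bar>Im z\<bar> * \<bar>freq n J l\<bar>)) summable_on UNIV"
      using assms by (intro summable_on_gaussian)
    show "norm (gterm b n J s z l) \<le> exp (- s0 * (freq n J l)\<^sup>2 + \<bar>Im z\<bar> * \<bar>freq n J l\<bar>)" if "s \<in> {s0..}" for s l
      using that by (intro norm_gterm_le) auto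
  qed
qed (auto simp: gterm_def intro!: always_eventually continuous_intros)

lemma cnj_gseries: "cnj (gseries b n J s (of_real y)) = gseries b n J s (- of_real y)"
  unfolding gseries_def infsum_cnj[symmetric]
  by (rule infsum_cong) (simp add: gterm_def alt_def exp_cnj add.commute)

section \<open>Gaussian series under the two periods\<close>

lemma alt_plus_1: "alt b (l + 1) = (if b then -1 else 1) * alt b l"
  by (auto simp: alt_def)

text \<open>With \<open>k = freq n J l\<close> and \<open>T = 2 * s * n\<close>, the extra exponent
  \<open>- 2 * s * n * k\<close> completes \<open>- s * k\<^sup>2\<close> to
  \<open>- s * (k + n)\<^sup>2 + s * n\<^sup>2\<close>. The shift in \<open>z\<close> thus becomes
  the index shift \<open>l + 1\<close>.\<close>

lemma gseries_plus_quasi_period: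
  assumes n: "T = 2 * s * real n"
  shows "gseries b n J s (z + \<i> * T) =
     (if b then -1 else 1) * exp (of_real (s * real n ^ 2)) * exp (- (\<i> * of_nat n * z)) * gseries b n J s z"
proof -
  define c where "c = (if b then -1 else 1) * exp (of_real (s * real n ^ 2)) * exp (- (\<i> * of_nat n * z))"
  have "gterm b n J s (z + \<i> * T) l = c * gterm b n J s z (l + 1)" for l
  proof -
    have fr: "freq n J (l + 1) = freq n J l + n" by (simp add: freq_def algebra_simps)
    have ee: "of_real (- s * (freq n J l)\<^sup>2) + \<i> * of_real (freq n J l) * (z + \<i> * T) =
      (of_real (s * real n ^ 2) + - (\<i> * of_nat n * z)) +
      (of_real (- s * (freq n J (l + 1))\<^sup>2) + \<i> * of_real (freq n J (l + 1)) * z)"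
      unfolding fr n by (simp add: algebra_simps power2_eq_square complex_eq_iff)
    show ?thesis
      unfolding gterm_def ee c_def alt_plus_1 exp_add[of "_ + _" "_ + _"] exp_add[of "_" "- (\<i> * of_nat n * z)"]
      by (simp add: mult_ac)
  qed
  then have "gseries b n J s (z + \<i> * T) = (\<Sum>\<^sub>\<infinity>l. c * gterm b n J s z (l + 1))"
    by (simp add: gseries_def)
  also have "\<dots> = c * (\<Sum>\<^sub>\<infinity>l. gterm b n J s z (l + 1))"
    by (rule infsum_cmult_right')
  also have "(\<Sum>\<^sub>\<infinity>l. gterm b n J s z (l + 1)) = gseries b n J s z"
    unfolding gseries_def
    by (rule infsum_reindex_bij_witness[of _ "\<lambda>l. l - 1" "\<lambda>l. l + 1"]) auto
  finally show ?thesis unfolding c_def .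
qed

text \<open>The reflected series satisfies the same equation: the previous lemma at
  \<open>w = - (z + \<i> * T)\<close> expresses the value at \<open>- z\<close>, and solving for the
  value at \<open>w\<close> inverts the multiplier, whose sign squares to 1.\<close>

lemma gseries_minus_quasi_period:
  assumes n: "T = 2 * s * real n"
  shows "gseries b n J s (- (z + \<i> * T)) =
     (if b then -1 else 1) * exp (of_real (s * real n ^ 2)) * exp (- (\<i> * of_nat n * z)) * gseries b n J s (- z)"
proof -
  define w where "w = - (z + \<i> * T)"
  define \<sigma> :: complex where "\<sigma> = (if b then -1 else 1)"
  define E where "E = exp (of_real (s * real n ^ 2)) * exp (- (\<i> * of_nat n * w))"
  have wz: "w + \<i> * T = - z" by (simp add: w_def)
  have "gseries b n J s (- z) = \<sigma> * E * gseries b n J s w"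
    using gseries_plus_quasi_period[OF n, of b J w] unfolding wz \<sigma>_def E_def by (simp add: mult_ac)
  moreover have "\<sigma> * \<sigma> = 1" by (simp add: \<sigma>_def)
  moreover have "E * (exp (of_real (s * real n ^ 2)) * exp (- (\<i> * of_nat n * z))) = 1"
  proof -
    have "(of_real (s * real n ^ 2) + - (\<i> * of_nat n * w)) + (of_real (s * real n ^ 2) + - (\<i> * of_nat n * z)) = 0"
      unfolding w_def n by (simp add: algebra_simps power2_eq_square complex_eq_iff)
    then show ?thesis unfolding E_def exp_add[symmetric] by simp
  qed
  ultimately show ?thesis
    unfolding w_def[symmetric] \<sigma>_def[symmetric] by (metis (no_types, lifting) mult.assoc mult.commute mult.left_neutral)
qed

text \<open>The assumption says that every mode is \<open>n * l + p / 2\<close>, so all modes are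
  integers or all are half-integers, according to the parity of \<open>p\<close>.\<close>

lemma gseries_plus_period:
  fixes z :: complex
  assumes "2 * (J - real n / 2) = of_int p"
  shows "gseries b n J s (z + 2 * pi) = (if even p then 1 else -1) * gseries b n J s z"
    and "gseries b n J s (- (z + 2 * pi)) = (if even p then 1 else -1) * gseries b n J s (- z)"
proof -
  define e :: complex where "e = (if even p then 1 else -1)"
  have fr: "freq n J l = of_int (int n * l) + of_int p / 2" for l
    using assms by (simp add: freq_def algebra_simps)
  have eip: "exp (\<i> * of_real (pi * of_int p)) = e"
  proof -
    have "exp (\<i> * of_real (pi * of_int p)) = cis (pi * of_int p)"
      by (simp only: cis_conv_exp)
    also have "\<dots> = e"
      using sin_npi_int[of p] cos_npi_int[of p] by (simp add: e_def complex_eq_iff)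
    finally show ?thesis .
  qed
  have ex: "exp (\<i> * of_real (freq n J l) * of_real (2 * pi)) = e" for l
  proof -
    have "\<i> * of_real (freq n J l) * of_real (2 * pi) = 2 * of_real pi * \<i> * of_int (int n * l) + \<i> * of_real (pi * of_int p)"
      unfolding fr by (simp add: algebra_simps)
    moreover have "exp (2 * of_real pi * \<i> * of_int (int n * l)) = 1"
      using exp_integer_2pi[OF Ints_of_int, of "int n * l"] by (simp add: mult_ac)
    ultimately show ?thesis using eip by (simp add: exp_add)
  qed
  have ex': "exp (- (\<i> * of_real (freq n J l) * of_real (2 * pi))) = e" for l
    unfolding exp_minus ex by (simp add: e_def)
  have g1: "gterm b n J s (z + 2 * pi) l = e * gterm b n J s z l" for l
    unfolding gterm_def ring_distribs exp_add ex by (simp add: mult_ac)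
  have g2: "gterm b n J s (- (z + 2 * pi)) l = e * gterm b n J s (- z) l" for l
    unfolding gterm_def minus_add_distrib ring_distribs exp_add mult_minus_right ex' by (simp add: mult_ac)
  show "gseries b n J s (z + 2 * pi) = (if even p then 1 else -1) * gseries b n J s z"
    unfolding gseries_def e_def[symmetric] g1 by (rule infsum_cmult_right')
  show "gseries b n J s (- (z + 2 * pi)) = (if even p then 1 else -1) * gseries b n J s (- z)"
    unfolding gseries_def e_def[symmetric] g2 by (rule infsum_cmult_right')
qed

section \<open>Termwise integration over a full period\<close>

lemma has_sum_integral:
  fixes g :: "'i \<Rightarrow> real \<Rightarrow> complex"
  assumes cont: "\<And>l. continuous_on {a..b} (g l)"
    and bound: "\<And>l y. y \<in> {a..b} \<Longrightarrow> norm (g l y) \<le> M l" and M: "M summable_on UNIV"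
  shows "((\<lambda>l. integral {a..b} (g l)) has_sum integral {a..b} (\<lambda>y. \<Sum>\<^sub>\<infinity>l. g l y)) UNIV"
proof -
  have ul: "uniform_limit {a..b} (\<lambda>L y. \<Sum>l\<in>L. g l y) (\<lambda>y. \<Sum>\<^sub>\<infinity>l. g l y) (finite_subsets_at_top UNIV)"
    by (rule Weierstrass_m_test_general) (use bound M in auto)
  obtain I J where IJ: "\<And>L. ((\<lambda>y. \<Sum>l\<in>L. g l y) has_integral I L) {a..b}"
    "((\<lambda>y. \<Sum>\<^sub>\<infinity>l. g l y) has_integral J) {a..b}" "(I \<longlongrightarrow> J) (finite_subsets_at_top UNIV)"
    using uniform_limit_integral[OF ul] cont by (auto intro!: continuous_on_sum)
  have J: "J = integral {a..b} (\<lambda>y. \<Sum>\<^sub>\<infinity>l. g l y)"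
    using IJ(2) by (simp add: integral_unique)
  have "I L = (\<Sum>l\<in>L. integral {a..b} (g l))" if "finite L" for L
  proof -
    have "((\<lambda>y. \<Sum>l\<in>L. g l y) has_integral (\<Sum>l\<in>L. integral {a..b} (g l))) {a..b}"
      using that cont by (intro has_integral_sum integrable_integral integrable_continuous_real) auto
    then show ?thesis using IJ(1) has_integral_unique by blast
  qed
  then have "eventually (\<lambda>L. I L = (\<Sum>l\<in>L. integral {a..b} (g l))) (finite_subsets_at_top UNIV)"
    by (auto intro: eventually_finite_subsets_at_top_weakI)
  with IJ(3) have "((\<lambda>L. \<Sum>l\<in>L. integral {a..b} (g l)) \<longlongrightarrow> J) (finite_subsets_at_top UNIV)"
    by (rule Lim_transform_eventually)
  then show ?thesis unfolding J has_sum_def .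
qed

lemma integral_exp_full_period:
  assumes "\<kappa> \<in> \<int>"
  shows "integral {c..c + 2 * pi} (\<lambda>y. exp (\<i> * of_real \<kappa> * of_real y)) = (if \<kappa> = 0 then of_real (2 * pi) else 0)"
proof (cases "\<kappa> = 0")
  case True
  then show ?thesis by (simp add: scaleR_conv_of_real)
next
  case False
  define F where "F y = exp (\<i> * of_real \<kappa> * of_real y) / (\<i> * of_real \<kappa>)" for y :: real
  have "((\<lambda>y. exp (\<i> * of_real \<kappa> * of_real y)) has_integral F (c + 2 * pi) - F c) {c..c + 2 * pi}"
  proof (rule fundamental_theorem_of_calculus)
    fix y :: real
    have "((\<lambda>y. exp (\<i> * of_real \<kappa> * y) / (\<i> * of_real \<kappa>)) has_field_derivative exp (\<i> * of_real \<kappa> * of_real y)) (at (of_real y))"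
      using False by (auto intro!: derivative_eq_intros)
    then show "(F has_vector_derivative exp (\<i> * of_real \<kappa> * of_real y)) (at y within {c..c + 2 * pi})"
      unfolding F_def by (rule has_vector_derivative_real_field)
  qed simp
  moreover have "F (c + 2 * pi) = F c"
  proof -
    obtain k :: int where k: "\<kappa> = of_int k" using assms by (auto elim: Ints_cases)
    have "\<i> * of_real \<kappa> * of_real (c + 2 * pi) = \<i> * of_real \<kappa> * of_real c + 2 * of_int k * pi * \<i>"
      unfolding k by (simp add: algebra_simps)
    then show ?thesis
      unfolding F_def using exp_integer_2pi[OF Ints_of_int, of k] by (simp add: exp_add)
  qed
  ultimately show ?thesis using False by (simp add: integral_unique)
qed

text \<open>Both sums are integrated term by term. For each \<open>l\<close> at most one
  \<open>m\<close> gives total frequency zero: it is \<open>\<phi> l\<close>, and it exists exactly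
  under \<open>P\<close>. The number \<open>\<epsilon>\<close> is a sign, so that matching modes
  have equal squares and the times \<open>s\<close> and \<open>s'\<close> add in the
  exponent.\<close>

lemma integral_gseries_mult:
  fixes \<epsilon> c :: real
  assumes n: "n \<ge> 1" and s: "s > 0" "s' > 0"
    and int: "\<And>l m. freq n J l + \<epsilon> * freq n J' m \<in> \<int>"
    and match: "\<And>l m. freq n J l + \<epsilon> * freq n J' m = 0 \<longleftrightarrow> P \<and> m = \<phi> l"
    and \<epsilon>: "\<epsilon> * \<epsilon> = 1"
  shows "integral {c..c + 2 * pi} (\<lambda>y. gseries b n J s (of_real y) * gseries b n J' s' (of_real (\<epsilon> * y)))
     = (if P then of_real (2 * pi) * (\<Sum>\<^sub>\<infinity>l. alt b l * alt b (\<phi> l) * exp (of_real (- (s + s') * (freq n J l)\<^sup>2))) else 0)"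
proof -
  let ?I = "{c..c + 2 * pi}"
  have nb: "norm (gterm b n J s (of_real y) l) \<le> exp (- s * (freq n J l)\<^sup>2 + 0 * \<bar>freq n J l\<bar>)"
    if "s > 0" for b J s l and y :: real
    by (rule norm_gterm_le) auto
  have contH: "continuous_on ?I (\<lambda>y. gseries b n J' s' (of_real (\<epsilon> * y)))"
    by (intro continuous_on_gseries n s continuous_intros)
  then obtain B where B: "\<And>y. y \<in> ?I \<Longrightarrow> norm (gseries b n J' s' (of_real (\<epsilon> * y))) \<le> B"
    using compact_continuous_image[OF contH] compact_imp_bounded by (force simp: bounded_iff)
  have inner: "integral ?I (\<lambda>y. gterm b n J s (of_real y) l * gseries b n J' s' (of_real (\<epsilon> * y))) =
      (if P then of_real (2 * pi) * (alt b l * alt b (\<phi> l) * exp (of_real (- (s + s') * (freq n J l)\<^sup>2))) else 0)" for l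
  proof -
    let ?g = "\<lambda>m y. gterm b n J s (of_real y) l * gterm b n J' s' (of_real (\<epsilon> * y)) m"
    have "((\<lambda>m. integral ?I (?g m)) has_sum integral ?I (\<lambda>y. \<Sum>\<^sub>\<infinity>m. ?g m y)) UNIV"
    proof (rule has_sum_integral)
      show "continuous_on ?I (?g m)" for m
        unfolding gterm_def by (intro continuous_intros)
      show "norm (?g m y) \<le> exp (- s * (freq n J l)\<^sup>2 + 0 * \<bar>freq n J l\<bar>) * exp (- s' * (freq n J' m)\<^sup>2 + 0 * \<bar>freq n J' m\<bar>)"
        for m y unfolding norm_mult by (intro mult_mono nb s) auto
      show "(\<lambda>m. exp (- s * (freq n J l)\<^sup>2 + 0 * \<bar>freq n J l\<bar>) * exp (- s' * (freq n J' m)\<^sup>2 + 0 * \<bar>freq n J' m\<bar>)) summable_on UNIV"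
        by (intro summable_on_cmult_right summable_on_gaussian s n)
    qed
    also have "(\<lambda>y. \<Sum>\<^sub>\<infinity>m. ?g m y) = (\<lambda>y. gterm b n J s (of_real y) l * gseries b n J' s' (of_real (\<epsilon> * y)))"
      by (simp add: gseries_def infsum_cmult_right')
    finally have hs: "((\<lambda>m. integral ?I (?g m)) has_sum
       integral ?I (\<lambda>y. gterm b n J s (of_real y) l * gseries b n J' s' (of_real (\<epsilon> * y)))) UNIV" .
    have val: "integral ?I (?g m) = (if P \<and> m = \<phi> l then
        of_real (2 * pi) * (alt b l * alt b (\<phi> l) * exp (of_real (- (s + s') * (freq n J l)\<^sup>2))) else 0)" for m
    proof -
      define A where "A = alt b l * alt b m * exp (of_real (- s * (freq n J l)\<^sup>2 - s' * (freq n J' m)\<^sup>2))"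
      have "?g m y = A * exp (\<i> * of_real (freq n J l + \<epsilon> * freq n J' m) * of_real y)" for y
      proof -
        have "(of_real (- s * (freq n J l)\<^sup>2) + \<i> * of_real (freq n J l) * of_real y) +
              (of_real (- s' * (freq n J' m)\<^sup>2) + \<i> * of_real (freq n J' m) * of_real (\<epsilon> * y)) =
          of_real (- s * (freq n J l)\<^sup>2 - s' * (freq n J' m)\<^sup>2) + \<i> * complex_of_real (freq n J l + \<epsilon> * freq n J' m) * of_real y"
          by (simp add: algebra_simps)
        from arg_cong[OF this, of exp] show ?thesis
          unfolding gterm_def A_def exp_add[of "_ + _" "_ + _"] exp_add[of _ "_ * _ * of_real y"]
          by (simp add: mult_ac exp_add)
      qed
      then have "integral ?I (?g m) = A * (if freq n J l + \<epsilon> * freq n J' m = 0 then of_real (2 * pi) else 0)"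
        using integral_exp_full_period[OF int[of l m], of c] by (simp only: integral_mult_right)
      also have "\<dots> = (if P \<and> m = \<phi> l then
        of_real (2 * pi) * (alt b l * alt b (\<phi> l) * exp (of_real (- (s + s') * (freq n J l)\<^sup>2))) else 0)"
      proof (cases "freq n J l + \<epsilon> * freq n J' m = 0")
        case True
        then have "freq n J l = - (\<epsilon> * freq n J' m)" by simp
        then have "(freq n J l)\<^sup>2 = (\<epsilon> * \<epsilon>) * (freq n J' m)\<^sup>2" by (simp add: power2_eq_square)
        then have "(freq n J' m)\<^sup>2 = (freq n J l)\<^sup>2" by (simp add: \<epsilon>)
        then show ?thesis using True match[of l m] by (simp add: A_def algebra_simps)
      next
        case False
        then have "\<not> (P \<and> m = \<phi> l)" using match[of l m] by simp
        then show ?thesis using False by (simp only: if_False mult_zero_right)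
      qed
      finally show ?thesis .
    qed
    have "((\<lambda>m. integral ?I (?g m)) has_sum (if P then
        of_real (2 * pi) * (alt b l * alt b (\<phi> l) * exp (of_real (- (s + s') * (freq n J l)\<^sup>2))) else 0)) UNIV"
      unfolding val by (rule has_sum_finite_neutralI[where B = "{\<phi> l}"]) auto
    with hs show ?thesis by (rule has_sum_unique)
  qed
  let ?h = "\<lambda>l y. gterm b n J s (of_real y) l * gseries b n J' s' (of_real (\<epsilon> * y))"
  have "((\<lambda>l. integral ?I (?h l)) has_sum integral ?I (\<lambda>y. \<Sum>\<^sub>\<infinity>l. ?h l y)) UNIV"
  proof (rule has_sum_integral)
    show "continuous_on ?I (?h l)" for l
      unfolding gterm_def by (intro continuous_intros contH)
    show "norm (?h l y) \<le> exp (- s * (freq n J l)\<^sup>2 + 0 * \<bar>freq n J l\<bar>) * B" if "y \<in> ?I" for l y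
      unfolding norm_mult using that by (intro mult_mono nb s B) auto
    show "(\<lambda>l. exp (- s * (freq n J l)\<^sup>2 + 0 * \<bar>freq n J l\<bar>) * B) summable_on UNIV"
      by (intro summable_on_cmult_left summable_on_gaussian s n)
  qed
  then have "integral ?I (\<lambda>y. \<Sum>\<^sub>\<infinity>l. ?h l y) = (\<Sum>\<^sub>\<infinity>l. integral ?I (?h l))"
    by (simp add: infsumI)
  also have "(\<lambda>y. \<Sum>\<^sub>\<infinity>l. ?h l y) = (\<lambda>y. gseries b n J s (of_real y) * gseries b n J' s' (of_real (\<epsilon> * y)))"
    by (simp add: gseries_def infsum_cmult_left')
  also have "(\<Sum>\<^sub>\<infinity>l. integral ?I (?h l)) =
     (if P then of_real (2 * pi) * (\<Sum>\<^sub>\<infinity>l. alt b l * alt b (\<phi> l) * exp (of_real (- (s + s') * (freq n J l)\<^sup>2))) else 0)"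
    unfolding inner by (simp add: infsum_cmult_right')
  finally show ?thesis .
qed

lemma gseries_0_pos:
  assumes "s > 0" "n \<ge> 1"
  obtains c where "c > 0" "gseries False n J s 0 = of_real c"
proof -
  let ?f = "\<lambda>l. exp (- s * (freq n J l)\<^sup>2)"
  have sm: "?f summable_on UNIV" using summable_on_gaussian[OF assms, of J 0] by simp
  have "gseries False n J s 0 = (\<Sum>\<^sub>\<infinity>l. of_real (?f l))"
    by (simp add: gseries_def gterm_def alt_def exp_of_real[symmetric])
  also have "\<dots> = of_real (\<Sum>\<^sub>\<infinity>l. ?f l)"
    by (rule infsumI[OF has_sum_of_real[OF has_sum_infsum[OF sm]]])
  finally have eq: "gseries False n J s 0 = of_real (\<Sum>\<^sub>\<infinity>l. ?f l)" .
  have "?f 0 = (\<Sum>\<^sub>\<infinity>l\<in>{0}. ?f l)" by simp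
  also have "\<dots> \<le> (\<Sum>\<^sub>\<infinity>l. ?f l)"
    by (rule infsum_mono_neutral) (use sm in auto)
  finally have "(\<Sum>\<^sub>\<infinity>l. ?f l) > 0" using exp_gt_zero[of "- s * (freq n J 0)\<^sup>2"] by linarith
  then show thesis using eq by (rule that)
qed

section \<open>The functions of the seven root systems\<close>

text \<open>This is \<open>Ncal\<close> as a natural number (truncated only at \<open>N = 0\<close>); it is the number of zeros of the functions \<open>Mfun\<close> per
  period parallelogram.\<close>
fun theta_degree :: "root_sys \<Rightarrow> nat \<Rightarrow> nat" where
  "theta_degree RA N = N" | "theta_degree RB N = 2 * N - 1"
| "theta_degree RBv N = 2 * N" | "theta_degree RCv N = 2 * N"
| "theta_degree RC N = 2 * (N + 1)" | "theta_degree RBC N = 2 * N + 1"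
| "theta_degree RD N = 2 * (N - 1)"

definition alternating :: "root_sys \<Rightarrow> bool" where
  "alternating R \<longleftrightarrow> R = RB \<or> R = RBv"

text \<open>The value 0 switches off the reflected summand for \<open>RA\<close>, so that one
  formula serves all seven types.\<close>

fun reflection_sign :: "root_sys \<Rightarrow> real" where
  "reflection_sign RA = 0" | "reflection_sign RD = 1"
| "reflection_sign RB = -1" | "reflection_sign RBv = -1" | "reflection_sign RC = -1"
| "reflection_sign RCv = -1" | "reflection_sign RBC = -1"

text \<open>Up to the factor \<open>exp (s * J\<^sup>2)\<close> and a phase this is \<open>Mfun\<close> in the variables \<open>z = x / r\<close> and \<open>s = t / (2 * r\<^sup>2)\<close>:
  a Fourier series with Gaussian coefficients whose modes fill one residue class modulo the degree, reflected for the types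
  other than \<open>RA\<close>.\<close>
definition Hfun :: "root_sys \<Rightarrow> nat \<Rightarrow> nat \<Rightarrow> real \<Rightarrow> complex \<Rightarrow> complex" where
  "Hfun R N j s z = gseries (alternating R) (theta_degree R N) (Jfun R j) s z
     + of_real (reflection_sign R) * gseries (alternating R) (theta_degree R N) (Jfun R j) s (- z)"

text \<open>The indices whose residue class of modes is invariant under reflection, so that the squared norm doubles.\<close>
definition doubled :: "root_sys \<Rightarrow> nat \<Rightarrow> nat \<Rightarrow> bool" where
  "doubled R N j \<longleftrightarrow> (R = RB \<or> R = RBv \<or> R = RD) \<and> j = 1 \<or> R = RD \<and> j = N"

text \<open>For \<open>RD\<close> the value \<open>N = 1\<close> would make \<open>Ncal\<close> zero
  and the theta parameters degenerate.\<close>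

locale root_system =
  fixes R :: root_sys and N :: nat
  assumes N1: "N \<ge> 1" and N2: "R = RD \<Longrightarrow> N \<ge> 2"
begin

abbreviation "deg \<equiv> theta_degree R N"

lemma Ncal_eq: "Ncal R N = real deg"
  using N1 N2 by (cases R) (auto simp: of_nat_diff)

lemma deg_pos: "deg \<ge> 1"
  using N1 N2 by (cases R) auto

end

text \<open>Here \<open>pi * \<i> * \<tau> = - n\<^sup>2 * s\<close>, and with
  \<open>a = l - 1/2\<close> the quadratic part is \<open>- s * (n * a)\<^sup>2 - 2 * s * n * a * J
  = s * J\<^sup>2 - s * (n * a + J)\<^sup>2\<close>. This is the origin of the factor
  \<open>exp (s * J\<^sup>2)\<close>.\<close>

lemma theta_exponent:
  fixes J :: real and w :: complex
  assumes n: "n \<ge> 1" and r: "r > 0" and s: "s = t / (2 * r\<^sup>2)"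
  defines "\<tau> \<equiv> of_real ((real n)\<^sup>2) * tau r t" and "\<sigma> \<equiv> J / real n"
  shows "exp (2 * pi * \<i> * \<sigma> * w) * (exp (pi * \<i> * \<tau> * (of_int l - 1/2)\<^sup>2) * exp (pi * \<i> * (\<sigma> * \<tau> + w) * (2 * of_int l - 1)))
    = exp (of_real (s * J\<^sup>2)) * exp (of_real (- s * (freq n J l)\<^sup>2) + \<i> * of_real (freq n J l) * (2 * pi * w / n))"
proof -
  have \<tau>: "pi * \<i> * \<tau> = of_real (- (real n ^ 2 * s))"
    using r by (simp add: \<tau>_def tau_def s power2_eq_square field_simps)
  define a :: complex where "a = of_int l - 1/2"
  have n0: "(of_nat n :: complex) \<noteq> 0" using n by simp
  have 1: "2 * pi * \<i> * \<sigma> * w + pi * \<i> * w * (2 * a) = \<i> * of_real (freq n J l) * (2 * pi * w / n)"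
    using n0 by (simp add: \<sigma>_def freq_def a_def field_simps)
  have 2: "(pi * \<i> * \<tau>) * a\<^sup>2 + (pi * \<i> * \<tau>) * \<sigma> * (2 * a) = of_real (s * J\<^sup>2) + of_real (- s * (freq n J l)\<^sup>2)"
    unfolding \<tau> using n0 by (simp add: \<sigma>_def freq_def a_def field_simps power2_eq_square)
  have 3: "2 * of_int l - 1 = 2 * a" by (simp add: a_def)
  have "2 * pi * \<i> * \<sigma> * w + (pi * \<i> * \<tau> * a\<^sup>2 + pi * \<i> * (\<sigma> * \<tau> + w) * (2 * a)) =
    (2 * pi * \<i> * \<sigma> * w + pi * \<i> * w * (2 * a)) + ((pi * \<i> * \<tau>) * a\<^sup>2 + (pi * \<i> * \<tau>) * \<sigma> * (2 * a))"
    by (simp add: algebra_simps)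
  also have "\<dots> = of_real (s * J\<^sup>2) + (of_real (- s * (freq n J l)\<^sup>2) + \<i> * of_real (freq n J l) * (2 * pi * w / n))"
    unfolding 1 2 by simp
  finally have "2 * pi * \<i> * \<sigma> * w + (pi * \<i> * \<tau> * a\<^sup>2 + pi * \<i> * (\<sigma> * \<tau> + w) * (2 * a)) =
     of_real (s * J\<^sup>2) + (of_real (- s * (freq n J l)\<^sup>2) + \<i> * of_real (freq n J l) * (2 * pi * w / n))" .
  from arg_cong[OF this, of exp] show ?thesis
    unfolding a_def[symmetric] 3 exp_add[symmetric] .
qed

lemma theta2_eq_gseries:
  fixes J :: real and w :: complex
  assumes n: "n \<ge> 1" and r: "r > 0" and s: "s = t / (2 * r\<^sup>2)"
  defines "\<tau> \<equiv> of_real ((real n)\<^sup>2) * tau r t" and "\<sigma> \<equiv> J / real n"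
  shows "exp (2 * pi * \<i> * \<sigma> * w) * theta2 (\<sigma> * \<tau> + w) \<tau> = exp (of_real (s * J\<^sup>2)) * gseries False n J s (2 * pi * w / n)"
  unfolding theta2_def gseries_def gterm_def infsum_cmult_right'[symmetric] \<tau>_def \<sigma>_def
    theta_exponent[OF n r s]
  by (simp add: alt_def)

lemma theta1_eq_gseries:
  fixes J :: real and w :: complex
  assumes n: "n \<ge> 1" and r: "r > 0" and s: "s = t / (2 * r\<^sup>2)"
  defines "\<tau> \<equiv> of_real ((real n)\<^sup>2) * tau r t" and "\<sigma> \<equiv> J / real n"
  shows "exp (2 * pi * \<i> * \<sigma> * w) * theta1 (\<sigma> * \<tau> + w) \<tau> = \<i> * exp (of_real (s * J\<^sup>2)) * gseries True n J s (2 * pi * w / n)"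
proof -
  have alt: "alt True l = (if even l then 1 else -1)" for l by (simp add: alt_def)
  have "exp (2 * pi * \<i> * \<sigma> * w) * theta1 (\<sigma> * \<tau> + w) \<tau> =
    \<i> * (\<Sum>\<^sub>\<infinity>l. alt True l * (exp (2 * pi * \<i> * \<sigma> * w) * (exp (pi * \<i> * \<tau> * (of_int l - 1/2)\<^sup>2) * exp (pi * \<i> * (\<sigma> * \<tau> + w) * (2 * of_int l - 1)))))"
    unfolding theta1_def alt[symmetric] by (simp add: mult_ac flip: infsum_cmult_right')
  then show ?thesis
    unfolding \<tau>_def \<sigma>_def theta_exponent[OF n r s] gseries_def gterm_def
    by (simp add: mult_ac flip: infsum_cmult_right')
qed

context root_system
begin

text \<open>The imaginary unit in front of the \<open>theta1\<close> series. Having modulus one, it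
  disappears whenever a function meets a conjugate one.\<close>

definition prefactor :: complex where "prefactor = (if alternating R then \<i> else 1)"

lemma Mfun_eq:
  assumes r: "r > 0" and s: "s = t / (2 * r\<^sup>2)"
  shows "Mfun R N r j x t = prefactor * exp (of_real (s * (Jfun R j)\<^sup>2)) * Hfun R N j s (of_real (x / r))"
proof -
  define w where "w = complex_of_real (Ncal R N * xi r x)"
  have w: "of_real (2 * pi) * w / of_nat deg = of_real (x / r)"
    using deg_pos r by (simp add: w_def Ncal_eq xi_def field_simps)
  have w': "of_real (2 * pi) * (- w) / of_nat deg = - of_real (x / r)"
    using w by simp
  define \<sigma> where "\<sigma> = Jfun R j / real deg"
  define \<tau> where "\<tau> = of_real ((real deg)\<^sup>2) * tau r t"
  define E where "E = complex_of_real (s * (Jfun R j)\<^sup>2)"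
  note t2 = theta2_eq_gseries[OF deg_pos r s, of "Jfun R j", folded \<sigma>_def \<tau>_def E_def]
    and t1 = theta1_eq_gseries[OF deg_pos r s, of "Jfun R j", folded \<sigma>_def \<tau>_def E_def]
  have M: "Mfun R N r j x t = Theta (sharp R) \<sigma> w \<tau>"
    by (simp add: Mfun_def w_def \<sigma>_def \<tau>_def Ncal_eq)
  show ?thesis
    using t2[of w, unfolded w] t2[of "- w", unfolded w'] t1[of w, unfolded w] t1[of "- w", unfolded w']
    unfolding M Theta_def Hfun_def prefactor_def E_def[symmetric]
    by (cases "sharp R"; cases R; simp add: alternating_def ring_distribs mult.assoc del: theta_degree.simps Jfun.simps)
qed

text \<open>The general formula is the theta series at \<open>w = 0\<close>. The special cases fit
  in because \<open>Jfun R 1 = 0\<close> for \<open>RB\<close>, \<open>RBv\<close>,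
  \<open>RD\<close> and \<open>Jfun RD N = N - 1\<close>; only the factor 2 distinguishes
  them.\<close>

lemma mconst_eq:
  assumes r: "r > 0" and s: "s = t / (2 * r\<^sup>2)"
  shows "mconst R N r t j = (if doubled R N j then 2 else 1) * of_real (2 * pi * r) *
     (exp (of_real (s * (Jfun R j)\<^sup>2)) * gseries False deg (Jfun R j) s 0)"
proof -
  have J0: "theta2 (of_real (real deg * Jfun R j) * tau r t) (of_real ((real deg)\<^sup>2) * tau r t) =
      exp (of_real (s * (Jfun R j)\<^sup>2)) * gseries False deg (Jfun R j) s 0"
  proof -
    have "of_real (Jfun R j / real deg) * (of_real ((real deg)\<^sup>2) * tau r t) + 0 = of_real (real deg * Jfun R j) * tau r t"
      using deg_pos by (simp add: power2_eq_square)
    then show ?thesis using theta2_eq_gseries[OF deg_pos r s, of "Jfun R j" 0] by simp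
  qed
  have J1: "theta2 0 (of_real ((real deg)\<^sup>2) * tau r t) =
      exp (of_real (s * (Jfun R j)\<^sup>2)) * gseries False deg (Jfun R j) s 0" if "Jfun R j = 0"
    using J0 that by simp
  show ?thesis
    unfolding mconst_def Let_def Ncal_eq doubled_def
    using J0 J1 N1 N2 by (cases R) (auto simp: mult_ac)
qed

lemma mconst_pos:
  assumes r: "r > 0" and t: "t > 0"
  obtains c where "c > 0" "mconst R N r t j = of_real c"
proof -
  define s where "s = t / (2 * r\<^sup>2)"
  have s: "s > 0" using r t by (simp add: s_def)
  obtain c where c: "c > 0" "gseries False deg (Jfun R j) s 0 = of_real c"
    using gseries_0_pos[OF s deg_pos] .
  show thesis
  proof (rule that)
    show "mconst R N r t j = of_real ((if doubled R N j then 2 else 1) * (2 * pi * r) * (exp (s * (Jfun R j)\<^sup>2) * c))"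
      unfolding mconst_eq[OF r s_def] c(2) exp_of_real by simp
  qed (use c r in auto)
qed

lemma Jfun_diff: "Jfun R j - Jfun R j' = real_of_int (int j - int j')"
  by (cases R) auto

text \<open>The sum decides whether the modes of \<open>j\<close> meet the reflected modes of
  \<open>j'\<close>, which happens only if it is a multiple of the degree. The ends \<open>0\<close>
  and \<open>deg\<close> of its range are reached only at the self-reflected indices.\<close>

lemma Jfun_sum:
  assumes "j \<in> {1..N}" "j' \<in> {1..N}"
  obtains S :: int where "Jfun R j + Jfun R j' = of_int S"
    "R \<noteq> RA \<Longrightarrow> 0 \<le> S \<and> S \<le> int deg"
    "R \<noteq> RA \<Longrightarrow> S = 0 \<longleftrightarrow> (R = RB \<or> R = RBv \<or> R = RD) \<and> j = 1 \<and> j' = 1"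
    "R \<noteq> RA \<Longrightarrow> S = int deg \<longleftrightarrow> R = RD \<and> j = N \<and> j' = N"
proof -
  \<comment> \<open>The subtracted number is twice the shift in \<open>Jfun\<close>, namely 1/2, 1
    or 0 according to the type.\<close>
  define S :: int where "S = int j + int j' - (case R of RA \<Rightarrow> 1 | RCv \<Rightarrow> 1 | RB \<Rightarrow> 2 | RBv \<Rightarrow> 2 | RD \<Rightarrow> 2 | _ \<Rightarrow> 0)"
  show thesis
    by (rule that[of S]) (use assms N1 N2 in \<open>cases R; auto simp: S_def of_nat_diff\<close>)+
qed

lemma Jfun_diff_less_deg: "j \<in> {1..N} \<Longrightarrow> j' \<in> {1..N} \<Longrightarrow> \<bar>int j - int j'\<bar> < int deg"
  using N1 N2 by (cases R) auto

end

lemma int_mult_eq_small: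
  fixes n q d :: int
  assumes "n * q = d" "\<bar>d\<bar> < n"
  shows "q = 0"
proof (rule ccontr)
  assume "q \<noteq> 0"
  then have "n * 1 \<le> \<bar>n\<bar> * \<bar>q\<bar>" using assms by (intro mult_mono) auto
  with assms show False by (simp add: abs_mult[symmetric])
qed

section \<open>Biorthogonality of the theta functions\<close>

context root_system
begin

text \<open>Modes of \<open>j\<close> and \<open>j'\<close> differ by a multiple of the degree plus
  \<open>j - j'\<close>. The latter is smaller than the degree in modulus, so equal modes require
  equal indices and \<open>l = m\<close>.\<close>

lemma integral_gseries_diff:
  assumes j: "j \<in> {1..N}" "j' \<in> {1..N}" and s: "s > 0" "s' > 0"
  shows "integral {c..c + 2 * pi} (\<lambda>y. gseries b deg (Jfun R j) s (of_real y) * gseries b deg (Jfun R j') s' (- of_real y))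
     = (if j = j' then of_real (2 * pi) * gseries False deg (Jfun R j) (s + s') 0 else 0)"
proof -
  have fr: "freq deg (Jfun R j) l + (-1) * freq deg (Jfun R j') m = of_int (int deg * (l - m) + (int j - int j'))" for l m
    using Jfun_diff[of j j'] by (simp add: freq_def algebra_simps)
  have m0: "int deg * (l - m) + (int j - int j') = 0 \<longleftrightarrow> j = j' \<and> m = l" for l m
  proof
    assume *: "int deg * (l - m) + (int j - int j') = 0"
    then have "l - m = 0"
      using Jfun_diff_less_deg[OF j] by (intro int_mult_eq_small[of "int deg" _ "int j' - int j"]) auto
    with * show "j = j' \<and> m = l" by auto
  qed auto
  have "integral {c..c + 2 * pi} (\<lambda>y. gseries b deg (Jfun R j) s (of_real y) * gseries b deg (Jfun R j') s' (of_real ((-1) * y)))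
     = (if j = j' then of_real (2 * pi) * (\<Sum>\<^sub>\<infinity>l. alt b l * alt b l * exp (of_real (- (s + s') * (freq deg (Jfun R j) l)\<^sup>2))) else 0)"
  proof (rule integral_gseries_mult)
    show "freq deg (Jfun R j) l + (-1) * freq deg (Jfun R j') m \<in> \<int>" for l m unfolding fr by (rule Ints_of_int)
    show "freq deg (Jfun R j) l + (-1) * freq deg (Jfun R j') m = 0 \<longleftrightarrow> j = j' \<and> m = l" for l m
      unfolding fr using m0[of l m] by (metis of_int_eq_0_iff)
  qed (use deg_pos s in auto)
  also have "(\<Sum>\<^sub>\<infinity>l. alt b l * alt b l * exp (of_real (- (s + s') * (freq deg (Jfun R j) l)\<^sup>2))) = gseries False deg (Jfun R j) (s + s') 0"
    unfolding gseries_def by (rule infsum_cong) (simp add: gterm_def alt_def)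
  finally show ?thesis by simp
qed

text \<open>Opposite modes need \<open>deg * (l + m - 1) + S = 0\<close>, so \<open>S = 0\<close>
  with \<open>m = 1 - l\<close>, or \<open>S = deg\<close> with \<open>m = - l\<close>. For
  \<open>RB\<close> and \<open>RBv\<close> only the first case occurs; then \<open>l\<close> and
  \<open>m\<close> have opposite parity, and the resulting sign cancels the reflection sign. For
  \<open>RD\<close> both signs are positive.\<close>

lemma integral_gseries_sum:
  assumes RA: "R \<noteq> RA" and j: "j \<in> {1..N}" "j' \<in> {1..N}" and s: "s > 0" "s' > 0"
  shows "of_real (reflection_sign R) *
     integral {c..c + 2 * pi} (\<lambda>y. gseries (alternating R) deg (Jfun R j) s (of_real y) * gseries (alternating R) deg (Jfun R j') s' (of_real y))
     = (if j = j' \<and> doubled R N j then of_real (2 * pi) * gseries False deg (Jfun R j) (s + s') 0 else 0)"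
proof -
  obtain S where S: "Jfun R j + Jfun R j' = of_int S" "0 \<le> S" "S \<le> int deg"
    "S = 0 \<longleftrightarrow> (R = RB \<or> R = RBv \<or> R = RD) \<and> j = 1 \<and> j' = 1"
    "S = int deg \<longleftrightarrow> R = RD \<and> j = N \<and> j' = N"
    using Jfun_sum[OF j] RA by metis
  define \<phi> where "\<phi> l = (if S = 0 then 1 - l else - l)" for l :: int
  define P where "P \<longleftrightarrow> S = 0 \<or> S = int deg"
  have fr: "freq deg (Jfun R j) l + 1 * freq deg (Jfun R j') m = of_int (int deg * (l + m - 1) + S)" for l m
    using S(1) by (simp add: freq_def algebra_simps)
  have m0: "int deg * (l + m - 1) + S = 0 \<longleftrightarrow> P \<and> m = \<phi> l" for l m
  proof
    assume *: "int deg * (l + m - 1) + S = 0"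
    show "P \<and> m = \<phi> l"
    proof (cases "S = int deg")
      case True
      then have "int deg * (l + m) = 0" using * by (simp add: algebra_simps)
      then show ?thesis using deg_pos True by (auto simp: P_def \<phi>_def)
    next
      case False
      have "l + m - 1 = 0"
        using S(2,3) False * by (intro int_mult_eq_small[of "int deg" _ "- S"]) auto
      with * show ?thesis by (auto simp: P_def \<phi>_def)
    qed
  next
    assume "P \<and> m = \<phi> l"
    then show "int deg * (l + m - 1) + S = 0" using deg_pos by (auto simp: P_def \<phi>_def)
  qed
  have PR: "P \<longleftrightarrow> j = j' \<and> doubled R N j"
    unfolding P_def S(4,5) doubled_def using j by auto
  have sg: "of_real (reflection_sign R) * (alt (alternating R) l * alt (alternating R) (\<phi> l)) = 1" if P for l
    using that S(4,5) deg_pos unfolding P_def \<phi>_def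
    by (cases R) (auto simp: alt_def alternating_def)
  have "integral {c..c + 2 * pi} (\<lambda>y. gseries (alternating R) deg (Jfun R j) s (of_real y) * gseries (alternating R) deg (Jfun R j') s' (of_real (1 * y)))
     = (if P then of_real (2 * pi) * (\<Sum>\<^sub>\<infinity>l. alt (alternating R) l * alt (alternating R) (\<phi> l) * exp (of_real (- (s + s') * (freq deg (Jfun R j) l)\<^sup>2))) else 0)"
  proof (rule integral_gseries_mult)
    show "freq deg (Jfun R j) l + 1 * freq deg (Jfun R j') m \<in> \<int>" for l m unfolding fr by (rule Ints_of_int)
    show "freq deg (Jfun R j) l + 1 * freq deg (Jfun R j') m = 0 \<longleftrightarrow> P \<and> m = \<phi> l" for l m
      unfolding fr using m0[of l m] by (metis of_int_eq_0_iff)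
  qed (use deg_pos s in auto)
  then have "of_real (reflection_sign R) *
     integral {c..c + 2 * pi} (\<lambda>y. gseries (alternating R) deg (Jfun R j) s (of_real y) * gseries (alternating R) deg (Jfun R j') s' (of_real y))
     = (if P then of_real (2 * pi) * (\<Sum>\<^sub>\<infinity>l. of_real (reflection_sign R) * (alt (alternating R) l * alt (alternating R) (\<phi> l)) * exp (of_real (- (s + s') * (freq deg (Jfun R j) l)\<^sup>2))) else 0)"
    by (simp add: mult.assoc mult.left_commute infsum_cmult_right')
  also have "\<dots> = (if P then of_real (2 * pi) * gseries False deg (Jfun R j) (s + s') 0 else 0)"
    using sg by (auto simp: gseries_def gterm_def alt_def intro!: infsum_cong)
  finally show ?thesis unfolding PR .
qed

end

lemma integral_rescale:
  fixes F :: "real \<Rightarrow> complex"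
  assumes "r > 0"
  shows "integral {0..c * r} (\<lambda>x. F (x / r)) = of_real r * integral {0..c} F"
proof -
  have "(\<lambda>x. x / (1 / r)) ` {0..c} = {0..c * r}"
    using image_mult_atLeastAtMost[OF assms, of 0 c] by (simp add: mult.commute)
  then show ?thesis
    using integral_stretch_real[of "1 / r" 0 c F] assms by (simp add: scaleR_conv_of_real)
qed

context root_system
begin

lemma continuous_on_Hfun:
  assumes "s > 0" "continuous_on A f"
  shows "continuous_on A (\<lambda>x. Hfun R N j s (f x))"
  unfolding Hfun_def using assms deg_pos
  by (intro continuous_intros continuous_on_gseries) auto

lemma cnj_Hfun:
  assumes "R \<noteq> RA"
  shows "cnj (Hfun R N j s (of_real y)) = of_real (reflection_sign R) * Hfun R N j s (of_real y)"
  using assms cnj_gseries[of "alternating R" deg "Jfun R j" s y] cnj_gseries[of "alternating R" deg "Jfun R j" s "- y"]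
  unfolding Hfun_def by (cases R) (simp_all add: algebra_simps)

lemma reflection_sign_squared: "R \<noteq> RA \<Longrightarrow> reflection_sign R * reflection_sign R = 1"
  by (cases R) auto

text \<open>For the reflected types the integrand is \<open>u y + u (- y)\<close>, so the integral
  over the half period unfolds to one of \<open>u\<close> over the full period, where exponentials
  are orthogonal. The difference part of \<open>u\<close> gives the norm, and the sum part repeats
  it for the doubled indices.\<close>

lemma Hfun_biorthogonal:
  assumes j: "j \<in> {1..N}" "j' \<in> {1..N}" and s: "s > 0" "s' > 0"
  shows "integral {0..if R = RA then 2 * pi else pi} (\<lambda>y. Hfun R N j s (of_real y) * cnj (Hfun R N j' s' (of_real y)))
     = (if j = j' then (if doubled R N j then 2 else 1) * of_real (2 * pi) * gseries False deg (Jfun R j) (s + s') 0 else 0)"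
proof (cases "R = RA")
  case True
  then show ?thesis
    using integral_gseries_diff[OF j s, of 0] by (auto simp: Hfun_def cnj_gseries alternating_def doubled_def)
next
  case False
  define A where "A y = gseries (alternating R) deg (Jfun R j) s (of_real y)" for y :: real
  define B where "B y = gseries (alternating R) deg (Jfun R j') s' (of_real y)" for y :: real
  define \<delta> where "\<delta> = complex_of_real (reflection_sign R)"
  have \<delta>: "\<delta> * \<delta> = 1" using reflection_sign_squared[OF False] by (simp add: \<delta>_def flip: of_real_mult)
  have cA: "continuous_on S (\<lambda>y. A (f y))" "continuous_on S (\<lambda>y. B (f y))" if "continuous_on S f" for f and S :: "real set"
    unfolding A_def B_def using that s deg_pos by (intro continuous_on_gseries continuous_intros; simp)+
  define u where "u y = A y * B (- y) + \<delta> * (A y * B y)" for y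
  have cu: "continuous_on S (\<lambda>y. u (f y))" if "continuous_on S f" for f and S :: "real set"
    unfolding u_def using that by (intro continuous_intros cA)
  have H: "Hfun R N j s (of_real y) * cnj (Hfun R N j' s' (of_real y)) = u y + u (- y)" for y
  proof -
    have "cnj (Hfun R N j' s' (of_real y)) = \<delta> * (B y + \<delta> * B (- y))"
      unfolding cnj_Hfun[OF False] \<delta>_def by (simp add: Hfun_def B_def)
    also have "\<dots> = \<delta> * B y + (\<delta> * \<delta>) * B (- y)" by (simp only: distrib_left mult.assoc)
    finally have "cnj (Hfun R N j' s' (of_real y)) = \<delta> * B y + B (- y)" using \<delta> by simp
    moreover have "Hfun R N j s (of_real y) = A y + \<delta> * A (- y)" by (simp add: Hfun_def A_def \<delta>_def)
    moreover have "(A y + \<delta> * A (- y)) * (\<delta> * B y + B (- y)) = A y * B (- y) + \<delta> * (A y * B y) + ((\<delta> * \<delta>) * A (- y) * B y + \<delta> * (A (- y) * B (- y)))"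
      by (simp add: algebra_simps)
    ultimately show ?thesis using \<delta> by (simp add: u_def)
  qed
  have int: "(\<lambda>y. u (f y)) integrable_on {a..b}" if "continuous_on {a..b} f" for f and a b :: real
    using cu[OF that] by (rule integrable_continuous_real)
  have "integral {0..pi} (\<lambda>y. u y + u (- y)) = integral {0..pi} u + integral {0..pi} (\<lambda>y. u (- y))"
    by (intro Henstock_Kurzweil_Integration.integral_add int continuous_intros)
  also have "integral {0..pi} (\<lambda>y. u (- y)) = integral {- pi..0} u"
    using Henstock_Kurzweil_Integration.integral_reflect_real[of 0 "- pi" u] by simp
  also have "integral {0..pi} u + integral {- pi..0} u = integral {- pi..pi} u"
    using Henstock_Kurzweil_Integration.integral_combine[of "- pi" 0 pi u] int[of _ _ "\<lambda>y. y"] by (simp add: add.commute)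
  also have "\<dots> = integral {- pi..- pi + 2 * pi} (\<lambda>y. A y * B (- y)) + \<delta> * integral {- pi..- pi + 2 * pi} (\<lambda>y. A y * B y)"
    unfolding u_def by (subst Henstock_Kurzweil_Integration.integral_add)
      (auto intro!: integrable_continuous_real continuous_intros cA)
  also have "\<delta> * integral {- pi..- pi + 2 * pi} (\<lambda>y. A y * B y) =
     (if j = j' \<and> doubled R N j then of_real (2 * pi) * gseries False deg (Jfun R j) (s + s') 0 else 0)"
    unfolding \<delta>_def A_def B_def by (rule integral_gseries_sum[OF False j s])
  also have "integral {- pi..- pi + 2 * pi} (\<lambda>y. A y * B (- y)) =
     (if j = j' then of_real (2 * pi) * gseries False deg (Jfun R j) (s + s') 0 else 0)"
    using integral_gseries_diff[OF j s, of "- pi" "alternating R"] unfolding A_def B_def by simp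
  finally show ?thesis using False unfolding H by simp
qed

lemma set_integral_Ldom:
  fixes f :: "real \<Rightarrow> complex"
  assumes r: "r > 0" and f: "continuous_on UNIV f"
  shows "set_integrable lborel (Ldom R r) f"
    and "(LINT x:Ldom R r|lborel. f x) = integral {0..(if R = RA then 2 * pi else pi) * r} f"
proof -
  define c where "c = (if R = RA then 2 * pi else pi) * r"
  have si: "set_integrable lborel {0..c} f"
    unfolding set_integrable_def using f
    by (intro borel_integrable_compact) (auto intro: continuous_on_subset)
  have "(LINT x:{0..c}|lborel. f x) = integral {0..c} f"
    using set_borel_integral_eq_integral[OF si] by simp
  moreover have "(LINT x:Ldom R r|lborel. f x) = (LINT x:{0..c}|lborel. f x)"
  proof (rule set_integral_cong_set)
    have "f \<in> borel_measurable lborel" using f by (simp add: borel_measurable_continuous_onI)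
    then show "set_borel_measurable lborel {0..c} f" "set_borel_measurable lborel (Ldom R r) f"
      unfolding set_borel_measurable_def by (auto simp: Ldom_def)
    \<comment> \<open>For \<open>RA\<close> the half-open interval differs from the closed one only
      by this null endpoint.\<close>
    have "AE x in lborel. x \<noteq> c" by (rule AE_lborel_singleton)
    then show "AE x in lborel. (x \<in> {0..c}) = (x \<in> Ldom R r)"
      by eventually_elim (auto simp: Ldom_def c_def)
  qed
  ultimately show "(LINT x:Ldom R r|lborel. f x) = integral {0..(if R = RA then 2 * pi else pi) * r} f"
    unfolding c_def by simp
  show "set_integrable lborel (Ldom R r) f"
    by (rule set_integrable_subset[OF si]) (auto simp: Ldom_def c_def)
qed

lemma continuous_on_Mfun:
  assumes r: "r > 0" and t: "t > 0" and f: "continuous_on A f"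
  shows "continuous_on A (\<lambda>x. Mfun R N r j (f x) t)"
proof -
  have "continuous_on A (\<lambda>x. Hfun R N j (t / (2 * r\<^sup>2)) (of_real (f x / r)))"
    using r t f by (intro continuous_on_Hfun continuous_intros) auto
  then show ?thesis unfolding Mfun_eq[OF r refl] by (intro continuous_intros)
qed

lemma prefactor_mult_cnj: "prefactor * cnj prefactor = 1"
  by (simp add: prefactor_def)

text \<open>The times add in the Gaussian coefficients and in the factors
  \<open>exp (s * J\<^sup>2)\<close>; at \<open>t' = ts - t\<close> this yields the constants at
  \<open>ts\<close>.\<close>

lemma Mfun_biorthogonal:
  assumes r: "r > 0" and t: "t > 0" "t' > 0" and j: "j \<in> {1..N}" "j' \<in> {1..N}"
  shows "(LINT x:Ldom R r|lborel. Mfun R N r j x t * cnj (Mfun R N r j' x t')) =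
    (if j = j' then mconst R N r (t + t') j else 0)"
proof -
  define s where "s = t / (2 * r\<^sup>2)"
  define s' where "s' = t' / (2 * r\<^sup>2)"
  have s: "s > 0" "s' > 0" using r t by (auto simp: s_def s'_def)
  have ss: "s + s' = (t + t') / (2 * r\<^sup>2)" by (simp add: s_def s'_def add_divide_distrib)
  define c where "c = exp (complex_of_real (s * (Jfun R j)\<^sup>2)) * exp (of_real (s' * (Jfun R j')\<^sup>2))"
  define F where "F y = Hfun R N j s (of_real y) * cnj (Hfun R N j' s' (of_real y))" for y :: real
  have eq: "Mfun R N r j x t * cnj (Mfun R N r j' x t') = c * F (x / r)" for x
  proof -
    have "Mfun R N r j x t * cnj (Mfun R N r j' x t') = (prefactor * cnj prefactor) * (c * F (x / r))"
      unfolding Mfun_eq[OF r s_def] Mfun_eq[OF r s'_def] c_def F_def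
      by (simp add: exp_cnj mult_ac)
    then show ?thesis by (simp add: prefactor_mult_cnj)
  qed
  have "(LINT x:Ldom R r|lborel. Mfun R N r j x t * cnj (Mfun R N r j' x t')) =
     integral {0..(if R = RA then 2 * pi else pi) * r} (\<lambda>x. Mfun R N r j x t * cnj (Mfun R N r j' x t'))"
    using r t by (intro set_integral_Ldom continuous_intros continuous_on_Mfun) auto
  also have "\<dots> = c * (of_real r * integral {0..if R = RA then 2 * pi else pi} F)"
    unfolding eq using integral_rescale[OF r, of "if R = RA then 2 * pi else pi" F] by simp
  also have "integral {0..if R = RA then 2 * pi else pi} F =
     (if j = j' then (if doubled R N j then 2 else 1) * of_real (2 * pi) * gseries False deg (Jfun R j) (s + s') 0 else 0)"
    unfolding F_def by (rule Hfun_biorthogonal[OF j s])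
  finally show ?thesis
    unfolding mconst_eq[OF r ss] by (simp add: c_def algebra_simps exp_add)
qed

text \<open>Parity of \<open>2 * Jfun R j - deg\<close>, which does not depend on \<open>j\<close>:
  the functions are \<open>2 * pi\<close>-periodic if it is even and antiperiodic otherwise.\<close>

definition period_even :: bool where
  "period_even \<longleftrightarrow> (case R of RA \<Rightarrow> odd N | RBv \<Rightarrow> True | RC \<Rightarrow> True | RD \<Rightarrow> True | _ \<Rightarrow> False)"

lemma Jfun_period:
  obtains p :: int where "2 * (Jfun R j - real deg / 2) = of_int p" "even p \<longleftrightarrow> period_even"
proof -
  define p where "p = 2 * int j - int deg - (case R of RA \<Rightarrow> 1 | RCv \<Rightarrow> 1 | RB \<Rightarrow> 2 | RBv \<Rightarrow> 2 | RD \<Rightarrow> 2 | _ \<Rightarrow> 0)"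
  show thesis
  proof (rule that)
    show "2 * (Jfun R j - real deg / 2) = of_int p"
      by (cases R) (simp_all add: p_def field_simps)
    show "even p \<longleftrightarrow> period_even"
      unfolding period_even_def using N1 N2 by (cases R) (simp_all add: p_def of_nat_diff)
  qed
qed

text \<open>The multipliers depend on the type and the degree but not on the index \<open>j\<close>,
  so linear combinations stay in one space of theta functions.\<close>

lemma quasi_periodic_Hfun_sum:
  assumes s: "s > 0"
  shows "quasi_periodic (2 * s * real deg) deg (if period_even then 1 else -1)
     ((if alternating R then -1 else 1) * exp (of_real (s * (real deg)\<^sup>2))) (\<lambda>z. \<Sum>j\<in>I. a j * Hfun R N j s z)"
  unfolding quasi_periodic_def
proof (intro conjI allI)
  have neg: "(\<lambda>z. gseries b deg J s (- z)) holomorphic_on UNIV" for b J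
  proof -
    have "(gseries b deg J s \<circ> uminus) holomorphic_on UNIV"
      using holomorphic_gseries[OF s deg_pos]
      by (intro holomorphic_on_compose_gen[where t = UNIV] holomorphic_intros) auto
    then show ?thesis by (simp add: o_def)
  qed
  show "(\<lambda>z. \<Sum>j\<in>I. a j * Hfun R N j s z) holomorphic_on UNIV"
    unfolding Hfun_def by (intro holomorphic_intros holomorphic_gseries[OF s deg_pos] neg)
  show "(\<Sum>j\<in>I. a j * Hfun R N j s (z + 2 * pi)) = (if period_even then 1 else -1) * (\<Sum>j\<in>I. a j * Hfun R N j s z)" for z :: complex
  proof -
    have "Hfun R N j s (z + 2 * pi) = (if period_even then 1 else -1) * Hfun R N j s z" for j
    proof -
      obtain p :: int where p: "2 * (Jfun R j - real deg / 2) = of_int p" "even p \<longleftrightarrow> period_even"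
        by (rule Jfun_period)
      show ?thesis
        unfolding Hfun_def gseries_plus_period[OF p(1)] p(2) by (simp add: algebra_simps)
    qed
    then show ?thesis by (simp add: sum_distrib_left mult_ac)
  qed
  show "(\<Sum>j\<in>I. a j * Hfun R N j s (z + \<i> * of_real (2 * s * real deg))) =
      (if alternating R then - 1 else 1) * exp (of_real (s * (real deg)\<^sup>2)) * exp (- (\<i> * of_nat deg * z)) *
      (\<Sum>j\<in>I. a j * Hfun R N j s z)" for z
  proof -
    define C where "C = (if alternating R then - 1 else 1) * exp (of_real (s * (real deg)\<^sup>2)) * exp (- (\<i> * of_nat deg * z))"
    have "Hfun R N j s (z + \<i> * of_real (2 * s * real deg)) = C * Hfun R N j s z" for j
      unfolding Hfun_def gseries_plus_quasi_period[OF refl] gseries_minus_quasi_period[OF refl] C_def[symmetric]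
      by (simp only: distrib_left mult.left_commute)
    then show ?thesis unfolding C_def[symmetric] by (simp add: sum_distrib_left mult.left_commute)
  qed
qed

text \<open>Pairing with the \<open>l\<close>-th function at the same time \<open>s\<close> isolates
  \<open>a l\<close> times a positive squared norm.\<close>

lemma Hfun_linear_independent:
  assumes s: "s > 0" and a: "\<And>y. (\<Sum>j\<in>{1..N}. a j * Hfun R N j s (of_real y)) = 0" and l: "l \<in> {1..N}"
  shows "a l = 0"
proof -
  let ?I = "{0..if R = RA then 2 * pi else pi}"
  have "(\<Sum>j\<in>{1..N}. a j * integral ?I (\<lambda>y. Hfun R N j s (of_real y) * cnj (Hfun R N l s (of_real y)))) =
     (\<Sum>j\<in>{1..N}. integral ?I (\<lambda>y. a j * (Hfun R N j s (of_real y) * cnj (Hfun R N l s (of_real y)))))"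
    by (simp only: integral_mult_right)
  also have "\<dots> = integral ?I (\<lambda>y. \<Sum>j\<in>{1..N}. a j * (Hfun R N j s (of_real y) * cnj (Hfun R N l s (of_real y))))"
    using s by (intro integral_sum[symmetric] integrable_continuous_real continuous_intros continuous_on_Hfun) auto
  also have "\<dots> = integral ?I (\<lambda>y. (\<Sum>j\<in>{1..N}. a j * Hfun R N j s (of_real y)) * cnj (Hfun R N l s (of_real y)))"
    by (simp add: sum_distrib_right mult.assoc)
  also have "\<dots> = 0" unfolding a by simp
  finally have 0: "(\<Sum>j\<in>{1..N}. a j * integral ?I (\<lambda>y. Hfun R N j s (of_real y) * cnj (Hfun R N l s (of_real y)))) = 0" .
  obtain c where c: "c > 0" "gseries False deg (Jfun R l) (s + s) 0 = of_real c"
    using gseries_0_pos[of "s + s" deg] s deg_pos by auto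
  have "(\<Sum>j\<in>{1..N}. a j * integral ?I (\<lambda>y. Hfun R N j s (of_real y) * cnj (Hfun R N l s (of_real y)))) =
    (\<Sum>j\<in>{1..N}. if j = l then a j * ((if doubled R N j then 2 else 1) * of_real (2 * pi) * gseries False deg (Jfun R j) (s + s) 0) else 0)"
    using Hfun_biorthogonal[OF _ l s s] by (intro sum.cong refl) (simp add: if_distrib)
  also have "\<dots> = a l * ((if doubled R N l then 2 else 1) * of_real (2 * pi) * of_real c)"
    using l c by (simp add: sum.delta)
  finally show ?thesis using 0 c by (auto split: if_splits)
qed

end

lemma distinct_mod_2piI:
  assumes "\<And>x y. x \<in> X \<Longrightarrow> y \<in> X \<Longrightarrow> \<bar>x - y\<bar> < 2 * pi"
  shows "distinct_mod_2pi X"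
  unfolding distinct_mod_2pi_def
proof safe
  fix y and k :: int
  assume "y + 2 * pi * of_int k \<in> X" "y \<in> X"
  from assms[OF this] have "2 * pi * \<bar>real_of_int k\<bar> < 2 * pi * 1" by (simp add: abs_mult)
  then have "\<bar>real_of_int k\<bar> < 1" by (subst (asm) mult_less_cancel_left_pos) auto
  then show "y + 2 * pi * of_int k = y" by simp
qed

section \<open>Sign of the determinants\<close>

context root_system
begin

text \<open>For the reflected types the endpoints are excluded because \<open>y k\<close> and
  \<open>- y k\<close> coincide there modulo \<open>2 * pi\<close>, which would spoil the count of
  zeros.\<close>

definition interior_config :: "(nat \<Rightarrow> real) \<Rightarrow> bool" where
  "interior_config y \<longleftrightarrow> inj_on y {1..N} \<and>
     (\<forall>k\<in>{1..N}. if R = RA then 0 \<le> y k \<and> y k < 2 * pi else 0 < y k \<and> y k < pi)"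

text \<open>For the types other than \<open>RA\<close> the combination also vanishes at the points \<open>- y k\<close> by symmetry, at \<open>0\<close> if it is odd,
  and at \<open>pi\<close> if it is odd and periodic. These are more zeros than the degree, except for \<open>RA\<close>, \<open>RBC\<close> and \<open>RC\<close>, where
  their number equals the degree and the multipliers do not match.\<close>
lemma Hfun_sum_eq_0:
  assumes s: "s > 0" and y: "interior_config y"
    and zeros: "\<And>k. k \<in> {1..N} \<Longrightarrow> (\<Sum>j\<in>{1..N}. a j * Hfun R N j s (of_real (y k))) = 0"
  shows "(\<Sum>j\<in>{1..N}. a j * Hfun R N j s z) = 0"
proof -
  define f where "f z = (\<Sum>j\<in>{1..N}. a j * Hfun R N j s z)" for z
  define T where "T = 2 * s * real deg"
  define e :: complex where "e = (if period_even then 1 else -1)"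
  define C where "C = (if alternating R then -1 else 1) * exp (complex_of_real (s * (real deg)\<^sup>2))"
  \<comment> \<open>Forced by \<open>norm C = exp (s * deg\<^sup>2)\<close> and
    \<open>T = 2 * s * deg\<close>.\<close>
  define \<beta> where "\<beta> = real deg / 2"
  have T: "T > 0" using s deg_pos by (simp add: T_def)
  have e: "norm e = 1" by (simp add: e_def)
  have \<beta>T: "\<beta> * T = s * (real deg)\<^sup>2" by (simp add: \<beta>_def T_def power2_eq_square)
  have C: "norm C = exp (\<beta> * T)" unfolding \<beta>T C_def by (simp add: norm_mult norm_exp_eq_Re)
  have C0: "C \<noteq> 0" by (simp add: C_def)
  have f: "quasi_periodic T deg e C f"
    unfolding T_def e_def C_def f_def by (rule quasi_periodic_Hfun_sum[OF s])
  have fy: "f (of_real (y k)) = 0" if "k \<in> {1..N}" for k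
    using zeros[OF that] by (simp add: f_def)
  have inj: "inj_on y {1..N}" using y by (simp add: interior_config_def)
  have "f z = 0"
  proof (cases "R = RA")
    case True
    have deg: "deg = N" using True by simp
    show ?thesis
    proof (rule quasi_periodic_zeros_phase[OF T e C f, of "y ` {1..N}"])
      show "distinct_mod_2pi (y ` {1..N})"
      proof (rule distinct_mod_2piI)
        fix u v assume "u \<in> y ` {1..N}" "v \<in> y ` {1..N}"
        then have "0 \<le> u" "u < 2 * pi" "0 \<le> v" "v < 2 * pi"
          using y[unfolded interior_config_def] True by auto
        then show "\<bar>u - v\<bar> < 2 * pi" by linarith
      qed
      show "card (y ` {1..N}) = deg" using inj deg by (simp add: card_image)
      \<comment> \<open>The real period alone is contradictory: an exponential would need the
        multiplier \<open>(-1) ^ N\<close>, whereas \<open>e\<close> is its negative.\<close>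
      have "Re (exp (- (2 * pi * \<beta> * \<i>))) = (-1) ^ N"
        by (simp add: \<beta>_def deg Re_exp cos_npi2)
      moreover have "Re e = - ((-1) ^ N)" unfolding e_def period_even_def using True by simp
      ultimately show "e \<noteq> exp (- (2 * pi * \<beta> * \<i>)) \<or>
          C * (\<Prod>x\<in>y ` {1..N}. - exp (- (\<i> * of_real x))) \<noteq> of_real (exp (\<beta> * T))"
        by (cases "even N") auto
    qed (use fy in auto)
  next
    case False
    have yr: "0 < y k" "y k < pi" if "k \<in> {1..N}" for k
      using y[unfolded interior_config_def] False that by auto
    define \<delta> where "\<delta> = complex_of_real (reflection_sign R)"
    have \<delta>: "\<delta> * \<delta> = 1" using reflection_sign_squared[OF False] by (simp add: \<delta>_def flip: of_real_mult)
    have Hm: "Hfun R N j s (- z) = \<delta> * Hfun R N j s z" for j z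
    proof -
      define g where "g = gseries (alternating R) deg (Jfun R j) s"
      have "Hfun R N j s (- z) = (\<delta> * \<delta>) * g (- z) + \<delta> * g z"
        unfolding \<delta> by (simp add: Hfun_def g_def \<delta>_def)
      also have "\<dots> = \<delta> * Hfun R N j s z" by (simp add: Hfun_def g_def \<delta>_def algebra_simps)
      finally show ?thesis .
    qed
    have fm: "f (- z) = \<delta> * f z" for z
      unfolding f_def Hm by (simp add: sum_distrib_left mult_ac)
    define X where "X = y ` {1..N} \<union> (\<lambda>k. - y k) ` {1..N}"
    have Xfin: "finite X" by (simp add: X_def)
    have Xr: "x \<noteq> 0 \<and> - pi < x \<and> x < pi" if "x \<in> X" for x
    proof -
      obtain k where k: "k \<in> {1..N}" "x = y k \<or> x = - y k" using \<open>x \<in> X\<close> unfolding X_def by blast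
      show ?thesis using k(2) yr[OF k(1)] by linarith
    qed
    have inj': "inj_on (\<lambda>k. - y k) {1..N}"
    proof (rule inj_onI)
      fix k l assume "k \<in> {1..N}" "l \<in> {1..N}" "- y k = - y l"
      then show "k = l" by (intro inj_onD[OF inj]) linarith+
    qed
    have disj: "y ` {1..N} \<inter> (\<lambda>k. - y k) ` {1..N} = {}"
    proof (rule equals0I)
      fix x assume "x \<in> y ` {1..N} \<inter> (\<lambda>k. - y k) ` {1..N}"
      then obtain k l where kl: "k \<in> {1..N}" "l \<in> {1..N}" "x = y k" "x = - y l" by blast
      show False using yr(1)[OF kl(1)] yr(1)[OF kl(2)] kl(3,4) by linarith
    qed
    have Xcard: "card X = 2 * N"
      unfolding X_def using inj inj' disj by (simp add: card_Un_disjoint card_image)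
    \<comment> \<open>A pair \<open>y k\<close>, \<open>- y k\<close> contributes two inverse
      exponentials and two minus signs, hence 1, so only the extra zeros at 0 and \<open>pi\<close>
      affect the multiplier.\<close>
    have Xprod: "(\<Prod>x\<in>X. - exp (- (\<i> * complex_of_real x))) = 1"
    proof -
      have "(\<Prod>x\<in>X. - exp (- (\<i> * complex_of_real x))) =
        (\<Prod>k\<in>{1..N}. - exp (- (\<i> * complex_of_real (y k)))) * (\<Prod>k\<in>{1..N}. - exp (- (\<i> * complex_of_real (- y k))))"
        unfolding X_def using disj inj inj' by (simp add: prod.union_disjoint prod.reindex)
      also have "\<dots> = (\<Prod>k\<in>{1..N}. 1)"
        unfolding prod.distrib[symmetric] by (rule prod.cong) (auto simp: exp_minus)
      finally show ?thesis by simp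
    qed
    have Xzero: "f (of_real x) = 0" if "x \<in> X" for x
      using that fy fm by (auto simp: X_def)
    have f0: "f 0 = 0" if "\<delta> = -1"
      using fm[of 0] that by simp
    have too_many: ?thesis if Y: "finite Y" "distinct_mod_2pi Y" "deg < card Y" "\<And>x. x \<in> Y \<Longrightarrow> f (of_real x) = 0" for Y
    proof -
      obtain Y' where Y': "Y' \<subseteq> Y" "card Y' = Suc deg" "finite Y'"
        using obtain_subset_with_card_n[of "Suc deg" Y] Y(1,3) finite_subset by (metis Suc_leI)
      show ?thesis
        by (rule quasi_periodic_too_many_zeros[OF T e C0 f Y'(3) _ Y'(2)])
           (use Y Y' in \<open>auto simp: distinct_mod_2pi_def\<close>)
    qed
    have dist: "distinct_mod_2pi Y" if "Y \<subseteq> insert pi (insert 0 X)" for Y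
    proof (rule distinct_mod_2piI)
      fix u v assume "u \<in> Y" "v \<in> Y"
      then have "u \<in> insert pi (insert 0 X)" "v \<in> insert pi (insert 0 X)" using that by auto
      then have "- pi < u" "u \<le> pi" "- pi < v" "v \<le> pi"
        using Xr[of u] Xr[of v] pi_gt_zero by (auto simp: less_imp_le)
      then show "\<bar>u - v\<bar> < 2 * pi" by linarith
    qed
    have X0: "0 \<notin> X" "pi \<notin> insert 0 X" using Xr by auto
    consider "R \<in> {RB, RBv, RCv}" | "R = RD" | "R = RBC" | "R = RC"
      using False by (cases R) auto
    then show ?thesis
    proof cases
      case 1
      then have "\<delta> = -1" "deg \<le> 2 * N" by (auto simp: \<delta>_def)
      then show ?thesis
        using X0 Xcard Xfin Xzero f0 by (intro too_many[of "insert 0 X"] dist) auto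
    next
      case 2
      then have "deg < 2 * N" using N1 by auto
      then show ?thesis
        using X0 Xcard Xfin Xzero by (intro too_many[of X] dist) auto
    next
      case 3
      then have 3: "\<delta> = -1" "deg = Suc (2 * N)" "\<not> alternating R" by (auto simp: \<delta>_def alternating_def)
      show ?thesis
      proof (rule quasi_periodic_zeros_phase[OF T e C f, of "insert 0 X"])
        show "distinct_mod_2pi (insert 0 X)" by (rule dist) auto
        \<comment> \<open>The zero at 0 contributes \<open>- exp 0 = -1\<close>, while
          \<open>C\<close> itself is positive.\<close>
        have "C * (\<Prod>x\<in>insert 0 X. - exp (- (\<i> * of_real x))) = - of_real (exp (\<beta> * T))"
          using X0 Xfin Xprod 3 unfolding \<beta>T C_def by (simp flip: exp_of_real)
        then show "e \<noteq> exp (- (2 * pi * \<beta> * \<i>)) \<or>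
          C * (\<Prod>x\<in>insert 0 X. - exp (- (\<i> * of_real x))) \<noteq> of_real (exp (\<beta> * T))"
          by (simp add: complex_eq_iff)
      qed (use X0 Xfin Xcard Xzero f0 3 in auto)
    next
      case 4
      then have 4: "\<delta> = -1" "deg = Suc (Suc (2 * N))" "\<not> alternating R" "period_even"
        unfolding \<delta>_def alternating_def period_even_def by auto
      \<comment> \<open>Periodicity gives \<open>f pi = f (- pi)\<close> and oddness gives
        \<open>f (- pi) = - f pi\<close>.\<close>
      have "f (of_real (- pi) + of_real (2 * pi)) = e * f (of_real (- pi))"
        using f unfolding quasi_periodic_def by blast
      then have fpi: "f (of_real pi) = 0" using fm[of "of_real pi"] 4 by (simp add: e_def)
      show ?thesis
      proof (rule quasi_periodic_zeros_phase[OF T e C f, of "insert pi (insert 0 X)"])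
        show "distinct_mod_2pi (insert pi (insert 0 X))" by (rule dist) auto
        \<comment> \<open>Now 0 contributes \<open>-1\<close> and \<open>pi\<close> contributes
          \<open>- exp (- \<i> * pi) = 1\<close>.\<close>
        have "C * (\<Prod>x\<in>insert pi (insert 0 X). - exp (- (\<i> * of_real x))) = - of_real (exp (\<beta> * T))"
          using X0 Xfin Xprod 4 unfolding \<beta>T C_def by (simp add: exp_minus flip: exp_of_real)
        then show "e \<noteq> exp (- (2 * pi * \<beta> * \<i>)) \<or>
          C * (\<Prod>x\<in>insert pi (insert 0 X). - exp (- (\<i> * of_real x))) \<noteq> of_real (exp (\<beta> * T))"
          by (simp add: complex_eq_iff)
      qed (use X0 Xfin Xcard Xzero f0 fpi 4 in auto)
    qed
  qed
  then show ?thesis by (simp add: f_def)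
qed

definition Hdet :: "real \<Rightarrow> (nat \<Rightarrow> real) \<Rightarrow> complex" where
  "Hdet s y = det (mat N N (\<lambda>(j, k). Hfun R N (Suc j) s (of_real (y (Suc k)))))"

text \<open>A vanishing determinant yields a nontrivial combination of the rows, that is, of the
  functions, with zeros at all \<open>N\<close> points. It is identically zero by the count of
  zeros, and linear independence removes its coefficients.\<close>

lemma Hdet_nonzero:
  assumes s: "s > 0" and y: "interior_config y"
  shows "Hdet s y \<noteq> 0"
proof
  define A where "A = mat N N (\<lambda>(j, k). Hfun R N (Suc j) s (of_real (y (Suc k))))"
  have A: "A \<in> carrier_mat N N" by (simp add: A_def)
  assume "Hdet s y = 0"
  then have "det A\<^sup>T = 0" using det_transpose[OF A] by (simp add: Hdet_def A_def)
  then obtain v where v: "v \<in> carrier_vec N" "v \<noteq> 0\<^sub>v N" "A\<^sup>T *\<^sub>v v = 0\<^sub>v N"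
    using det_0_iff_vec_prod_zero_field[of "A\<^sup>T" N] A by auto
  define a where "a j = v $ (j - 1)" for j
  have "(\<Sum>j\<in>{1..N}. a j * Hfun R N j s (of_real (y k))) = 0" if k: "k \<in> {1..N}" for k
  proof -
    have "(\<Sum>j\<in>{1..N}. a j * Hfun R N j s (of_real (y k))) = (\<Sum>j\<in>{0..<N}. v $ j * Hfun R N (Suc j) s (of_real (y k)))"
      by (rule sum.reindex_bij_witness[of _ Suc "\<lambda>j. j - 1"]) (auto simp: a_def)
    also have "\<dots> = (A\<^sup>T *\<^sub>v v) $ (k - 1)"
      using k v(1) by (auto simp: A_def scalar_prod_def mult.commute intro!: sum.cong)
    also have "\<dots> = 0" using k unfolding v(3) by (intro index_zero_vec) auto
    finally show ?thesis .
  qed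
  then have "\<And>z. (\<Sum>j\<in>{1..N}. a j * Hfun R N j s z) = 0"
    using Hfun_sum_eq_0[OF s y] by blast
  then have "a l = 0" if "l \<in> {1..N}" for l
    using Hfun_linear_independent[OF s _ that] by blast
  then have "v $ i = 0" if "i < N" for i
    using that \<open>\<And>l. l \<in> {1..N} \<Longrightarrow> a l = 0\<close>[of "Suc i"] by (simp add: a_def)
  then have "v = 0\<^sub>v N" using v(1) by (intro eq_vecI) auto
  with v(2) show False by simp
qed

end

section \<open>Conjugation, scaling and continuity of determinants\<close>

lemma cnj_det: "cnj (det (mat n n (\<lambda>(i, k). f i k))) = det (mat n n (\<lambda>(i, k). cnj (f i k)))"
proof -
  have sg: "cnj (signof p) = signof p" for p :: "nat \<Rightarrow> nat" by (simp add: sign_def)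
  show ?thesis
    by (auto simp: det_def cnj_sum cnj_prod sg permutes_def intro!: sum.cong prod.cong)
qed

lemma det_scale_rows:
  fixes c :: "nat \<Rightarrow> 'a::comm_ring_1"
  shows "det (mat n n (\<lambda>(i, k). c i * f i k)) = (\<Prod>i<n. c i) * det (mat n n (\<lambda>(i, k). f i k))"
proof -
  have "det (mat n n (\<lambda>(i, k). c i * f i k)) = (\<Sum>p | p permutes {0..<n}. signof p * (\<Prod>i = 0..<n. c i * f i (p i)))"
    by (auto simp: det_def permutes_def intro!: sum.cong prod.cong)
  also have "\<dots> = (\<Sum>p | p permutes {0..<n}. (\<Prod>i<n. c i) * (signof p * (\<Prod>i = 0..<n. f i (p i))))"
    by (simp add: prod.distrib lessThan_atLeast0 mult_ac)
  also have "\<dots> = (\<Prod>i<n. c i) * det (mat n n (\<lambda>(i, k). f i k))"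
    by (auto simp: det_def permutes_def sum_distrib_left intro!: sum.cong prod.cong)
  finally show ?thesis .
qed

lemma continuous_on_det:
  fixes f :: "nat \<Rightarrow> nat \<Rightarrow> 'b::topological_space \<Rightarrow> complex"
  assumes "\<And>i j. i < n \<Longrightarrow> j < n \<Longrightarrow> continuous_on A (f i j)"
  shows "continuous_on A (\<lambda>u. det (mat n n (\<lambda>(i, j). f i j u)))"
proof -
  have eq: "(\<lambda>u. det (mat n n (\<lambda>(i, j). f i j u))) =
      (\<lambda>u. \<Sum>p | p permutes {0..<n}. signof p * (\<Prod>i = 0..<n. f i (p i) u))"
    by (auto simp: det_def permutes_def fun_eq_iff intro!: sum.cong prod.cong)
  show ?thesis
    unfolding eq using assms by (intro continuous_intros) (auto simp: permutes_in_image)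
qed

context root_system
begin

text \<open>Conjugation negates the modes, and negation carries the residue class of
  \<open>j\<close> to that of \<open>N + 1 - j\<close>.\<close>

lemma cnj_Hfun_RA:
  assumes "R = RA" "j \<in> {1..N}"
  shows "cnj (Hfun R N j s (of_real y)) = Hfun R N (Suc N - j) s (of_real y)"
proof -
  have fr: "freq N (real (Suc N - j) - 1 / 2) (- l) = - freq N (real j - 1 / 2) l" for l
    using assms by (simp add: freq_def of_nat_diff algebra_simps)
  have "gseries False N (real j - 1 / 2) s (- of_real y) = gseries False N (real (Suc N - j) - 1 / 2) s (of_real y)"
    unfolding gseries_def
    by (rule infsum_reindex_bij_witness[of _ uminus uminus]) (auto simp: gterm_def alt_def fr)
  then show ?thesis
    unfolding Hfun_def using assms cnj_gseries[of False N "real j - 1 / 2" s y] by (simp add: alternating_def)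
qed

text \<open>For the reflected types conjugation multiplies each row by the reflection sign; for
  \<open>RA\<close> it reverses the order of the rows. In both cases the constant involves neither
  the time nor the points.\<close>

lemma cnj_Hdet: "\<exists>\<kappa>::complex. \<forall>s y. cnj (Hdet s y) = \<kappa> * Hdet s y"
proof (cases "R = RA")
  case False
  let ?d = "complex_of_real (reflection_sign R)"
  have "cnj (Hdet s y) = ?d ^ N * Hdet s y" for s y
  proof -
    have "cnj (Hdet s y) = det (mat N N (\<lambda>(j, k). ?d * Hfun R N (Suc j) s (of_real (y (Suc k)))))"
      unfolding Hdet_def cnj_det cnj_Hfun[OF False] ..
    then show ?thesis
      unfolding Hdet_def using det_scale_rows[of N "\<lambda>_. ?d"] by simp
  qed
  then show ?thesis by blast
next
  case True
  define p where "p i = (if i < N then N - 1 - i else i)" for i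
  have p: "p permutes {0..<N}"
    by (rule bij_imp_permutes, rule bij_betw_byWitness[of _ p]) (auto simp: p_def)
  have "cnj (Hdet s y) = signof p * Hdet s y" for s y
  proof -
    define A where "A = mat N N (\<lambda>(j, k). Hfun R N (Suc j) s (of_real (y (Suc k))))"
    have "cnj (Hdet s y) = det (mat N N (\<lambda>(i, j). A $$ (p i, j)))"
      unfolding Hdet_def cnj_det
    proof (rule arg_cong[of _ _ det], rule eq_matI; clarsimp)
      fix i k assume ik: "i < N" "k < N"
      show "cnj (Hfun R N (Suc i) s (of_real (y (Suc k)))) = A $$ (p i, k)"
        using ik cnj_Hfun_RA[OF True, of "Suc i" s "y (Suc k)"] by (simp add: A_def p_def Suc_diff_Suc)
    qed
    also have "\<dots> = signof p * det A"
      by (rule det_permute_rows[OF _ p]) (simp add: A_def)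
    finally show ?thesis by (simp add: Hdet_def A_def)
  qed
  then show ?thesis by blast
qed

lemma continuous_on_Hdet_time:
  assumes "s0 > 0"
  shows "continuous_on {s0..} (\<lambda>s. Hdet s y)"
  unfolding Hdet_def Hfun_def using assms deg_pos
  by (intro continuous_on_det continuous_intros continuous_on_gseries_time)

text \<open>For fixed \<open>y\<close> the product is real and never vanishes as \<open>s'\<close> varies, and it is positive at \<open>s' = s\<close>.\<close>
lemma cnj_Hdet_mult_Hdet_pos:
  assumes s: "s > 0" "s' > 0" and y: "interior_config y"
  obtains c where "c > 0" "cnj (Hdet s' y) * Hdet s y = of_real c"
proof -
  define F where "F u = cnj (Hdet u y) * Hdet s y" for u
  obtain \<kappa> where \<kappa>: "\<And>s y. cnj (Hdet s y) = \<kappa> * Hdet s y"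
    using cnj_Hdet by blast
  have real: "Im (F u) = 0" for u
  proof -
    have "cnj (F u) = Hdet u y * cnj (Hdet s y)" by (simp add: F_def)
    also have "\<dots> = F u" unfolding F_def \<kappa> by (simp only: mult_ac)
    finally show ?thesis by (metis Reals_cnj_iff complex_is_Real_iff)
  qed
  have nz: "Re (F u) \<noteq> 0" if "u > 0" for u
    using Hdet_nonzero[OF that y] Hdet_nonzero[OF s(1) y] real[of u] unfolding F_def
    by (metis complex_cnj_zero_iff complex_eq_iff mult_eq_0_iff zero_complex.sel)
  \<comment> \<open>Continuity in time is available on half-lines bounded away from 0; this one
    contains both times.\<close>
  define m where "m = min s s'"
  have m: "m > 0" using s by (simp add: m_def)
  have cont: "continuous_on {m..} (\<lambda>u. Re (F u))"
    unfolding F_def using continuous_on_Hdet_time[OF m] by (intro continuous_intros)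
  have "F s = of_real ((norm (Hdet s y))\<^sup>2)"
    unfolding F_def using complex_norm_square[of "Hdet s y"] by (simp add: mult.commute)
  then have pos: "Re (F s) > 0" using Hdet_nonzero[OF s(1) y] by simp
  have "Re (F s') > 0"
  proof (rule ccontr)
    assume "\<not> Re (F s') > 0"
    then have neg: "Re (F s') < 0" using nz[OF s(2)] by simp
    have "connected ((\<lambda>u. Re (F u)) ` {m..})"
      using cont by (intro connected_continuous_image) auto
    moreover have "Re (F s) \<in> (\<lambda>u. Re (F u)) ` {m..}" "Re (F s') \<in> (\<lambda>u. Re (F u)) ` {m..}"
      by (auto simp: m_def)
    ultimately have "0 \<in> (\<lambda>u. Re (F u)) ` {m..}"
      using neg pos by (meson connectedD_interval less_imp_le)
    then obtain u where "u \<ge> m" "Re (F u) = 0" by auto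
    with nz[of u] m show False by simp
  qed
  moreover have "F s' = of_real (Re (F s'))" using real[of s'] by (simp add: complex_eq_iff)
  ultimately show thesis using that unfolding F_def by metis
qed

text \<open>The powers of \<open>prefactor\<close> cancel against their conjugates, and the
  remaining row factors \<open>exp (s * J\<^sup>2)\<close> are positive, so the sign of
  \<open>qfun\<close> is that of the product of the two \<open>Hdet\<close>.\<close>

lemma qfun_eq_Hdet:
  assumes r: "r > 0"
  obtains c where "c > 0" "\<And>x. qfun R N r ts t x = of_real c *
     (cnj (Hdet ((ts - t) / (2 * r\<^sup>2)) (\<lambda>k. x k / r)) * Hdet (t / (2 * r\<^sup>2)) (\<lambda>k. x k / r))"
proof -
  define e where "e s = (\<Prod>j<N. exp (s * (Jfun R (Suc j))\<^sup>2))" for s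
  have M: "det (mat N N (\<lambda>(l, m). Mfun R N r (Suc l) (x (Suc m)) t)) = prefactor ^ N * of_real (e s) * Hdet s (\<lambda>k. x k / r)"
    if s: "s = t / (2 * r\<^sup>2)" for s t x
  proof -
    have "det (mat N N (\<lambda>(l, m). Mfun R N r (Suc l) (x (Suc m)) t)) =
        (\<Prod>l<N. prefactor * exp (of_real (s * (Jfun R (Suc l))\<^sup>2))) * Hdet s (\<lambda>k. x k / r)"
      unfolding Mfun_eq[OF r s] Hdet_def by (rule det_scale_rows)
    also have "(\<Prod>l<N. prefactor * exp (of_real (s * (Jfun R (Suc l))\<^sup>2))) = prefactor ^ N * of_real (e s)"
      unfolding prod.distrib e_def of_real_prod exp_of_real by simp
    finally show ?thesis .
  qed
  have pf: "cnj (prefactor ^ N) * prefactor ^ N = 1"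
    using prefactor_mult_cnj by (simp add: mult.commute flip: power_mult_distrib)
  show thesis
  proof (rule that)
    show "e ((ts - t) / (2 * r\<^sup>2)) * e (t / (2 * r\<^sup>2)) > 0"
      by (auto simp: e_def intro!: mult_pos_pos prod_pos)
    fix x
    have "qfun R N r ts t x = cnj (det (mat N N (\<lambda>(l, m). Mfun R N r (Suc l) (x (Suc m)) (ts - t)))) *
        det (mat N N (\<lambda>(l, m). Mfun R N r (Suc l) (x (Suc m)) t))"
      unfolding qfun_def cnj_det ..
    also have "\<dots> = (cnj (prefactor ^ N) * prefactor ^ N) * (of_real (e ((ts - t) / (2 * r\<^sup>2)) * e (t / (2 * r\<^sup>2))) *
      (cnj (Hdet ((ts - t) / (2 * r\<^sup>2)) (\<lambda>k. x k / r)) * Hdet (t / (2 * r\<^sup>2)) (\<lambda>k. x k / r)))"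
      unfolding M[OF refl] by simp
    finally show "qfun R N r ts t x = of_real (e ((ts - t) / (2 * r\<^sup>2)) * e (t / (2 * r\<^sup>2))) *
      (cnj (Hdet ((ts - t) / (2 * r\<^sup>2)) (\<lambda>k. x k / r)) * Hdet (t / (2 * r\<^sup>2)) (\<lambda>k. x k / r))"
      unfolding pf by simp
  qed
qed

end

text \<open>The configuration space over an arbitrary set \<open>L\<close>. Monotonicity in place of
  consecutive inequalities suits the sorting by permutations.\<close>

definition weyl_chamber :: "nat \<Rightarrow> real set \<Rightarrow> (nat \<Rightarrow> real) set" where
  "weyl_chamber N L = {x \<in> {1..N} \<rightarrow>\<^sub>E L. strict_mono_on {1..N} x}"

lemma strict_mono_on_atLeastAtMostI:
  fixes x :: "nat \<Rightarrow> real"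
  assumes "\<And>k. a \<le> k \<Longrightarrow> k < b \<Longrightarrow> x k < x (Suc k)"
  shows "strict_mono_on {a..b} x"
proof (rule strict_mono_onI)
  fix i j assume ij: "i \<in> {a..b}" "j \<in> {a..b}" "i < j"
  from ij(3) have "Suc i \<le> j" by simp
  then have "j \<le> b \<longrightarrow> x i < x j"
  proof (induction j rule: dec_induct)
    case base
    then show ?case using assms[of i] ij by auto
  next
    case (step k)
    then show ?case using assms[of k] ij by force
  qed
  then show "x i < x j" using ij by simp
qed

lemma Sdom_eq:
  assumes "N \<ge> 1"
  shows "Sdom R N r = weyl_chamber N (Ldom R r)"
proof (intro equalityI subsetI)
  fix x assume x: "x \<in> Sdom R N r"
  have sm: "strict_mono_on {1..N} x"
    using x by (intro strict_mono_on_atLeastAtMostI) (auto simp: Sdom_def)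
  have xE: "x \<in> {1..N} \<rightarrow>\<^sub>E UNIV" "0 \<le> x 1" "if R = RA then x N < 2 * pi * r else x N \<le> pi * r"
    using x by (auto simp: Sdom_def)
  have "x k \<in> Ldom R r" if k: "k \<in> {1..N}" for k
  proof -
    have "k = 1 \<or> x 1 < x k" "k = N \<or> x k < x N"
      using strict_mono_onD[OF sm, of 1 k] strict_mono_onD[OF sm, of k N] k by force+
    then show ?thesis using xE(2,3) by (cases "R = RA") (auto simp: Ldom_def)
  qed
  then show "x \<in> weyl_chamber N (Ldom R r)"
    using xE(1) sm by (auto simp: weyl_chamber_def PiE_iff)
next
  fix x assume x: "x \<in> weyl_chamber N (Ldom R r)"
  have sm: "strict_mono_on {1..N} x" and xE: "x \<in> {1..N} \<rightarrow>\<^sub>E Ldom R r"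
    using x by (auto simp: weyl_chamber_def)
  have "x k < x (Suc k)" if "1 \<le> k" "k < N" for k
    by (rule strict_mono_onD[OF sm]) (use that in auto)
  moreover have "x 1 \<in> Ldom R r" "x N \<in> Ldom R r" using PiE_mem[OF xE] assms by auto
  moreover have "x \<in> {1..N} \<rightarrow>\<^sub>E UNIV" using xE by (auto simp: PiE_iff)
  ultimately show "x \<in> Sdom R N r"
    by (cases "R = RA") (simp_all add: Sdom_def Ldom_def)
qed

section \<open>Nonnegativity up to the walls\<close>

context root_system
begin

text \<open>For \<open>RA\<close> every ordered configuration is interior. For the other types
  points may lie on a wall; such a configuration is a limit of interior ones, and nonnegativity is a
  closed condition.\<close>

lemma cnj_Hdet_mult_Hdet_nonneg:
  assumes s: "s > 0" "s' > 0" and y: "strict_mono_on {1..N} y"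
    and yr: "\<And>k. k \<in> {1..N} \<Longrightarrow> if R = RA then 0 \<le> y k \<and> y k < 2 * pi else 0 \<le> y k \<and> y k \<le> pi"
  shows "cnj (Hdet s' y) * Hdet s y \<in> \<real>\<^sub>\<ge>\<^sub>0"
proof (cases "R = RA")
  case True
  have "interior_config y"
    unfolding interior_config_def using yr True strict_mono_on_imp_inj_on[OF y] by auto
  from cnj_Hdet_mult_Hdet_pos[OF s this] obtain c where "c > 0" "cnj (Hdet s' y) * Hdet s y = of_real c" .
  then show ?thesis by (simp add: nonneg_Reals_of_real_iff)
next
  case False
  \<comment> \<open>Straight path towards the equally spaced interior points
    \<open>pi * k / (N + 1)\<close>; convex combinations keep the order, and for
    \<open>0 < u < 1\<close> they avoid both walls.\<close>
  define w where "w u k = y k + u * (pi * real k / (real N + 1) - y k)" for u k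
  define F where "F u = cnj (Hdet s' (w u)) * Hdet s (w u)" for u
  have F: "F u \<in> \<real>\<^sub>\<ge>\<^sub>0" if u: "0 < u" "u < 1" for u
  proof -
    have weq: "w u k = (1 - u) * y k + u * (pi * real k / (real N + 1))" for k
      by (simp add: w_def algebra_simps)
    have "interior_config (w u)"
      unfolding interior_config_def
    proof (intro conjI ballI)
      show "inj_on (w u) {1..N}"
      proof (rule strict_mono_on_imp_inj_on, rule strict_mono_onI)
        fix i k assume ik: "i \<in> {1..N}" "k \<in> {1..N}" "i < k"
        have "y i < y k" using strict_mono_onD[OF y ik] .
        moreover have "pi * real i / (real N + 1) < pi * real k / (real N + 1)"
          using ik by (intro divide_strict_right_mono) auto
        ultimately show "w u i < w u k"
          unfolding weq using u by (intro add_strict_mono mult_strict_left_mono) auto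
      qed
      fix k assume k: "k \<in> {1..N}"
      have yk: "0 \<le> y k" "y k \<le> pi" using yr[OF k] False by auto
      have "pi * real k < pi * (real N + 1)" using k by (intro mult_strict_left_mono) auto
      then have ck: "0 < pi * real k / (real N + 1)" "pi * real k / (real N + 1) < pi"
        using k by (auto simp: pos_divide_less_eq)
      have "0 < w u k"
        unfolding weq using u yk ck by (intro add_nonneg_pos mult_nonneg_nonneg mult_pos_pos) auto
      moreover have "(1 - u) * y k + u * (pi * real k / (real N + 1)) < (1 - u) * pi + u * pi"
        using u yk ck by (intro add_le_less_mono mult_left_mono mult_strict_left_mono) auto
      then have "w u k < pi" unfolding weq by (simp add: algebra_simps)
      ultimately show "if R = RA then 0 \<le> w u k \<and> w u k < 2 * pi else 0 < w u k \<and> w u k < pi"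
        using False by simp
    qed
    from cnj_Hdet_mult_Hdet_pos[OF s this] obtain c where "c > 0" "F u = of_real c"
      unfolding F_def .
    then show ?thesis by (simp add: nonneg_Reals_of_real_iff)
  qed
  have "continuous_on UNIV F"
    unfolding F_def Hdet_def w_def using s
    by (intro continuous_intros continuous_on_det continuous_on_Hfun)
  then have "isCont F 0" by (simp add: continuous_on_eq_continuous_at)
  \<comment> \<open>The two successors start the sequence at 1/2, inside the open interval
    \<open>0 < u < 1\<close>.\<close>
  moreover have "(\<lambda>n. inverse (real (Suc (Suc n)))) \<longlonglongrightarrow> 0"
    by (rule LIMSEQ_Suc[OF LIMSEQ_inverse_real_of_nat])
  ultimately have lim: "(\<lambda>n. F (inverse (real (Suc (Suc n))))) \<longlonglongrightarrow> F 0"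
    by (rule isCont_tendsto_compose)
  have "F 0 \<in> \<real>\<^sub>\<ge>\<^sub>0"
  proof (rule closed_sequentially[OF _ _ lim])
    show "F (inverse (real (Suc (Suc n)))) \<in> \<real>\<^sub>\<ge>\<^sub>0" for n
      by (rule F) (auto simp: inverse_less_1_iff)
  qed (rule closed_nonneg_Reals_complex)
  moreover have "w 0 = y" by (simp add: w_def fun_eq_iff)
  ultimately show ?thesis by (simp add: F_def)
qed

lemma qfun_nonneg:
  assumes r: "r > 0" and t: "0 < t" "t < ts" and x: "x \<in> Sdom R N r"
  shows "qfun R N r ts t x \<in> \<real>\<^sub>\<ge>\<^sub>0"
proof -
  obtain c where c: "c > 0" "\<And>x. qfun R N r ts t x = of_real c *
     (cnj (Hdet ((ts - t) / (2 * r\<^sup>2)) (\<lambda>k. x k / r)) * Hdet (t / (2 * r\<^sup>2)) (\<lambda>k. x k / r))"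
    using qfun_eq_Hdet[OF r, where ts = ts and t = t] by blast
  have x': "x \<in> {1..N} \<rightarrow>\<^sub>E Ldom R r" "strict_mono_on {1..N} x"
    using x unfolding Sdom_eq[OF N1] by (auto simp: weyl_chamber_def)
  have "cnj (Hdet ((ts - t) / (2 * r\<^sup>2)) (\<lambda>k. x k / r)) * Hdet (t / (2 * r\<^sup>2)) (\<lambda>k. x k / r) \<in> \<real>\<^sub>\<ge>\<^sub>0"
  proof (rule cnj_Hdet_mult_Hdet_nonneg)
    show "strict_mono_on {1..N} (\<lambda>k. x k / r)"
      using x'(2) r by (auto simp: strict_mono_on_def divide_strict_right_mono)
    fix k assume "k \<in> {1..N}"
    then have "x k \<in> Ldom R r" using x'(1) by auto
    then show "if R = RA then 0 \<le> x k / r \<and> x k / r < 2 * pi else 0 \<le> x k / r \<and> x k / r \<le> pi"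
      using r by (auto simp: Ldom_def field_simps split: if_splits)
  qed (use r t in auto)
  then show ?thesis unfolding c(2) using c(1) nonneg_Reals_mult_I[of "complex_of_real c"] by simp
qed

end

section \<open>Biorthogonal ensembles\<close>

interpretation lborel_product: product_sigma_finite "\<lambda>_::nat. lborel :: real measure"
  by standard

lemma measurable_reindex_PiM:
  assumes "\<And>k. k \<in> J \<Longrightarrow> \<sigma> k \<in> I"
  shows "(\<lambda>x. \<lambda>k\<in>J. x (\<sigma> k)) \<in> measurable (PiM I (\<lambda>_. lborel :: real measure)) (PiM J (\<lambda>_. lborel))"
  using assms by (intro measurable_restrict) (auto intro: measurable_component_singleton)

text \<open>The preimage of a box is the box with permuted sides, which has the same volume; boxes
  determine the product measure.\<close>

lemma distr_PiM_permute:
  assumes \<sigma>: "\<sigma> permutes I" and I: "finite I"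
  shows "distr (PiM I (\<lambda>_::nat. lborel :: real measure)) (PiM I (\<lambda>_. lborel)) (\<lambda>x. \<lambda>k\<in>I. x (\<sigma> k)) = PiM I (\<lambda>_. lborel)"
proof (rule lborel_product.PiM_eqI)
  let ?T = "\<lambda>x. \<lambda>k\<in>I. x (\<sigma> k)"
  let ?M = "PiM I (\<lambda>_::nat. lborel :: real measure)"
  fix A :: "nat \<Rightarrow> real set" assume A: "\<And>i. i \<in> I \<Longrightarrow> A i \<in> sets lborel"
  have T: "?T \<in> measurable ?M ?M"
    using \<sigma> by (intro measurable_reindex_PiM) (auto simp: permutes_in_image)
  have inv: "inv_into UNIV \<sigma> permutes I" using \<sigma> by (rule permutes_inv)
  have "?T -` (PiE I A) \<inter> space ?M = PiE I (\<lambda>i. A (inv_into UNIV \<sigma> i))"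
  proof (intro equalityI subsetI)
    fix x assume x: "x \<in> ?T -` (PiE I A) \<inter> space ?M"
    have "x i \<in> A (inv_into UNIV \<sigma> i)" if i: "i \<in> I" for i
    proof -
      have "inv_into UNIV \<sigma> i \<in> I" using inv i by (simp add: permutes_in_image)
      then have "?T x (inv_into UNIV \<sigma> i) \<in> A (inv_into UNIV \<sigma> i)" using x by auto
      then show ?thesis using \<open>inv_into UNIV \<sigma> i \<in> I\<close> permutes_inverses(1)[OF \<sigma>] by simp
    qed
    then show "x \<in> PiE I (\<lambda>i. A (inv_into UNIV \<sigma> i))" using x by (auto simp: space_PiM PiE_iff)
  next
    fix x assume x: "x \<in> PiE I (\<lambda>i. A (inv_into UNIV \<sigma> i))"
    have "x (\<sigma> i) \<in> A i" if i: "i \<in> I" for i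
    proof -
      have "\<sigma> i \<in> I" using \<sigma> i by (simp add: permutes_in_image)
      then have "x (\<sigma> i) \<in> A (inv_into UNIV \<sigma> (\<sigma> i))" using x by auto
      then show ?thesis using permutes_inverses(2)[OF \<sigma>] by simp
    qed
    then show "x \<in> ?T -` (PiE I A) \<inter> space ?M" using x by (auto simp: space_PiM PiE_iff)
  qed
  then have "emeasure (distr ?M ?M ?T) (PiE I A) = emeasure ?M (PiE I (\<lambda>i. A (inv_into UNIV \<sigma> i)))"
    using A I by (subst emeasure_distr[OF T]) (auto intro: sets_PiM_I_finite)
  also have "\<dots> = (\<Prod>i\<in>I. emeasure lborel (A (inv_into UNIV \<sigma> i)))"
    using A inv I by (intro lborel_product.emeasure_PiM) (auto simp: permutes_in_image)
  also have "\<dots> = (\<Prod>i\<in>I. emeasure lborel (A i))"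
    using prod.permute[OF inv, of "\<lambda>i. emeasure lborel (A i)"] by (simp add: o_def)
  finally show "emeasure (distr ?M ?M ?T) (PiE I A) = (\<Prod>i\<in>I. emeasure lborel (A i))" .
qed (use I in auto)

lemma integral_PiM_permute:
  fixes g :: "(nat \<Rightarrow> real) \<Rightarrow> complex"
  assumes \<sigma>: "\<sigma> permutes I" and I: "finite I" and g: "g \<in> borel_measurable (PiM I (\<lambda>_. lborel))"
  shows "(\<integral>x. g (\<lambda>k\<in>I. x (\<sigma> k)) \<partial>PiM I (\<lambda>_. lborel)) = (\<integral>x. g x \<partial>PiM I (\<lambda>_. lborel))"
proof -
  have "(\<lambda>x. \<lambda>k\<in>I. x (\<sigma> k)) \<in> measurable (PiM I (\<lambda>_. lborel :: real measure)) (PiM I (\<lambda>_. lborel))"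
    using \<sigma> by (intro measurable_reindex_PiM) (auto simp: permutes_in_image)
  from integral_distr[OF this g] show ?thesis
    unfolding distr_PiM_permute[OF \<sigma> I] by simp
qed

text \<open>The sign of the permutation enters once for the rows and once for the columns.\<close>

lemma det_permute_both:
  assumes p: "p permutes {0..<n}"
  shows "det (mat n n (\<lambda>(i, j). f (p i) (p j))) = (det (mat n n (\<lambda>(i, j). f i j)) :: 'a::comm_ring_1)"
proof -
  define A where "A = mat n n (\<lambda>(i, j). f i j)"
  define B where "B = mat n n (\<lambda>(i, j). A\<^sup>T $$ (p i, j))"
  have A: "A \<in> carrier_mat n n" and B: "B \<in> carrier_mat n n" by (auto simp: A_def B_def)
  have pi: "p i < n" if "i < n" for i using permutes_in_image[OF p, of i] that by simp
  have "mat n n (\<lambda>(i, j). f (p i) (p j)) = mat n n (\<lambda>(i, j). B\<^sup>T $$ (p i, j))"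
    by (rule eq_matI) (auto simp: B_def A_def pi)
  then have "det (mat n n (\<lambda>(i, j). f (p i) (p j))) = signof p * det B\<^sup>T"
    using det_permute_rows[OF _ p, of "B\<^sup>T"] B by simp
  also have "det B\<^sup>T = det B" using B by (rule det_transpose)
  also have "det B = signof p * det A\<^sup>T"
    unfolding B_def using A by (intro det_permute_rows[OF _ p]) simp
  also have "det A\<^sup>T = det A" using A by (rule det_transpose)
  also have "signof p * (signof p * det A) = det A"
    by (simp add: sign_def)
  finally show ?thesis unfolding A_def .
qed

lemma extend_to_permutation:
  assumes j: "inj_on j A" "j ` A \<subseteq> B" and A: "A \<subseteq> B" and B: "finite B"
  obtains \<sigma> where "\<sigma> permutes B" "\<And>k. k \<in> A \<Longrightarrow> \<sigma> k = j k"
proof -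
  have "card (B - A) = card (B - j ` A)"
    using assms by (simp add: card_Diff_subset finite_subset card_image)
  then obtain h where h: "bij_betw h (B - A) (B - j ` A)"
    using B by (meson finite_Diff finite_same_card_bij)
  define \<sigma> where "\<sigma> k = (if k \<in> A then j k else if k \<in> B then h k else k)" for k
  have "bij_betw \<sigma> (A \<union> (B - A)) (j ` A \<union> (B - j ` A))"
  proof (rule bij_betw_combine)
    show "bij_betw \<sigma> A (j ` A)"
      using j(1) by (auto simp: bij_betw_def \<sigma>_def inj_on_def)
    show "bij_betw \<sigma> (B - A) (B - j ` A)"
      using h by (subst bij_betw_cong[of _ _ h]) (auto simp: \<sigma>_def)
  qed auto
  moreover have "A \<union> (B - A) = B" "j ` A \<union> (B - j ` A) = B" using A j(2) by auto
  ultimately have "\<sigma> permutes B"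
    using A by (intro bij_imp_permutes) (auto simp: \<sigma>_def)
  then show thesis by (rule that) (simp add: \<sigma>_def)
qed

text \<open>The sorting permutation is the inverse of the rank function, which gives both its existence and its uniqueness.\<close>
lemma sum_indicator_sorting_permutation:
  assumes x: "x \<in> {1..N} \<rightarrow>\<^sub>E L" and inj: "inj_on x {1..N}"
  shows "(\<Sum>\<sigma> | \<sigma> permutes {1..N}. indicator (weyl_chamber N L) (\<lambda>k\<in>{1..N}. x (\<sigma> k))) = (1::real)"
proof -
  define \<rho> where "\<rho> k = (if k \<in> {1..N} then card {i \<in> {1..N}. x i \<le> x k} else k)" for k
  have mono: "\<rho> i < \<rho> k \<longleftrightarrow> x i < x k" if "i \<in> {1..N}" "k \<in> {1..N}" for i k
  proof -
    have 1: "\<rho> i < \<rho> k" if "x i < x k" "i \<in> {1..N}" "k \<in> {1..N}" for i k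
    proof -
      have "{l \<in> {1..N}. x l \<le> x i} \<subset> {l \<in> {1..N}. x l \<le> x k}"
      proof (rule psubsetI)
        show "{l \<in> {1..N}. x l \<le> x i} \<noteq> {l \<in> {1..N}. x l \<le> x k}"
          using that by (metis (mono_tags, lifting) mem_Collect_eq not_le order_refl)
      qed (use that in auto)
      then show ?thesis using that by (simp add: \<rho>_def psubset_card_mono)
    qed
    have "\<rho> k \<le> \<rho> i" if "x k \<le> x i"
      unfolding \<rho>_def using that \<open>i \<in> {1..N}\<close> \<open>k \<in> {1..N}\<close> by (auto intro!: card_mono)
    with 1[of i k] that show ?thesis by (meson not_le)
  qed
  have \<rho>1: "\<rho> k \<in> {1..N}" if "k \<in> {1..N}" for k
  proof -
    have "card {i \<in> {1..N}. x i \<le> x k} \<le> card {1..N}" by (rule card_mono) auto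
    moreover have "card {i \<in> {1..N}. x i \<le> x k} > 0" using that by (subst card_gt_0_iff) auto
    ultimately show ?thesis using that by (simp add: \<rho>_def)
  qed
  have \<rho>inj: "inj_on \<rho> {1..N}"
  proof (rule inj_onI)
    fix i k assume ik: "i \<in> {1..N}" "k \<in> {1..N}" "\<rho> i = \<rho> k"
    then have "x i = x k" using mono[OF ik(1,2)] mono[OF ik(2,1)] by auto
    then show "i = k" using inj ik by (auto dest: inj_onD)
  qed
  have \<rho>perm: "\<rho> permutes {1..N}"
  proof (rule bij_imp_permutes)
    have "\<rho> ` {1..N} = {1..N}"
      by (rule endo_inj_surj) (use \<rho>1 \<rho>inj in auto)
    then show "bij_betw \<rho> {1..N} {1..N}" using \<rho>inj by (simp add: bij_betw_def)
  qed (auto simp: \<rho>_def)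
  have iff: "(\<lambda>k\<in>{1..N}. x (\<sigma> k)) \<in> weyl_chamber N L \<longleftrightarrow> \<sigma> = inv_into UNIV \<rho>" if \<sigma>: "\<sigma> permutes {1..N}" for \<sigma>
  proof -
    have \<sigma>N: "\<sigma> k \<in> {1..N} \<longleftrightarrow> k \<in> {1..N}" for k using permutes_in_image[OF \<sigma>] by blast
    have "(\<lambda>k\<in>{1..N}. x (\<sigma> k)) \<in> weyl_chamber N L \<longleftrightarrow> strict_mono_on {1..N} (\<lambda>k. x (\<sigma> k))"
      using x \<sigma>N by (auto simp: weyl_chamber_def strict_mono_on_def PiE_iff)
    also have "\<dots> \<longleftrightarrow> strict_mono_on {1..N} (\<lambda>k. \<rho> (\<sigma> k))"
      unfolding strict_mono_on_def using mono \<sigma>N by metis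
    \<comment> \<open>A strictly increasing permutation of \<open>{1..N}\<close> is the identity: by
      strong induction a smaller value at \<open>k\<close> is already taken, and a larger one would
      leave the value \<open>k\<close> to a later index, against monotonicity.\<close>
    also have "\<dots> \<longleftrightarrow> (\<forall>k\<in>{1..N}. \<rho> (\<sigma> k) = k)"
    proof
      assume sm: "strict_mono_on {1..N} (\<lambda>k. \<rho> (\<sigma> k))"
      have bij: "(\<rho> \<circ> \<sigma>) permutes {1..N}" using \<sigma> \<rho>perm by (rule permutes_compose)
      have "\<rho> (\<sigma> k) = k" if "k \<in> {1..N}" for k
        using that
      proof (induction k rule: less_induct)
        case (less k)
        have "k \<le> \<rho> (\<sigma> k)"
        proof (rule ccontr)
          assume "\<not> k \<le> \<rho> (\<sigma> k)"
          then have lt: "\<rho> (\<sigma> k) < k" by simp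
          have "\<rho> (\<sigma> k) \<in> {1..N}" using less.prems \<rho>1 \<sigma>N by blast
          then have "\<rho> (\<sigma> (\<rho> (\<sigma> k))) = \<rho> (\<sigma> k)" using less.IH[OF lt] by blast
          then have "\<rho> (\<sigma> k) = k" using permutes_inj[OF bij] by (auto simp: inj_def)
          with lt show False by simp
        qed
        moreover have "\<not> k < \<rho> (\<sigma> k)"
        proof
          assume gt: "k < \<rho> (\<sigma> k)"
          obtain l where l: "\<rho> (\<sigma> l) = k" "l \<in> {1..N}"
            using permutes_image[OF bij] less.prems by (metis (no_types, lifting) comp_apply imageE)
          have "k < l \<or> l < k \<or> l = k" by auto
          then show False
            using gt l less.IH[of l] strict_mono_onD[OF sm less.prems l(2)] by auto
        qed
        ultimately show ?case by simp
      qed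
      then show "\<forall>k\<in>{1..N}. \<rho> (\<sigma> k) = k" by blast
    next
      assume "\<forall>k\<in>{1..N}. \<rho> (\<sigma> k) = k"
      then show "strict_mono_on {1..N} (\<lambda>k. \<rho> (\<sigma> k))" by (auto simp: strict_mono_on_def)
    qed
    also have "\<dots> \<longleftrightarrow> \<sigma> = inv_into UNIV \<rho>"
    proof
      assume *: "\<forall>k\<in>{1..N}. \<rho> (\<sigma> k) = k"
      show "\<sigma> = inv_into UNIV \<rho>"
      proof
        fix k
        have "\<rho> (\<sigma> k) = k" using * \<sigma> \<rho>perm by (cases "k \<in> {1..N}") (auto simp: permutes_not_in)
        then show "\<sigma> k = inv_into UNIV \<rho> k" using permutes_inv_eq[OF \<rho>perm] by metis
      qed
    qed (use permutes_inverses(1)[OF \<rho>perm] in auto)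
    finally show ?thesis .
  qed
  have "(\<Sum>\<sigma> | \<sigma> permutes {1..N}. indicator (weyl_chamber N L) (\<lambda>k\<in>{1..N}. x (\<sigma> k))) =
     (\<Sum>\<sigma> | \<sigma> permutes {1..N}. if \<sigma> = inv_into UNIV \<rho> then 1 else (0::real))"
    by (rule sum.cong) (simp_all add: indicator_def iff del: One_nat_def)
  also have "\<dots> = 1"
    using permutes_inv[OF \<rho>perm] by (simp add: finite_permutations)
  finally show ?thesis .
qed

lemma set_integral_weighted_sum:
  fixes u :: "'i \<Rightarrow> real \<Rightarrow> complex"
  assumes u: "\<And>a. a \<in> S \<Longrightarrow> set_integrable lborel L (u a)"
  shows "(LINT z:L|lborel. (\<Sum>a\<in>S. c a * u a z)) = (\<Sum>a\<in>S. c a * (LINT z:L|lborel. u a z))"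
    and "set_integrable lborel L (\<lambda>z. \<Sum>a\<in>S. c a * u a z)"
proof -
  have eq: "indicat_real L z *\<^sub>R (\<Sum>a\<in>S. c a * u a z) = (\<Sum>a\<in>S. c a * (indicator L z *\<^sub>R u a z))" for z
    unfolding scaleR_sum_right by (rule sum.cong) (simp_all only: mult_scaleR_right)
  have int: "integrable lborel (\<lambda>z. c a * (indicator L z *\<^sub>R u a z))" if "a \<in> S" for a
    using u[OF that] unfolding set_integrable_def by (rule integrable_mult_right)
  show "set_integrable lborel L (\<lambda>z. \<Sum>a\<in>S. c a * u a z)"
    unfolding set_integrable_def eq using int by (rule Bochner_Integration.integrable_sum)
  have "(LINT z:L|lborel. (\<Sum>a\<in>S. c a * u a z)) = (\<Sum>a\<in>S. (LINT z|lborel. c a * (indicator L z *\<^sub>R u a z)))"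
    unfolding set_lebesgue_integral_def eq using int by (rule Bochner_Integration.integral_sum)
  also have "\<dots> = (\<Sum>a\<in>S. c a * (LINT z:L|lborel. u a z))"
    unfolding set_lebesgue_integral_def integral_mult_right_zero ..
  finally show "(LINT z:L|lborel. (\<Sum>a\<in>S. c a * u a z)) = (\<Sum>a\<in>S. c a * (LINT z:L|lborel. u a z))" .
qed

text \<open>Conjugation is absorbed into \<open>\<psi>\<close>, so the pairing is bilinear.
  Boundedness on a set of finite measure supplies all integrability, including that needed for
  Fubini.\<close>

locale biorthogonal_ensemble =
  fixes N :: nat and L :: "real set" and \<phi> \<psi> :: "nat \<Rightarrow> real \<Rightarrow> complex"
  assumes L_meas [measurable]: "L \<in> sets borel" and L_fin: "emeasure lborel L < \<infinity>"
    and meas [measurable]: "\<And>i. \<phi> i \<in> borel_measurable borel" "\<And>i. \<psi> i \<in> borel_measurable borel"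
    and bounded: "\<And>i. \<exists>B. \<forall>x\<in>L. norm (\<phi> i x) \<le> B" "\<And>i. \<exists>B. \<forall>x\<in>L. norm (\<psi> i x) \<le> B"
    and biorth: "\<And>i j. i \<in> {1..N} \<Longrightarrow> j \<in> {1..N} \<Longrightarrow> (LINT x:L|lborel. \<phi> i x * \<psi> j x) = (if i = j then 1 else 0)"
begin

definition K :: "real \<Rightarrow> real \<Rightarrow> complex" where
  "K x y = (\<Sum>i\<in>{1..N}. \<phi> i x * \<psi> i y)"

text \<open>Points are numbered from 1, matrix entries from 0, hence the successors.\<close>

definition Kdet :: "nat \<Rightarrow> (nat \<Rightarrow> real) \<Rightarrow> complex" where
  "Kdet n x = det (mat n n (\<lambda>(j, k). K (x (Suc j)) (x (Suc k))))"

lemma Kdet_Leibniz: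
  "Kdet n x = (\<Sum>p | p permutes {0..<n}. signof p * (\<Prod>i\<in>{0..<n}. K (x (Suc i)) (x (Suc (p i)))))"
  unfolding Kdet_def by (auto simp: det_def permutes_def intro!: sum.cong prod.cong)

lemma set_integrable_bounded:
  fixes u :: "real \<Rightarrow> complex"
  assumes "u \<in> borel_measurable borel" "\<And>x. x \<in> L \<Longrightarrow> norm (u x) \<le> B"
  shows "set_integrable lborel L u"
  unfolding set_integrable_def using assms L_fin L_meas
  by (intro integrableI_bounded_set_indicator[where B = B]) auto

lemma integrable_basis: "set_integrable lborel L (\<lambda>x. \<phi> i x * \<psi> j x)"
proof -
  obtain B C where "\<forall>x\<in>L. norm (\<phi> i x) \<le> B" "\<forall>x\<in>L. norm (\<psi> j x) \<le> C"
    using bounded by meson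
  then have "norm (\<phi> i x * \<psi> j x) \<le> \<bar>B\<bar> * \<bar>C\<bar>" if "x \<in> L" for x
    unfolding norm_mult using that by (intro mult_mono) fastforce+
  then show ?thesis by (intro set_integrable_bounded[where B = "\<bar>B\<bar> * \<bar>C\<bar>"]) auto
qed

lemma K_trace: "(LINT z:L|lborel. K z z) = of_nat N" and integrable_K_diag: "set_integrable lborel L (\<lambda>z. K z z)"
proof -
  have "(LINT z:L|lborel. K z z) = (LINT z:L|lborel. (\<Sum>i\<in>{1..N}. 1 * (\<phi> i z * \<psi> i z)))"
    by (simp add: K_def)
  also have "\<dots> = (\<Sum>i\<in>{1..N}. 1 * (LINT z:L|lborel. \<phi> i z * \<psi> i z))"
    by (rule set_integral_weighted_sum(1)) (rule integrable_basis)
  also have "\<dots> = of_nat N" by (simp add: biorth)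
  finally show "(LINT z:L|lborel. K z z) = of_nat N" .
  show "set_integrable lborel L (\<lambda>z. K z z)"
    using set_integral_weighted_sum(2)[where u = "\<lambda>i z. \<phi> i z * \<psi> i z" and S = "{1..N}" and c = "\<lambda>_. 1", OF integrable_basis]
    by (simp add: K_def)
qed

lemma K_mult_eq: "K z y * K x z = (\<Sum>(i, j)\<in>{1..N} \<times> {1..N}. (\<phi> j x * \<psi> i y) * (\<phi> i z * \<psi> j z))"
  unfolding K_def sum_product sum.cartesian_product by (auto intro!: sum.cong simp: mult_ac)

text \<open>The kernel is that of a projection: in the double sum over indices biorthogonality keeps
  only the diagonal. The factors stand in the order in which inserting a point \<open>z\<close> into
  a cycle produces them.\<close>

lemma K_reproducing: "(LINT z:L|lborel. K z y * K x z) = K x y"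
  and integrable_K_mult: "set_integrable lborel L (\<lambda>z. K z y * K x z)"
proof -
  have "(LINT z:L|lborel. K z y * K x z) =
     (LINT z:L|lborel. (\<Sum>a\<in>{1..N} \<times> {1..N}. (\<phi> (snd a) x * \<psi> (fst a) y) * (\<phi> (fst a) z * \<psi> (snd a) z)))"
    unfolding K_mult_eq by (simp add: case_prod_beta)
  also have "\<dots> = (\<Sum>a\<in>{1..N} \<times> {1..N}. (\<phi> (snd a) x * \<psi> (fst a) y) * (LINT z:L|lborel. \<phi> (fst a) z * \<psi> (snd a) z))"
    by (rule set_integral_weighted_sum(1)) (rule integrable_basis)
  also have "\<dots> = (\<Sum>i\<in>{1..N}. \<Sum>j\<in>{1..N}. (\<phi> j x * \<psi> i y) * (LINT z:L|lborel. \<phi> i z * \<psi> j z))"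
    by (subst sum.cartesian_product) (simp add: case_prod_beta)
  also have "\<dots> = (\<Sum>i\<in>{1..N}. \<Sum>j\<in>{1..N}. if j = i then \<phi> j x * \<psi> i y else 0)"
    by (intro sum.cong refl) (simp add: biorth)
  also have "\<dots> = K x y" by (simp add: K_def)
  finally show "(LINT z:L|lborel. K z y * K x z) = K x y" .
  show "set_integrable lborel L (\<lambda>z. K z y * K x z)"
    using set_integral_weighted_sum(2)[where u = "\<lambda>a z. \<phi> (fst a) z * \<psi> (snd a) z" and S = "{1..N} \<times> {1..N}"
        and c = "\<lambda>a. \<phi> (snd a) x * \<psi> (fst a) y", OF integrable_basis]
    unfolding K_mult_eq by (simp add: case_prod_beta)
qed

text \<open>A permutation of \<open>n + 1\<close> points arises by inserting the last point into a permutation \<open>q\<close> of the others, either as a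
  fixed point or into a cycle. In the second case the reproducing property gives back the term of \<open>q\<close> with the opposite sign.\<close>
lemma Kdet_integrate_out:
  "(LINT z:L|lborel. Kdet (Suc n) (x(Suc n := z))) = (of_nat N - of_nat n) * Kdet n x"
proof -
  define U where "U = {0..<n}"
  have U: "finite U" "n \<notin> U" "{0..<Suc n} = insert n U" by (auto simp: U_def)
  define P where "P q = signof q * (\<Prod>i\<in>U. K (x (Suc i)) (x (Suc (q i))))" for q
  define X where "X z = x(Suc n := z)" for z
  define f where "f z p = signof p * (\<Prod>i\<in>insert n U. K (X z (Suc i)) (X z (Suc (p i))))" for z and p :: "nat \<Rightarrow> nat"
  have XU: "X z (Suc i) = x (Suc i)" if "i \<in> U" for z i using that by (simp add: X_def U_def)
  have Xn: "X z (Suc n) = z" for z by (simp add: X_def)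
  have key: "set_integrable lborel L (\<lambda>z. f z (Transposition.transpose n b \<circ> q)) \<and>
      (LINT z:L|lborel. f z (Transposition.transpose n b \<circ> q)) = (if b = n then of_nat N else -1) * P q"
    if q: "q permutes U" and b: "b \<in> insert n U" for q b
  proof (cases "b = n")
    case True
    have qn: "q n = n" using permutes_not_in[OF q U(2)] .
    have "f z (Transposition.transpose n b \<circ> q) = P q * K z z" for z
    proof -
      have "(\<Prod>i\<in>U. K (X z (Suc i)) (X z (Suc (q i)))) = (\<Prod>i\<in>U. K (x (Suc i)) (x (Suc (q i))))"
        using permutes_in_image[OF q] by (intro prod.cong refl) (simp add: XU)
      then show ?thesis unfolding f_def P_def using True U qn Xn by (simp add: mult_ac)
    qed
    then show ?thesis using True K_trace integrable_K_diag by (simp add: mult.commute)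
  next
    case False
    then have bU: "b \<in> U" using b by simp
    have qn: "q n = n" using permutes_not_in[OF q U(2)] .
    \<comment> \<open>The predecessor of \<open>b\<close>: composing with the transposition replaces
      the link from \<open>c\<close> to \<open>b\<close> by links from \<open>c\<close> to
      \<open>n\<close> and from \<open>n\<close> to \<open>b\<close>.\<close>
    define c where "c = inv_into UNIV q b"
    have qc: "q c = b" unfolding c_def using permutes_inverses(1)[OF q] .
    have cU: "c \<in> U" using bU qc permutes_in_image[OF q] by metis
    have qi: "q i \<noteq> b" if "i \<noteq> c" for i using that qc permutes_inj[OF q] by (metis injD)
    define W where "W = (\<Prod>i\<in>U - {c}. K (x (Suc i)) (x (Suc (q i))))"
    have Peq: "P q = signof q * (K (x (Suc c)) (x (Suc b)) * W)"
      unfolding P_def W_def using prod.remove[OF U(1) cU, of "\<lambda>i. K (x (Suc i)) (x (Suc (q i)))"] qc by simp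
    have sg: "signof (Transposition.transpose n b \<circ> q) = - (signof q :: complex)"
    proof -
      have "sign (Transposition.transpose n b \<circ> q) = sign (Transposition.transpose n b) * sign q"
      proof (rule sign_compose)
        show "permutation q" using q U(1) unfolding permutation_permutes by blast
      qed (rule permutation_swap_id)
      then show ?thesis using False by (simp add: sign_swap_id)
    qed
    have feq: "f z (Transposition.transpose n b \<circ> q) = (- signof q * W) * (K z (x (Suc b)) * K (x (Suc c)) z)" for z
    proof -
      have "(\<Prod>i\<in>insert n U. K (X z (Suc i)) (X z (Suc ((Transposition.transpose n b \<circ> q) i)))) =
        K z (x (Suc b)) * (\<Prod>i\<in>U. K (X z (Suc i)) (X z (Suc ((Transposition.transpose n b \<circ> q) i))))"
        using U qn Xn XU[OF bU] by simp
      also have "(\<Prod>i\<in>U. K (X z (Suc i)) (X z (Suc ((Transposition.transpose n b \<circ> q) i)))) =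
        K (x (Suc c)) z * (\<Prod>i\<in>U - {c}. K (X z (Suc i)) (X z (Suc ((Transposition.transpose n b \<circ> q) i))))"
        using prod.remove[OF U(1) cU, of "\<lambda>i. K (X z (Suc i)) (X z (Suc ((Transposition.transpose n b \<circ> q) i)))"] qc Xn XU[OF cU] by simp
      also have "(\<Prod>i\<in>U - {c}. K (X z (Suc i)) (X z (Suc ((Transposition.transpose n b \<circ> q) i)))) = W"
        unfolding W_def
      proof (intro prod.cong refl)
        fix i assume i: "i \<in> U - {c}"
        then have "q i \<in> U" "q i \<noteq> b" "q i \<noteq> n" using permutes_in_image[OF q, of i] qi[of i] U(2) by auto
        then show "K (X z (Suc i)) (X z (Suc ((Transposition.transpose n b \<circ> q) i))) = K (x (Suc i)) (x (Suc (q i)))"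
          using i by (simp add: XU)
      qed
      finally show ?thesis unfolding f_def sg by (simp add: mult_ac)
    qed
    show ?thesis
    proof
      show "set_integrable lborel L (\<lambda>z. f z (Transposition.transpose n b \<circ> q))"
        unfolding feq using integrable_K_mult by (rule set_integrable_mult_right)
      have "(LINT z:L|lborel. f z (Transposition.transpose n b \<circ> q)) = (- signof q * W) * K (x (Suc c)) (x (Suc b))"
        unfolding feq set_integral_mult_right K_reproducing ..
      then show "(LINT z:L|lborel. f z (Transposition.transpose n b \<circ> q)) = (if b = n then of_nat N else -1) * P q"
        using False by (simp add: Peq mult_ac)
    qed
  qed
  have "Kdet (Suc n) (X z) = (\<Sum>b\<in>insert n U. \<Sum>q | q permutes U. f z (Transposition.transpose n b \<circ> q))" for z
    unfolding Kdet_Leibniz U(3) f_def[symmetric] by (rule sum_over_permutations_insert[OF U(1,2)])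
  then have "(LINT z:L|lborel. Kdet (Suc n) (X z)) =
     (LINT z:L|lborel. (\<Sum>a\<in>insert n U \<times> {q. q permutes U}. 1 * f z (Transposition.transpose n (fst a) \<circ> snd a)))"
    by (simp add: sum.cartesian_product case_prod_beta)
  also have "\<dots> = (\<Sum>a\<in>insert n U \<times> {q. q permutes U}. 1 * (LINT z:L|lborel. f z (Transposition.transpose n (fst a) \<circ> snd a)))"
  proof (rule set_integral_weighted_sum(1))
    fix a assume "a \<in> insert n U \<times> {q. q permutes U}"
    then show "set_integrable lborel L (\<lambda>z. f z (Transposition.transpose n (fst a) \<circ> snd a))"
      by (intro key[THEN conjunct1]) auto
  qed
  also have "\<dots> = (\<Sum>b\<in>insert n U. \<Sum>q | q permutes U. (if b = n then of_nat N else -1) * P q)"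
    unfolding sum.cartesian_product
  proof (rule sum.cong)
    fix a assume a: "a \<in> insert n U \<times> {q. q permutes U}"
    have "(LINT z:L|lborel. f z (Transposition.transpose n (fst a) \<circ> snd a)) = (if fst a = n then of_nat N else -1) * P (snd a)"
      by (rule key[THEN conjunct2]) (use a in auto)
    then show "1 * (LINT z:L|lborel. f z (Transposition.transpose n (fst a) \<circ> snd a)) =
        (case a of (b, q) \<Rightarrow> (if b = n then of_nat N else -1) * P q)"
      by (simp add: case_prod_beta)
  qed simp
  also have "\<dots> = (\<Sum>b\<in>insert n U. (if b = n then of_nat N else -1)) * (\<Sum>q | q permutes U. P q)"
    unfolding sum_product ..
  \<comment> \<open>The fixed point contributes the trace \<open>N\<close>, and each of the
    \<open>n\<close> possible insertions contributes \<open>-1\<close>.\<close>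
  also have "(\<Sum>b\<in>insert n U. (if b = n then of_nat N else -1)) = (of_nat N - of_nat n :: complex)"
  proof -
    have "(\<Sum>b\<in>U. (if b = n then of_nat N else -1)) = (\<Sum>b\<in>U. -1 :: complex)"
      using U(2) by (intro sum.cong) auto
    then show ?thesis using U(1,2) by (simp add: U_def)
  qed
  also have "(\<Sum>q | q permutes U. P q) = Kdet n x"
    unfolding Kdet_Leibniz P_def U_def ..
  finally show ?thesis unfolding X_def .
qed

end

section \<open>Correlation functionals and symmetrisation\<close>

context biorthogonal_ensemble
begin

abbreviation Leb :: "nat \<Rightarrow> (nat \<Rightarrow> real) measure" where
  "Leb n \<equiv> PiM {1..n} (\<lambda>_. lborel)"

abbreviation box :: "nat \<Rightarrow> (nat \<Rightarrow> real) set" where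
  "box n \<equiv> {1..n} \<rightarrow>\<^sub>E L"

lemma box_sets [measurable]: "box n \<in> sets (Leb n)"
  by (rule sets_PiM_I_finite) auto

lemma emeasure_box: "emeasure (Leb n) (box n) < \<infinity>"
proof -
  have "emeasure (Leb n) (box n) = (\<Prod>i\<in>{1..n}. emeasure lborel L)"
    by (rule lborel_product.emeasure_PiM) auto
  then show ?thesis using L_fin by (simp add: power_less_top_ennreal)
qed

lemma measurable_K_components:
  assumes "i \<in> {1..n}" "j \<in> {1..n}"
  shows "(\<lambda>x. K (x i) (x j)) \<in> borel_measurable (Leb n)"
proof -
  have c: "(\<lambda>x. x k) \<in> borel_measurable (Leb n)" if "k \<in> {1..n}" for k
    using measurable_component_singleton[OF that, of "\<lambda>_. lborel"] by simp
  show ?thesis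
    unfolding K_def
    by (intro borel_measurable_sum borel_measurable_times measurable_compose[OF c meas(1)] measurable_compose[OF c meas(2)] assms)
qed

lemma measurable_Kdet [measurable]: "Kdet n \<in> borel_measurable (Leb n)"
proof -
  have "Kdet n = (\<lambda>x. \<Sum>p | p permutes {0..<n}. signof p * (\<Prod>i\<in>{0..<n}. K (x (Suc i)) (x (Suc (p i)))))"
    by (rule ext) (rule Kdet_Leibniz)
  also have "\<dots> \<in> borel_measurable (Leb n)"
    by (intro borel_measurable_sum borel_measurable_times borel_measurable_const borel_measurable_prod measurable_K_components)
       (auto simp: permutes_in_image less_eq_Suc_le[symmetric])
  finally show ?thesis .
qed

lemma bounded_K: "\<exists>C. \<forall>x\<in>L. \<forall>y\<in>L. norm (K x y) \<le> C"
proof -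
  obtain B C where B: "\<And>i. \<forall>x\<in>L. norm (\<phi> i x) \<le> B i" and C: "\<And>i. \<forall>x\<in>L. norm (\<psi> i x) \<le> C i"
    using bounded by metis
  have "norm (K x y) \<le> (\<Sum>i\<in>{1..N}. \<bar>B i\<bar> * \<bar>C i\<bar>)" if "x \<in> L" "y \<in> L" for x y
    unfolding K_def
  proof (rule sum_norm_le)
    fix i
    have "norm (\<phi> i x) \<le> \<bar>B i\<bar>" "norm (\<psi> i y) \<le> \<bar>C i\<bar>"
      using B[of i] C[of i] that by force+
    then show "norm (\<phi> i x * \<psi> i y) \<le> \<bar>B i\<bar> * \<bar>C i\<bar>"
      unfolding norm_mult by (intro mult_mono) auto
  qed
  then show ?thesis by blast
qed

lemma bounded_Kdet: "\<exists>C. \<forall>x\<in>box n. norm (Kdet n x) \<le> C"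
proof -
  obtain C where C: "\<And>x y. x \<in> L \<Longrightarrow> y \<in> L \<Longrightarrow> norm (K x y) \<le> C"
    using bounded_K by blast
  have "norm (Kdet n x) \<le> (\<Sum>p | p permutes {0..<n}. \<Prod>i\<in>{0..<n}. C)" if x: "x \<in> box n" for x
    unfolding Kdet_Leibniz
  proof (rule sum_norm_le)
    fix p assume "p \<in> {p. p permutes {0..<n}}"
    then have p: "p permutes {0..<n}" by simp
    have "norm (signof p * (\<Prod>i\<in>{0..<n}. K (x (Suc i)) (x (Suc (p i))))) = (\<Prod>i\<in>{0..<n}. norm (K (x (Suc i)) (x (Suc (p i)))))"
      by (simp add: norm_mult prod_norm sign_def)
    also have "\<dots> \<le> (\<Prod>i\<in>{0..<n}. C)"
    proof (rule prod_mono, intro conjI)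
      fix i assume i: "i \<in> {0..<n}"
      then have "p i \<in> {0..<n}" using permutes_in_image[OF p] by blast
      then show "norm (K (x (Suc i)) (x (Suc (p i)))) \<le> C"
        using i x by (intro C) (auto intro!: PiE_mem[OF x])
    qed simp
    finally show "norm (signof p * (\<Prod>i\<in>{0..<n}. K (x (Suc i)) (x (Suc (p i))))) \<le> (\<Prod>i\<in>{0..<n}. C)" .
  qed
  then show ?thesis by blast
qed

text \<open>The candidate \<open>n\<close>-point functional, complex because the kernel need not be
  real. At \<open>n = N\<close> it runs over unordered configurations and has total mass
  \<open>N!\<close>.\<close>

definition Q :: "nat \<Rightarrow> ((nat \<Rightarrow> real) \<Rightarrow> real) \<Rightarrow> complex" where
  "Q n h = (\<integral>x. indicator (box n) x *\<^sub>R (of_real (h x) * Kdet n x) \<partial>Leb n)"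

lemma Q_integrable:
  assumes [measurable]: "h \<in> borel_measurable (Leb n)" and B: "\<And>x. \<bar>h x\<bar> \<le> B"
  shows "integrable (Leb n) (\<lambda>x. indicator (box n) x *\<^sub>R (of_real (h x) * Kdet n x))"
proof -
  obtain C where C: "\<And>x. x \<in> box n \<Longrightarrow> norm (Kdet n x) \<le> C" using bounded_Kdet by blast
  have "norm (of_real (h x) * Kdet n x) \<le> \<bar>B\<bar> * C" if "x \<in> box n" for x
    unfolding norm_mult using B[of x] C[OF that] by (intro mult_mono) auto
  moreover have "(\<lambda>x. of_real (h x) * Kdet n x) \<in> borel_measurable (Leb n)" by measurable
  ultimately show ?thesis
    by (intro integrableI_bounded_set_indicator[where B = "\<bar>B\<bar> * C"] box_sets emeasure_box AE_I2 impI)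
qed

lemma Q_sum:
  assumes "finite A" and m: "\<And>a. a \<in> A \<Longrightarrow> h a \<in> borel_measurable (Leb n)" and B: "\<And>a x. a \<in> A \<Longrightarrow> \<bar>h a x\<bar> \<le> B"
  shows "Q n (\<lambda>x. \<Sum>a\<in>A. h a x) = (\<Sum>a\<in>A. Q n (h a))"
proof -
  have "Q n (\<lambda>x. \<Sum>a\<in>A. h a x) = (\<integral>x. (\<Sum>a\<in>A. indicator (box n) x *\<^sub>R (of_real (h a x) * Kdet n x)) \<partial>Leb n)"
    unfolding Q_def by (simp add: sum_distrib_right scaleR_sum_right)
  also have "\<dots> = (\<Sum>a\<in>A. Q n (h a))"
    unfolding Q_def by (rule Bochner_Integration.integral_sum) (rule Q_integrable[OF m B])
  finally show ?thesis .
qed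

lemma Q_cong:
  assumes "\<And>x. x \<in> box n \<Longrightarrow> Kdet n x \<noteq> 0 \<Longrightarrow> h x = h' x"
  shows "Q n h = Q n h'"
  unfolding Q_def using assms by (intro Bochner_Integration.integral_cong refl) (auto simp: indicator_def)

text \<open>Fubini isolates the last coordinate. The test function depends on the first
  \<open>m \<le> n\<close> coordinates only, so the inner integral is the one computed in
  \<open>Kdet_integrate_out\<close>.\<close>

lemma Q_Suc:
  assumes mn: "m \<le> n" and h [measurable]: "h \<in> borel_measurable (Leb m)" and B: "\<And>x. \<bar>h x\<bar> \<le> B"
  shows "Q (Suc n) (\<lambda>x. h (restrict x {1..m})) = (of_nat N - of_nat n) * Q n (\<lambda>x. h (restrict x {1..m}))"
proof -
  have ins: "{1..Suc n} = insert (Suc n) {1..n}" by auto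
  let ?g = "\<lambda>x. indicator (box (Suc n)) x *\<^sub>R (of_real (h (restrict x {1..m})) * Kdet (Suc n) x)"
  have "(\<lambda>x. restrict x {1..m}) \<in> measurable (Leb (Suc n)) (Leb m)"
    using mn by (intro measurable_restrict_subset) auto
  then have "(\<lambda>x. h (restrict x {1..m})) \<in> borel_measurable (Leb (Suc n))"
    using h by (rule measurable_compose)
  from Q_integrable[OF this B] have int: "integrable (PiM (insert (Suc n) {1..n}) (\<lambda>_. lborel)) ?g"
    unfolding ins .
  have "Q (Suc n) (\<lambda>x. h (restrict x {1..m})) = (\<integral>x. (\<integral>y. ?g (x(Suc n := y)) \<partial>lborel) \<partial>Leb n)"
    unfolding Q_def ins[symmetric] using lborel_product.product_integral_insert[OF _ _ int] unfolding ins[symmetric] by simp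
  also have "\<dots> = (\<integral>x. (of_nat N - of_nat n) * (indicator (box n) x *\<^sub>R (of_real (h (restrict x {1..m})) * Kdet n x)) \<partial>Leb n)"
  proof (rule Bochner_Integration.integral_cong[OF refl])
    fix x assume x: "x \<in> space (Leb n)"
    have ind: "indicat_real (box (Suc n)) (x(Suc n := y)) = indicator (box n) x * indicator L y" for y
    proof -
      have "x(Suc n := y) \<in> box (Suc n) \<longleftrightarrow> x \<in> box n \<and> y \<in> L"
      proof
        assume *: "x(Suc n := y) \<in> box (Suc n)"
        have "x k \<in> L" if "k \<in> {1..n}" for k
          using PiE_mem[OF *, of k] that by auto
        moreover have "y \<in> L" using PiE_mem[OF *, of "Suc n"] by simp
        ultimately show "x \<in> box n \<and> y \<in> L" using x by (auto simp: space_PiM PiE_iff)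
      next
        assume "x \<in> box n \<and> y \<in> L"
        then show "x(Suc n := y) \<in> box (Suc n)" by (auto simp: PiE_iff extensional_def le_Suc_eq)
      qed
      then show ?thesis by (auto simp: indicator_def)
    qed
    have res: "restrict (x(Suc n := y)) {1..m} = restrict x {1..m}" for y
      using mn by (auto simp: restrict_def fun_eq_iff)
    have "(\<integral>y. ?g (x(Suc n := y)) \<partial>lborel) =
      (\<integral>y. (indicator (box n) x *\<^sub>R of_real (h (restrict x {1..m}))) * (indicator L y *\<^sub>R Kdet (Suc n) (x(Suc n := y))) \<partial>lborel)"
      unfolding ind res by (simp add: mult_ac)
    also have "\<dots> = (indicator (box n) x *\<^sub>R of_real (h (restrict x {1..m}))) * (LINT y:L|lborel. Kdet (Suc n) (x(Suc n := y)))"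
      unfolding set_lebesgue_integral_def by (rule integral_mult_right_zero)
    finally show "(\<integral>y. ?g (x(Suc n := y)) \<partial>lborel) =
      (of_nat N - of_nat n) * (indicator (box n) x *\<^sub>R (of_real (h (restrict x {1..m})) * Kdet n x))"
      unfolding Kdet_integrate_out by (simp add: mult_ac)
  qed
  also have "\<dots> = (of_nat N - of_nat n) * Q n (\<lambda>x. h (restrict x {1..m}))"
    unfolding Q_def by (rule integral_mult_right_zero)
  finally show ?thesis .
qed

lemma Q_restrict:
  assumes mn: "m \<le> n" and h: "h \<in> borel_measurable (Leb m)" and B: "\<And>x. \<bar>h x\<bar> \<le> B"
  shows "Q n (\<lambda>x. h (restrict x {1..m})) = (\<Prod>i\<in>{m..<n}. of_nat N - of_nat i) * Q m h"
  using mn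
proof (induction n rule: dec_induct)
  case base
  have "Q m (\<lambda>x. h (restrict x {1..m})) = Q m h"
    by (rule Q_cong) (auto simp: PiE_iff extensional_restrict)
  moreover have "(\<Prod>i\<in>{m..<m}. of_nat N - of_nat i :: complex) = 1" by simp
  ultimately show ?case by (simp only: mult_1_left)
next
  case (step n)
  have "(\<Prod>i\<in>{m..<Suc n}. of_nat N - of_nat i :: complex) = (of_nat N - of_nat n) * (\<Prod>i\<in>{m..<n}. of_nat N - of_nat i)"
    using step(1) by (simp add: mult.commute)
  then show ?case unfolding Q_Suc[OF step(1) h B] step.IH by (simp only: mult.assoc)
qed

lemma Kdet_permute:
  assumes \<sigma>: "\<sigma> permutes {1..N}"
  shows "Kdet N (\<lambda>k\<in>{1..N}. x (\<sigma> k)) = Kdet N x"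
proof -
  \<comment> \<open>The permutation \<open>\<sigma>\<close> of \<open>{1..N}\<close> transported to
    the matrix indices \<open>{0..<N}\<close>.\<close>
  define p where "p i = (if i < N then \<sigma> (Suc i) - 1 else i)" for i
  have \<sigma>N: "\<sigma> k \<in> {1..N}" if "k \<in> {1..N}" for k using permutes_in_image[OF \<sigma>] that by blast
  have Sp: "Suc (p i) = \<sigma> (Suc i)" "p i < N" if "i < N" for i
    using \<sigma>N[of "Suc i"] that by (auto simp: p_def)
  have "inj_on p {0..<N}"
  proof (rule inj_onI)
    fix i j assume "i \<in> {0..<N}" "j \<in> {0..<N}" "p i = p j"
    then have "\<sigma> (Suc i) = \<sigma> (Suc j)" using Sp[of i] Sp[of j] by simp
    then show "i = j" using permutes_inj[OF \<sigma>] by (auto dest: injD)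
  qed
  moreover have "p ` {0..<N} \<subseteq> {0..<N}" using Sp by auto
  ultimately have "bij_betw p {0..<N} {0..<N}"
    by (simp add: bij_betw_def endo_inj_surj)
  then have p: "p permutes {0..<N}" by (rule bij_imp_permutes) (simp add: p_def)
  have "Kdet N (\<lambda>k\<in>{1..N}. x (\<sigma> k)) = det (mat N N (\<lambda>(i, j). K (x (Suc (p i))) (x (Suc (p j)))))"
    unfolding Kdet_def by (rule arg_cong[of _ _ det], rule eq_matI) (auto simp: Sp)
  also have "\<dots> = Kdet N x"
    unfolding Kdet_def by (rule det_permute_both[OF p])
  finally show ?thesis .
qed

lemma Q_permute:
  assumes \<sigma>: "\<sigma> permutes {1..N}" and h [measurable]: "h \<in> borel_measurable (Leb N)"
  shows "Q N (\<lambda>x. h (\<lambda>k\<in>{1..N}. x (\<sigma> k))) = Q N h"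
proof -
  let ?g = "\<lambda>x. indicator (box N) x *\<^sub>R (of_real (h x) * Kdet N x)"
  have \<sigma>N: "\<sigma> k \<in> {1..N} \<longleftrightarrow> k \<in> {1..N}" for k using permutes_in_image[OF \<sigma>] by blast
  have "Q N (\<lambda>x. h (\<lambda>k\<in>{1..N}. x (\<sigma> k))) = (\<integral>x. ?g (\<lambda>k\<in>{1..N}. x (\<sigma> k)) \<partial>Leb N)"
    unfolding Q_def
  proof (rule Bochner_Integration.integral_cong[OF refl])
    fix x assume x: "x \<in> space (Leb N)"
    have "(\<lambda>k\<in>{1..N}. x (\<sigma> k)) \<in> box N \<longleftrightarrow> x \<in> box N"
    proof
      assume *: "(\<lambda>k\<in>{1..N}. x (\<sigma> k)) \<in> box N"
      have "x k \<in> L" if "k \<in> {1..N}" for k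
      proof -
        obtain l where l: "\<sigma> l = k" "l \<in> {1..N}" using permutes_image[OF \<sigma>] \<open>k \<in> {1..N}\<close> by (metis imageE)
        then show ?thesis using PiE_mem[OF *, of l] by simp
      qed
      then show "x \<in> box N" using x by (auto simp: space_PiM PiE_iff)
    next
      assume "x \<in> box N"
      then show "(\<lambda>k\<in>{1..N}. x (\<sigma> k)) \<in> box N" using \<sigma>N by (auto simp: PiE_iff)
    qed
    then show "indicator (box N) x *\<^sub>R (of_real (h (\<lambda>k\<in>{1..N}. x (\<sigma> k))) * Kdet N x) = ?g (\<lambda>k\<in>{1..N}. x (\<sigma> k))"
      unfolding Kdet_permute[OF \<sigma>] by (simp add: indicator_def)
  qed
  also have "\<dots> = (\<integral>x. ?g x \<partial>Leb N)"
  proof (rule integral_PiM_permute[OF \<sigma>])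
    show "?g \<in> borel_measurable (Leb N)" by measurable
  qed simp
  finally show ?thesis unfolding Q_def .
qed

text \<open>Coinciding points give equal rows. Configurations with ties, which no permutation can
  sort strictly, are thereby discarded without any argument on null sets.\<close>

lemma Kdet_eq_0:
  assumes "\<not> inj_on x {1..N}"
  shows "Kdet N x = 0"
proof -
  obtain i j where ij: "i \<in> {1..N}" "j \<in> {1..N}" "i \<noteq> j" "x i = x j"
    using assms by (auto simp: inj_on_def)
  show ?thesis
    unfolding Kdet_def
    by (rule det_identical_rows[of _ N "i - 1" "j - 1"]) (use ij in \<open>auto intro!: eq_vecI\<close>)
qed

lemma weyl_chamber_subset_box: "weyl_chamber N L \<subseteq> box N"
  by (auto simp: weyl_chamber_def)

lemma weyl_chamber_sets [measurable]: "weyl_chamber N L \<in> sets (Leb N)"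
proof -
  have c: "(\<lambda>x. x k) \<in> borel_measurable (Leb N)" if "k \<in> {1..N}" for k
    using measurable_component_singleton[OF that, of "\<lambda>_. lborel"] by simp
  have "{x \<in> space (Leb N). x i < x j} \<in> sets (Leb N)" if "i \<in> {1..N}" "j \<in> {1..N}" for i j
    using c[OF that(1)] c[OF that(2)] by (rule borel_measurable_less)
  then have "{x \<in> space (Leb N). \<forall>i\<in>{1..N}. \<forall>j\<in>{j \<in> {1..N}. i < j}. x i < x j} \<in> sets (Leb N)"
    by (intro sets.sets_Collect_finite_All) auto
  then have "box N \<inter> {x \<in> space (Leb N). \<forall>i\<in>{1..N}. \<forall>j\<in>{j \<in> {1..N}. i < j}. x i < x j} \<in> sets (Leb N)"
    using box_sets by (rule sets.Int[rotated])
  moreover have "box N \<inter> {x \<in> space (Leb N). \<forall>i\<in>{1..N}. \<forall>j\<in>{j \<in> {1..N}. i < j}. x i < x j} = weyl_chamber N L"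
    using sets.sets_into_space[OF box_sets, of N] by (auto simp: weyl_chamber_def strict_mono_on_def)
  ultimately show ?thesis by (simp only:)
qed

definition injections :: "nat \<Rightarrow> (nat \<Rightarrow> nat) set" where
  "injections n = {j \<in> {1..n} \<rightarrow>\<^sub>E {1..N}. inj_on j {1..n}}"

lemma finite_injections: "finite (injections n)"
  unfolding injections_def by (rule finite_subset[of _ "{1..n} \<rightarrow>\<^sub>E {1..N}"]) (auto intro: finite_PiE)

lemma card_injections: "card (injections n) = (\<Prod>i\<in>{0..<n}. N - i)"
  using card_inj_on_subset_funcset[of "{1..n}" "{1..N}" "{1..n}"] by (simp add: injections_def)

lemma measurable_injection:
  assumes f: "f \<in> borel_measurable (Leb n)" and j: "j \<in> injections n"
  shows "(\<lambda>x. f (\<lambda>k\<in>{1..n}. x (j k))) \<in> borel_measurable (Leb N)"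
proof (rule measurable_compose[OF _ f])
  show "(\<lambda>x. \<lambda>k\<in>{1..n}. x (j k)) \<in> measurable (Leb N) (Leb n)"
    using j by (intro measurable_reindex_PiM) (auto simp: injections_def)
qed

text \<open>Composition with \<open>\<sigma>\<close> permutes the injections, so the statistic is
  symmetric in the particles and survives symmetrisation unchanged.\<close>

lemma sum_injections_permute:
  assumes \<sigma>: "\<sigma> permutes {1..N}"
  shows "(\<Sum>j\<in>injections n. f (\<lambda>k\<in>{1..n}. (\<lambda>k\<in>{1..N}. x (\<sigma> k)) (j k))) =
    (\<Sum>j\<in>injections n. f (\<lambda>k\<in>{1..n}. x (j k)) :: real)"
proof -
  have bij: "(\<lambda>k\<in>{1..n}. \<tau> (j k)) \<in> injections n" if "j \<in> injections n" "\<tau> permutes {1..N}" for j \<tau>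
  proof -
    have ji: "inj_on j {1..n}" using that(1) by (simp add: injections_def)
    have "inj_on (\<lambda>k\<in>{1..n}. \<tau> (j k)) {1..n}"
    proof (rule inj_onI)
      fix k l assume kl: "k \<in> {1..n}" "l \<in> {1..n}" "(\<lambda>k\<in>{1..n}. \<tau> (j k)) k = (\<lambda>k\<in>{1..n}. \<tau> (j k)) l"
      then have "\<tau> (j k) = \<tau> (j l)" by simp
      then have "j k = j l" by (rule injD[OF permutes_inj[OF that(2)]])
      then show "k = l" using inj_onD[OF ji _ kl(1,2)] by simp
    qed
    moreover have "\<tau> (j k) \<in> {1..N}" if "k \<in> {1..n}" for k
      unfolding permutes_in_image[OF \<open>\<tau> permutes {1..N}\<close>]
      using \<open>j \<in> injections n\<close> that by (simp add: injections_def PiE_iff)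
    ultimately show ?thesis unfolding injections_def by (simp add: restrict_PiE_iff)
  qed
  have jN: "j k \<in> {1..N}" if "j \<in> injections n" "k \<in> {1..n}" for j k
    using that by (simp add: injections_def PiE_iff)
  have inv: "inv_into UNIV \<sigma> permutes {1..N}" using \<sigma> by (rule permutes_inv)
  show ?thesis
  proof (rule sum.reindex_bij_witness[of _ "\<lambda>j. \<lambda>k\<in>{1..n}. inv_into UNIV \<sigma> (j k)" "\<lambda>j. \<lambda>k\<in>{1..n}. \<sigma> (j k)"])
    fix j assume j: "j \<in> injections n"
    have ext: "j k = undefined" if "k \<notin> {1..n}" for k
      using j that unfolding injections_def by (auto dest: PiE_arb)
    show "(\<lambda>k\<in>{1..n}. inv_into UNIV \<sigma> ((\<lambda>k\<in>{1..n}. \<sigma> (j k)) k)) = j"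
      "(\<lambda>k\<in>{1..n}. \<sigma> ((\<lambda>k\<in>{1..n}. inv_into UNIV \<sigma> (j k)) k)) = j"
      using ext by (auto simp: fun_eq_iff restrict_def permutes_inverses[OF \<sigma>] simp del: One_nat_def)
    show "(\<lambda>k\<in>{1..n}. \<sigma> (j k)) \<in> injections n" "(\<lambda>k\<in>{1..n}. inv_into UNIV \<sigma> (j k)) \<in> injections n"
      by (rule bij[OF j \<sigma>], rule bij[OF j inv])
    have "(\<lambda>k\<in>{1..n}. x ((\<lambda>k\<in>{1..n}. \<sigma> (j k)) k)) = (\<lambda>k\<in>{1..n}. (\<lambda>k\<in>{1..N}. x (\<sigma> k)) (j k))"
      by (intro restrict_ext) (simp add: jN[OF j] del: One_nat_def atLeastAtMost_iff)
    then show "f (\<lambda>k\<in>{1..n}. x ((\<lambda>k\<in>{1..n}. \<sigma> (j k)) k)) = f (\<lambda>k\<in>{1..n}. (\<lambda>k\<in>{1..N}. x (\<sigma> k)) (j k))"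
      by (rule arg_cong)
  qed
qed

text \<open>Summing over all relabellings removes the ordering at the cost of a factor
  \<open>N!\<close>. Every injection extends to a permutation, so each summand equals the one for
  the first \<open>n\<close> points, where the other \<open>N - n\<close> points integrate to
  \<open>(N - n)!\<close>.\<close>

lemma Q_weyl_chamber:
  assumes n: "n \<le> N" and f: "f \<in> borel_measurable (Leb n)" and B: "\<And>x. \<bar>f x\<bar> \<le> B"
  shows "Q N (\<lambda>x. indicator (weyl_chamber N L) x * (\<Sum>j\<in>injections n. f (\<lambda>k\<in>{1..n}. x (j k)))) = Q n f"
proof -
  define S where "S x = (\<Sum>j\<in>injections n. f (\<lambda>k\<in>{1..n}. x (j k)))" for x
  define h where "h x = indicator (weyl_chamber N L) x * S x" for x
  define C where "C = real (card (injections n)) * B"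
  have S_meas [measurable]: "S \<in> borel_measurable (Leb N)"
    unfolding S_def by (intro borel_measurable_sum measurable_injection f)
  have h_meas [measurable]: "h \<in> borel_measurable (Leb N)"
    unfolding h_def by measurable
  have SB: "\<bar>S x\<bar> \<le> C" for x
    unfolding S_def C_def by (intro order_trans[OF sum_abs] sum_bounded_above B)
  have hB: "\<bar>h x\<bar> \<le> C" for x
    using SB[of x] order_trans[OF abs_ge_zero SB[of x]] by (cases "x \<in> weyl_chamber N L") (simp_all add: h_def)
  let ?P = "{\<sigma>. \<sigma> permutes {1..N}}"
  let ?T = "\<lambda>\<sigma> x. \<lambda>k\<in>{1..N}. x (\<sigma> k)"
  have T_meas: "?T \<sigma> \<in> measurable (Leb N) (Leb N)" if "\<sigma> \<in> ?P" for \<sigma>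
  proof (rule measurable_reindex_PiM)
    have \<sigma>: "\<sigma> permutes {1..N}" using that by simp
    show "\<sigma> k \<in> {1..N}" if "k \<in> {1..N}" for k
      unfolding permutes_in_image[OF \<sigma>] by (rule that)
  qed
  have "of_nat (fact N) * Q N h = (\<Sum>\<sigma>\<in>?P. Q N h)"
    by (simp add: card_permutations)
  also have "\<dots> = (\<Sum>\<sigma>\<in>?P. Q N (\<lambda>x. h (?T \<sigma> x)))"
  proof (rule sum.cong[OF refl])
    show "Q N h = Q N (\<lambda>x. h (?T \<sigma> x))" if "\<sigma> \<in> ?P" for \<sigma>
      by (rule Q_permute[symmetric, OF _ h_meas]) (use that in simp)
  qed
  also have "\<dots> = Q N (\<lambda>x. \<Sum>\<sigma>\<in>?P. h (?T \<sigma> x))"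
  proof (rule Q_sum[symmetric, where B = C])
    show "(\<lambda>x. h (?T \<sigma> x)) \<in> borel_measurable (Leb N)" if "\<sigma> \<in> ?P" for \<sigma>
      by (rule measurable_compose[OF T_meas[OF that] h_meas])
  qed (auto intro: finite_permutations hB)
  also have "\<dots> = Q N S"
  proof (rule Q_cong)
    fix x assume x: "x \<in> box N" "Kdet N x \<noteq> 0"
    have "(\<Sum>\<sigma>\<in>?P. h (?T \<sigma> x)) = (\<Sum>\<sigma>\<in>?P. indicator (weyl_chamber N L) (?T \<sigma> x) * S x)"
    proof (rule sum.cong[OF refl])
      fix \<sigma> assume "\<sigma> \<in> ?P"
      then have "S (?T \<sigma> x) = S x" unfolding S_def by (intro sum_injections_permute) simp
      then show "h (?T \<sigma> x) = indicator (weyl_chamber N L) (?T \<sigma> x) * S x" by (simp only: h_def)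
    qed
    also have "\<dots> = (\<Sum>\<sigma>\<in>?P. indicator (weyl_chamber N L) (?T \<sigma> x)) * S x"
      by (rule sum_distrib_right[symmetric])
    also have "(\<Sum>\<sigma>\<in>?P. indicator (weyl_chamber N L) (?T \<sigma> x)) = (1::real)"
      by (rule sum_indicator_sorting_permutation[OF x(1)]) (use x(2) Kdet_eq_0[of x] in blast)
    finally show "(\<Sum>\<sigma>\<in>?P. h (?T \<sigma> x)) = S x" by (simp only: mult_1_left)
  qed
  also have "\<dots> = (\<Sum>j\<in>injections n. Q N (\<lambda>x. f (\<lambda>k\<in>{1..n}. x (j k))))"
    unfolding S_def by (rule Q_sum[OF finite_injections measurable_injection[OF f] B])
  also have "\<dots> = (\<Sum>j\<in>injections n. (\<Prod>i\<in>{n..<N}. of_nat N - of_nat i) * Q n f)"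
  proof (intro sum.cong refl)
    fix j assume j: "j \<in> injections n"
    obtain \<sigma> where \<sigma>: "\<sigma> permutes {1..N}" "\<And>k. k \<in> {1..n} \<Longrightarrow> \<sigma> k = j k"
    proof (rule extend_to_permutation)
      show "inj_on j {1..n}" "j ` {1..n} \<subseteq> {1..N}" using j by (auto simp: injections_def)
      show "{1..n} \<subseteq> {1..N}" using n by auto
    qed auto
    have "(\<lambda>x. restrict x {1..n}) \<in> measurable (Leb N) (Leb n)"
      using n by (intro measurable_restrict_subset) auto
    then have fm: "(\<lambda>x. f (restrict x {1..n})) \<in> borel_measurable (Leb N)"
      using f by (rule measurable_compose)
    have eq: "(\<lambda>k\<in>{1..n}. x (j k)) = restrict (?T \<sigma> x) {1..n}" for x
      using n \<sigma>(2) by (auto simp: fun_eq_iff)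
    have "(\<lambda>x. f (\<lambda>k\<in>{1..n}. x (j k))) = (\<lambda>x. f (restrict (?T \<sigma> x) {1..n}))"
      by (rule ext) (rule arg_cong[where f = f, OF eq])
    then have "Q N (\<lambda>x. f (\<lambda>k\<in>{1..n}. x (j k))) = Q N (\<lambda>x. f (restrict (?T \<sigma> x) {1..n}))"
      by (rule arg_cong)
    also have "\<dots> = Q N (\<lambda>x. f (restrict x {1..n}))"
      by (rule Q_permute[OF \<sigma>(1) fm])
    also have "\<dots> = (\<Prod>i\<in>{n..<N}. of_nat N - of_nat i) * Q n f"
      by (rule Q_restrict[OF n f B])
    finally show "Q N (\<lambda>x. f (\<lambda>k\<in>{1..n}. x (j k))) = (\<Prod>i\<in>{n..<N}. of_nat N - of_nat i) * Q n f" .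
  qed
  also have "\<dots> = of_nat (card (injections n)) * (\<Prod>i\<in>{n..<N}. of_nat N - of_nat i) * Q n f"
    by simp
  \<comment> \<open>There are \<open>N! / (N - n)!\<close> injections, and the product is
    \<open>(N - n)!\<close>.\<close>
  also have "of_nat (card (injections n)) * (\<Prod>i\<in>{n..<N}. of_nat N - of_nat i) = (of_nat (fact N) :: complex)"
  proof -
    have "(\<Prod>i\<in>{n..<N}. of_nat N - of_nat i :: complex) = of_nat (\<Prod>i\<in>{n..<N}. N - i)"
      by (simp add: of_nat_diff)
    moreover have "(\<Prod>i\<in>{0..<n}. N - i) * (\<Prod>i\<in>{n..<N}. N - i) = (\<Prod>i\<in>{0..<N}. N - i)"
      using n by (intro prod.atLeastLessThan_concat) auto
    moreover have "(\<Prod>i\<in>{0..<N}. N - i) = fact N"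
      using fact_prod_rev[of N, where 'a = nat] by simp
    ultimately show ?thesis unfolding card_injections by (metis of_nat_mult)
  qed
  finally have "Q N h = Q n f" by (simp del: of_nat_fact)
  then show ?thesis unfolding h_def S_def .
qed

theorem determinantal:
  assumes p: "\<And>x. x \<in> weyl_chamber N L \<Longrightarrow> p x \<ge> 0 \<and> of_real (p x) = Kdet N x"
    and P: "P = density (Leb N) (\<lambda>x. indicator (weyl_chamber N L) x * ennreal (p x))"
  shows "is_determinantal P N L K"
  unfolding is_determinantal_def is_correlation_function_def injections_def[symmetric]
proof (intro ballI allI impI)
  fix n and f :: "(nat \<Rightarrow> real) \<Rightarrow> real"
  assume n: "n \<in> {1..N}" and f: "f \<in> borel_measurable (Leb n)" and "\<exists>B. \<forall>y. \<bar>f y\<bar> \<le> B"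
  then obtain B where B: "\<And>y. \<bar>f y\<bar> \<le> B" by blast
  let ?W = "weyl_chamber N L"
  define S where "S x = (\<Sum>j\<in>injections n. f (\<lambda>k\<in>{1..n}. x (j k)))" for x
  have S_meas [measurable]: "S \<in> borel_measurable (Leb N)"
    unfolding S_def by (intro borel_measurable_sum measurable_injection f)
  \<comment> \<open>The hypotheses control \<open>p\<close> on the chamber only; \<open>g\<close> is
    a measurable function on the whole space with the same density.\<close>
  define g where "g x = indicator ?W x * Re (Kdet N x)" for x
  have g_meas: "g \<in> borel_measurable (Leb N)" unfolding g_def by measurable
  have Re: "Re (Kdet N x) = p x" if "x \<in> ?W" for x using p[OF that] by (metis Re_complex_of_real)
  have g0: "g x \<ge> 0" for x using p[of x] Re[of x] by (auto simp: g_def indicator_def)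
  have "P = density (Leb N) (\<lambda>x. ennreal (g x))"
    unfolding P g_def by (rule arg_cong[where f = "density (Leb N)"]) (auto simp: fun_eq_iff indicator_def Re)
  then have "(\<integral>x. S x \<partial>P) = (\<integral>x. g x *\<^sub>R S x \<partial>Leb N)"
    using integral_density[OF S_meas g_meas] g0 by simp
  then have "complex_of_real (\<integral>x. S x \<partial>P) = (\<integral>x. complex_of_real (g x *\<^sub>R S x) \<partial>Leb N)"
    by (simp only: integral_complex_of_real)
  also have "\<dots> = Q N (\<lambda>x. indicator ?W x * S x)"
    unfolding Q_def
  proof (rule Bochner_Integration.integral_cong[OF refl])
    fix x
    show "complex_of_real (g x *\<^sub>R S x) = indicat_real (box N) x *\<^sub>R (complex_of_real (indicator ?W x * S x) * Kdet N x)"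
    proof (cases "x \<in> ?W")
      case True
      then have "x \<in> box N" using weyl_chamber_subset_box by blast
      then show ?thesis using True p[OF True] by (simp add: g_def Re[OF True] mult.commute)
    next
      case False
      then show ?thesis by (simp add: g_def)
    qed
  qed
  also have "\<dots> = Q n f"
    unfolding S_def by (rule Q_weyl_chamber[OF _ f B]) (use n in simp)
  also have "\<dots> = (\<integral>y. of_real (f y) * (if y \<in> box n then det (mat n n (\<lambda>(j, k). K (y (Suc j)) (y (Suc k)))) else 0) \<partial>Leb n)"
    unfolding Q_def Kdet_def by (intro Bochner_Integration.integral_cong refl) (simp add: indicator_def)
  finally show "complex_of_real (\<integral>x. (\<Sum>j\<in>injections n. f (\<lambda>k\<in>{1..n}. x (j k))) \<partial>P) =
     (\<integral>y. of_real (f y) * (if y \<in> box n then det (mat n n (\<lambda>(j, k). K (y (Suc j)) (y (Suc k)))) else 0) \<partial>Leb n)"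
    unfolding S_def .
qed

end

text \<open>The kernel matrix is the transpose of one evaluation matrix times the other, so
  multiplicativity of the determinant applies.\<close>

lemma det_mult_det_eq_kernel:
  fixes \<phi> \<psi> :: "nat \<Rightarrow> real \<Rightarrow> complex"
  shows "det (mat N N (\<lambda>(j, k). \<psi> (Suc j) (x (Suc k)))) * det (mat N N (\<lambda>(j, k). \<phi> (Suc j) (x (Suc k)))) =
    det (mat N N (\<lambda>(j, k). \<Sum>i\<in>{1..N}. \<phi> i (x (Suc j)) * \<psi> i (x (Suc k))))"
proof -
  define A where "A = mat N N (\<lambda>(j, k). \<phi> (Suc j) (x (Suc k)))"
  define B where "B = mat N N (\<lambda>(j, k). \<psi> (Suc j) (x (Suc k)))"
  have A: "A \<in> carrier_mat N N" and B: "B \<in> carrier_mat N N" by (auto simp: A_def B_def)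
  have "A\<^sup>T * B = mat N N (\<lambda>(j, k). \<Sum>i\<in>{1..N}. \<phi> i (x (Suc j)) * \<psi> i (x (Suc k)))"
  proof (rule eq_matI)
    fix j k assume "j < dim_row (mat N N (\<lambda>(j, k). \<Sum>i\<in>{1..N}. \<phi> i (x (Suc j)) * \<psi> i (x (Suc k))))"
      "k < dim_col (mat N N (\<lambda>(j, k). \<Sum>i\<in>{1..N}. \<phi> i (x (Suc j)) * \<psi> i (x (Suc k))))"
    then have jk: "j < N" "k < N" by auto
    have "(A\<^sup>T * B) $$ (j, k) = (\<Sum>i\<in>{0..<N}. \<phi> (Suc i) (x (Suc j)) * \<psi> (Suc i) (x (Suc k)))"
      using jk by (simp add: A_def B_def scalar_prod_def)
    also have "\<dots> = (\<Sum>i\<in>{1..N}. \<phi> i (x (Suc j)) * \<psi> i (x (Suc k)))"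
      by (rule sum.reindex_bij_witness[of _ "\<lambda>i. i - 1" Suc]) auto
    finally show "(A\<^sup>T * B) $$ (j, k) = mat N N (\<lambda>(j, k). \<Sum>i\<in>{1..N}. \<phi> i (x (Suc j)) * \<psi> i (x (Suc k))) $$ (j, k)"
      using jk by simp
  qed (auto simp: A_def B_def)
  moreover have "det (A\<^sup>T * B) = det A * det B"
    using A B by (simp add: det_mult[of _ N] det_transpose)
  ultimately show ?thesis by (simp add: A_def B_def mult.commute)
qed

section \<open>Application to the seven root systems\<close>

theorem theorem3p3:
  fixes R :: root_sys and N :: nat and r ts t :: real
  assumes "N \<ge> 1" and "R = RD \<Longrightarrow> N \<ge> 2"
    and "r > 0" and "0 < ts" and "0 < t" and "t < ts"
  shows "is_determinantal (Pmeas R N r ts t) N (Ldom R r) (Kker R N r ts t)"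
proof -
  interpret rs: root_system R N
    by standard (use assms in auto)
  have r: "r > 0" and t: "t > 0" "ts - t > 0" using assms by auto
  define m where "m n = mconst R N r ts n" for n
  \<comment> \<open>All normalising constants are placed in \<open>\<phi>\<close>, which turns
    biorthogonality into biorthonormality and makes the abstract kernel equal to
    \<open>Kker\<close>.\<close>
  define \<phi> where "\<phi> n x = Mfun R N r n x t / m n" for n x
  define \<psi> where "\<psi> n x = cnj (Mfun R N r n x (ts - t))" for n x
  have m: "\<exists>c>0. m n = of_real c" for n
    using rs.mconst_pos[OF r \<open>0 < ts\<close>, of n] unfolding m_def by metis
  then have m0: "m n \<noteq> 0" for n by (metis less_irrefl of_real_eq_0_iff)
  have cont: "continuous_on UNIV (\<phi> n)" "continuous_on UNIV (\<psi> n)" for n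
    unfolding \<phi>_def \<psi>_def using m0 r t by (auto intro!: continuous_intros rs.continuous_on_Mfun)
  have bdd: "\<exists>B. \<forall>x\<in>Ldom R r. norm (u x) \<le> B" if "continuous_on UNIV u" for u :: "real \<Rightarrow> complex"
  proof -
    have "compact (u ` {0..2 * pi * r})"
      by (rule compact_continuous_image[OF continuous_on_subset[OF that]]) auto
    then obtain B where "\<forall>y\<in>u ` {0..2 * pi * r}. norm y \<le> B"
      using compact_imp_bounded bounded_iff by metis
    moreover have "Ldom R r \<subseteq> {0..2 * pi * r}"
      using r by (auto simp: Ldom_def intro: order_trans)
    ultimately show ?thesis by blast
  qed
  interpret be: biorthogonal_ensemble N "Ldom R r" \<phi> \<psi>
  proof
    show "Ldom R r \<in> sets borel" by (simp add: Ldom_def)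
    show "emeasure lborel (Ldom R r) < \<infinity>" using r by (simp add: Ldom_def)
    show "\<phi> i \<in> borel_measurable borel" "\<psi> i \<in> borel_measurable borel" for i
      using cont by (auto intro: borel_measurable_continuous_onI)
    show "\<exists>B. \<forall>x\<in>Ldom R r. norm (\<phi> i x) \<le> B" "\<exists>B. \<forall>x\<in>Ldom R r. norm (\<psi> i x) \<le> B" for i
      by (rule bdd[OF cont(1)], rule bdd[OF cont(2)])
    fix i j assume ij: "i \<in> {1..N}" "j \<in> {1..N}"
    have "(LINT x:Ldom R r|lborel. \<phi> i x * \<psi> j x) =
        (LINT x:Ldom R r|lborel. (1 / m i) * (Mfun R N r i x t * cnj (Mfun R N r j x (ts - t))))"
      by (simp add: \<phi>_def \<psi>_def)
    also have "\<dots> = (1 / m i) * (LINT x:Ldom R r|lborel. Mfun R N r i x t * cnj (Mfun R N r j x (ts - t)))"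
      by (rule set_integral_mult_right)
    also have "\<dots> = (if i = j then 1 else 0)"
      unfolding rs.Mfun_biorthogonal[OF r t ij] using m0[of i] by (cases "i = j") (simp_all add: m_def)
    finally show "(LINT x:Ldom R r|lborel. \<phi> i x * \<psi> j x) = (if i = j then 1 else 0)" .
  qed
  have K: "be.K = Kker R N r ts t"
    by (auto simp: fun_eq_iff be.K_def Kker_def \<phi>_def \<psi>_def m_def)
  have prod_m: "(\<Prod>n\<in>{1..N}. mconst R N r ts n) = (\<Prod>i<N. m (Suc i))"
    unfolding m_def by (rule prod.reindex_bij_witness[of _ Suc "\<lambda>n. n - 1"]) auto
  \<comment> \<open>Pulling the constants out of the rows of one determinant produces exactly the
    product by which the density is normalised.\<close>
  have q: "qfun R N r ts t x / (\<Prod>n\<in>{1..N}. mconst R N r ts n) = be.Kdet N x" for x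
  proof -
    have "det (mat N N (\<lambda>(l, k). Mfun R N r (Suc l) (x (Suc k)) t)) = (\<Prod>i<N. m (Suc i)) * det (mat N N (\<lambda>(l, k). \<phi> (Suc l) (x (Suc k))))"
      using det_scale_rows[of N "\<lambda>i. m (Suc i)" "\<lambda>l k. \<phi> (Suc l) (x (Suc k))"] m0 by (simp add: \<phi>_def)
    then have "qfun R N r ts t x = (\<Prod>i<N. m (Suc i)) *
        (det (mat N N (\<lambda>(j, k). \<psi> (Suc j) (x (Suc k)))) * det (mat N N (\<lambda>(j, k). \<phi> (Suc j) (x (Suc k)))))"
      unfolding qfun_def \<psi>_def by simp
    also have "\<dots> = (\<Prod>i<N. m (Suc i)) * be.Kdet N x"
      unfolding det_mult_det_eq_kernel be.Kdet_def be.K_def ..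
    finally show ?thesis unfolding prod_m using m0 by simp
  qed
  have S: "Sdom R N r = weyl_chamber N (Ldom R r)" by (rule Sdom_eq[OF assms(1)])
  \<comment> \<open>Nonnegativity ensures that neither the real part in \<open>pdens\<close> nor the
    truncation by \<open>ennreal\<close> alters the density.\<close>
  have p: "pdens R N r ts t x \<ge> 0 \<and> of_real (pdens R N r ts t x) = be.Kdet N x" if x: "x \<in> weyl_chamber N (Ldom R r)" for x
  proof -
    have "qfun R N r ts t x \<in> \<real>\<^sub>\<ge>\<^sub>0"
      using rs.qfun_nonneg[OF r t(1) \<open>t < ts\<close>] x S by simp
    moreover have "(\<Prod>n\<in>{1..N}. mconst R N r ts n) \<in> \<real>\<^sub>\<ge>\<^sub>0"
    proof -
      obtain c where c: "\<And>n. c n > 0 \<and> m n = of_real (c n)" using m by metis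
      have "(\<Prod>n\<in>{1..N}. mconst R N r ts n) = of_real (\<Prod>n\<in>{1..N}. c n)"
        using c by (simp add: m_def)
      moreover have "(\<Prod>n\<in>{1..N}. c n) \<ge> 0" using c by (intro prod_nonneg) (auto intro: less_imp_le)
      ultimately show ?thesis by (simp only: nonneg_Reals_of_real_iff)
    qed
    ultimately have "be.Kdet N x \<in> \<real>\<^sub>\<ge>\<^sub>0"
      unfolding q[symmetric] by (rule nonneg_Reals_divide_I)
    then obtain c where "c \<ge> 0" "be.Kdet N x = of_real c" by (auto elim: nonneg_Reals_cases)
    then show ?thesis unfolding pdens_def q by simp
  qed
  have "is_determinantal (Pmeas R N r ts t) N (Ldom R r) be.K"
    by (rule be.determinantal[OF p]) (simp_all add: Pmeas_def S)
  then show ?thesis unfolding K .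
qed

end
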